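(* Let $G$ be a locally compact group, let $1<p<\infty$, and let $E$ be either $L^{p}(G)$ or $L^{1}(G)^{**}$, regarded as a Banach left $L^{1}(G)$-module. Then $E$ is 0-injective as a Banach left $L^1(G)$-module.
   Context: $L^1(G)$ is the group algebra of $G$ (with respect to left Haar measure) with convolution product. $L^p(G)$ is a left $L^1(G)$-module by convolution, $f\cdot g=f*g$. For a Banach left $A$-module $E$, the dual $E^*$ is a Banach right $A$-module by $(f\cdot a)(x)=f(a\cdot x)$, and for a Banach right $A$-module $E$, the dual $E^*$ is a Banach left $A$-module by $(a\cdot f)(x)=f(x\cdot a)$; $L^1(G)^{**}$ carries the left module structure obtained by dualizing the left module $L^1(G)$ twice. For a Banach algebra $A$, let $A\textbf{-mod}$ denote the category of all Banach left $A$-modules. For $E,F\in A\textbf{-mod}$, $B(E,F)$ denotes the bounded linear operators from $E$ to $F$, and ${}_{A}B(E,F)$ denotes the space of all bounded linear left $A$-module morphisms from $E$ into $F$. For Banach spaces $E,F$, an operator $T\in B(E,F)$ is admissible if there exists $S\in B(F,E)$ with $T\circ S\circ T=T$. A monomorphism in $A\textbf{-mod}$ is an injective element of ${}_{A}B(F,K)$. A module $E\in A\textbf{-mod}$ is called (left) 0-injective if for all $F,K\in A\textbf{-mod}$ and every admissible monomorphism $T\in {}_{A}B(F,K)$ with $A\cdot K=\mathrm{span}\{a\cdot k: a\in A,\ k\in K\}\subseteq \mathrm{Im}\,T$, the induced map $T_{E}:{}_{A}B(K,E)\to {}_{A}B(F,E)$, $T_{E}(R)=R\circ T$, is onto. 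*)

theory Defs
  imports "HOL-Analysis.Analysis" "HOL-Algebra.Module"
begin

section \<open>Complex Banach spaces and Banach modules\<close>

text \<open>
  The spaces attached to a group depend on terms (a Haar measure, an exponent), so Banach spaces
  are structures with an explicit carrier. They extend the module records of HOL-Algebra, taken
  over the ring of complex numbers. In a space that is not an algebra the record fields
  \<open>mult\<close> and \<open>one\<close> are meaningless; no definition below reads \<open>one\<close>, since Banach algebras are
  not assumed unital.
\<close>

definition complex_ring :: "complex ring" where
  "complex_ring = \<lparr>carrier = UNIV, mult = (*), one = 1, zero = 0, add = (+)\<rparr>"

lemma cring_complex_ring: "cring complex_ring"
proof (rule cringI)
  show "abelian_group complex_ring"
    by (rule abelian_groupI)
      (auto simp: complex_ring_def algebra_simps intro: exI[of _ "- x" for x] add.left_inverse)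
  show "comm_monoid complex_ring"
    by (rule comm_monoidI) (auto simp: complex_ring_def)
qed (auto simp: complex_ring_def algebra_simps)

record 'v normed_cspace = "(complex, 'v) module" +
  nrm :: "'v \<Rightarrow> real"

locale complex_normed_space = module complex_ring V for V :: "('v, 'm) normed_cspace_scheme" +
  assumes nrm_nonneg: "x \<in> carrier V \<Longrightarrow> 0 \<le> nrm V x"
    and nrm_eq_0_iff: "x \<in> carrier V \<Longrightarrow> nrm V x = 0 \<longleftrightarrow> x = \<zero>\<^bsub>V\<^esub>"
    and nrm_triangle:
      "\<lbrakk>x \<in> carrier V; y \<in> carrier V\<rbrakk> \<Longrightarrow> nrm V (x \<oplus>\<^bsub>V\<^esub> y) \<le> nrm V x + nrm V y"
    and nrm_smult: "x \<in> carrier V \<Longrightarrow> nrm V (c \<odot>\<^bsub>V\<^esub> x) = cmod c * nrm V x"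

locale complex_banach_space = complex_normed_space V for V :: "('v, 'm) normed_cspace_scheme" +
  assumes complete:
    "\<lbrakk>\<And>n. s n \<in> carrier V;
      \<And>e. e > 0 \<Longrightarrow> \<exists>N. \<forall>m\<ge>N. \<forall>n\<ge>N. nrm V (s m \<ominus>\<^bsub>V\<^esub> s n) < e\<rbrakk>
     \<Longrightarrow> \<exists>l\<in>carrier V. (\<lambda>n::nat. nrm V (s n \<ominus>\<^bsub>V\<^esub> l)) \<longlonglongrightarrow> 0"

locale banach_algebra = complex_banach_space A for A :: "('a, 'm) normed_cspace_scheme" +
  assumes mult_closed:
      "\<lbrakk>a \<in> carrier A; b \<in> carrier A\<rbrakk> \<Longrightarrow> a \<otimes>\<^bsub>A\<^esub> b \<in> carrier A"
    and mult_assoc: "\<lbrakk>a \<in> carrier A; b \<in> carrier A; c \<in> carrier A\<rbrakk>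
      \<Longrightarrow> (a \<otimes>\<^bsub>A\<^esub> b) \<otimes>\<^bsub>A\<^esub> c = a \<otimes>\<^bsub>A\<^esub> (b \<otimes>\<^bsub>A\<^esub> c)"
    and mult_add_left: "\<lbrakk>a \<in> carrier A; b \<in> carrier A; c \<in> carrier A\<rbrakk>
      \<Longrightarrow> (a \<oplus>\<^bsub>A\<^esub> b) \<otimes>\<^bsub>A\<^esub> c = a \<otimes>\<^bsub>A\<^esub> c \<oplus>\<^bsub>A\<^esub> b \<otimes>\<^bsub>A\<^esub> c"
    and mult_add_right: "\<lbrakk>a \<in> carrier A; b \<in> carrier A; c \<in> carrier A\<rbrakk>
      \<Longrightarrow> a \<otimes>\<^bsub>A\<^esub> (b \<oplus>\<^bsub>A\<^esub> c) = a \<otimes>\<^bsub>A\<^esub> b \<oplus>\<^bsub>A\<^esub> a \<otimes>\<^bsub>A\<^esub> c"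
    and mult_smult_left: "\<lbrakk>a \<in> carrier A; b \<in> carrier A\<rbrakk>
      \<Longrightarrow> (k \<odot>\<^bsub>A\<^esub> a) \<otimes>\<^bsub>A\<^esub> b = k \<odot>\<^bsub>A\<^esub> (a \<otimes>\<^bsub>A\<^esub> b)"
    and mult_smult_right: "\<lbrakk>a \<in> carrier A; b \<in> carrier A\<rbrakk>
      \<Longrightarrow> a \<otimes>\<^bsub>A\<^esub> (k \<odot>\<^bsub>A\<^esub> b) = k \<odot>\<^bsub>A\<^esub> (a \<otimes>\<^bsub>A\<^esub> b)"
    and nrm_mult: "\<lbrakk>a \<in> carrier A; b \<in> carrier A\<rbrakk>
      \<Longrightarrow> nrm A (a \<otimes>\<^bsub>A\<^esub> b) \<le> nrm A a * nrm A b"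

text \<open>
  In a left module \<open>act M a x\<close> stands for \<open>a \<cdot> x\<close>, in a right module for \<open>x \<cdot> a\<close>.
\<close>

record ('a, 'v) banach_act = "'v normed_cspace" +
  act :: "'a \<Rightarrow> 'v \<Rightarrow> 'v"

locale banach_left_module = A: banach_algebra A + E: complex_banach_space E
  for A :: "('a, 'm) normed_cspace_scheme" and E :: "('a, 'e) banach_act" +
  assumes act_closed: "\<lbrakk>a \<in> carrier A; x \<in> carrier E\<rbrakk> \<Longrightarrow> act E a x \<in> carrier E"
    and act_mult: "\<lbrakk>a \<in> carrier A; b \<in> carrier A; x \<in> carrier E\<rbrakk>
      \<Longrightarrow> act E (a \<otimes>\<^bsub>A\<^esub> b) x = act E a (act E b x)"
    and act_add_left: "\<lbrakk>a \<in> carrier A; b \<in> carrier A; x \<in> carrier E\<rbrakk>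
      \<Longrightarrow> act E (a \<oplus>\<^bsub>A\<^esub> b) x = act E a x \<oplus>\<^bsub>E\<^esub> act E b x"
    and act_add_right: "\<lbrakk>a \<in> carrier A; x \<in> carrier E; y \<in> carrier E\<rbrakk>
      \<Longrightarrow> act E a (x \<oplus>\<^bsub>E\<^esub> y) = act E a x \<oplus>\<^bsub>E\<^esub> act E a y"
    and act_smult_left: "\<lbrakk>a \<in> carrier A; x \<in> carrier E\<rbrakk>
      \<Longrightarrow> act E (k \<odot>\<^bsub>A\<^esub> a) x = k \<odot>\<^bsub>E\<^esub> act E a x"
    and act_smult_right: "\<lbrakk>a \<in> carrier A; x \<in> carrier E\<rbrakk>
      \<Longrightarrow> act E a (k \<odot>\<^bsub>E\<^esub> x) = k \<odot>\<^bsub>E\<^esub> act E a x"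
    and act_bounded:
      "\<exists>C. \<forall>a\<in>carrier A. \<forall>x\<in>carrier E. nrm E (act E a x) \<le> C * nrm A a * nrm E x"


section \<open>Operators, duals and 0-injectivity\<close>

text \<open>
  Operators are extensional (\<open>undefined\<close> outside the carrier of the domain), so that equality of
  operators is equality of HOL functions.
\<close>

definition bounded_ops ::
    "('v, 'm) normed_cspace_scheme \<Rightarrow> ('w, 'n) normed_cspace_scheme \<Rightarrow> ('v \<Rightarrow> 'w) set" where
  "bounded_ops V W = {T \<in> carrier V \<rightarrow>\<^sub>E carrier W.
     (\<forall>x\<in>carrier V. \<forall>y\<in>carrier V. T (x \<oplus>\<^bsub>V\<^esub> y) = T x \<oplus>\<^bsub>W\<^esub> T y) \<and>
     (\<forall>c. \<forall>x\<in>carrier V. T (c \<odot>\<^bsub>V\<^esub> x) = c \<odot>\<^bsub>W\<^esub> T x) \<and>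
     (\<exists>C. \<forall>x\<in>carrier V. nrm W (T x) \<le> C * nrm V x)}"

definition module_ops ::
    "('a, 'm) normed_cspace_scheme \<Rightarrow> ('a, 'v) banach_act \<Rightarrow> ('a, 'w) banach_act
      \<Rightarrow> ('v \<Rightarrow> 'w) set" where
  "module_ops A F K = {T \<in> bounded_ops F K.
     \<forall>a\<in>carrier A. \<forall>x\<in>carrier F. T (act F a x) = act K a (T x)}"

definition admissible ::
    "('v, 'm) normed_cspace_scheme \<Rightarrow> ('w, 'n) normed_cspace_scheme \<Rightarrow> ('v \<Rightarrow> 'w) \<Rightarrow> bool" where
  "admissible V W T \<longleftrightarrow> T \<in> bounded_ops V W \<and>
     (\<exists>S\<in>bounded_ops W V. \<forall>x\<in>carrier V. T (S (T x)) = T x)"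

definition cspan :: "('v, 'm) normed_cspace_scheme \<Rightarrow> 'v set \<Rightarrow> 'v set" where
  "cspan V X = (\<lambda>W. submodule W complex_ring V) hull X"

text \<open>
  A definition cannot quantify over types, so the types underlying the test modules \<open>F\<close> and \<open>K\<close>
  are parameters. The property of the literature is
  \<open>zero_injective TYPE('f) TYPE('k) A E\<close> for all types \<open>'f\<close> and \<open>'k\<close>, that is, with both left as
  type variables in a theorem.
\<close>

definition zero_injective ::
    "'f itself \<Rightarrow> 'k itself \<Rightarrow> ('a, 'm) normed_cspace_scheme \<Rightarrow> ('a, 'e) banach_act \<Rightarrow> bool" where
  "zero_injective _ _ A E \<longleftrightarrow> banach_left_module A E \<and>
     (\<forall>(F :: ('a, 'f) banach_act) (K :: ('a, 'k) banach_act) T.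
        banach_left_module A F \<and> banach_left_module A K \<and>
        T \<in> module_ops A F K \<and> inj_on T (carrier F) \<and> admissible F K T \<and>
        cspan K {act K a k | a k. a \<in> carrier A \<and> k \<in> carrier K} \<subseteq> T ` carrier F \<longrightarrow>
        (\<lambda>R. compose (carrier F) R T) ` module_ops A K E = module_ops A F E)"

definition complex_space :: "complex normed_cspace" where
  "complex_space = \<lparr>carrier = UNIV, mult = (*), one = 1, zero = 0, add = (+),
     smult = (*), nrm = cmod\<rparr>"

text \<open>
  With the convention for \<open>act\<close>, the formulas \<open>(f \<cdot> a)(x) = f(a \<cdot> x)\<close> for the dual of a left module
  and \<open>(a \<cdot> f)(x) = f(x \<cdot> a)\<close> for the dual of a right module are one and the same. Thus
  \<open>dual_module\<close> turns left modules into right modules and right modules into left modules.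
\<close>

definition dual_module :: "('a, 'v) banach_act \<Rightarrow> ('a, 'v \<Rightarrow> complex) banach_act" where
  "dual_module M = \<lparr>
     carrier = bounded_ops M complex_space,
     mult = undefined,
     one = undefined,
     zero = (\<lambda>x\<in>carrier M. 0),
     add = (\<lambda>f g. \<lambda>x\<in>carrier M. f x + g x),
     smult = (\<lambda>c f. \<lambda>x\<in>carrier M. c * f x),
     nrm = (\<lambda>f. SUP x\<in>{x \<in> carrier M. nrm M x \<le> 1}. cmod (f x)),
     act = (\<lambda>a f. \<lambda>x\<in>carrier M. f (act M a x))\<rparr>"


section \<open>Haar measure, Lebesgue spaces and convolution\<close>

text \<open>
  The class \<^class>\<open>topological_group_add\<close> does not include commutativity: the group operation is
  written \<open>+\<close>, but the group is arbitrary.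
\<close>

locale left_haar_measure =
  fixes \<mu> :: "'g::{topological_group_add, t2_space} measure"
  assumes sets_eq_borel: "sets \<mu> = sets borel"
    and left_invariant: "A \<in> sets borel \<Longrightarrow> emeasure \<mu> ((+) g ` A) = emeasure \<mu> A"
    and nonzero: "emeasure \<mu> UNIV \<noteq> 0"
    and finite_on_compact: "compact K \<Longrightarrow> emeasure \<mu> K < \<infinity>"
    and outer_regular:
      "A \<in> sets borel \<Longrightarrow> emeasure \<mu> A = (INF U\<in>{U. open U \<and> A \<subseteq> U}. emeasure \<mu> U)"
    and inner_regular:
      "open U \<Longrightarrow> emeasure \<mu> U = (SUP K\<in>{K. compact K \<and> K \<subseteq> U}. emeasure \<mu> K)"

definition ae_class :: "'g measure \<Rightarrow> ('g \<Rightarrow> complex) \<Rightarrow> ('g \<Rightarrow> complex) set" where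
  "ae_class \<mu> f = {g \<in> borel_measurable \<mu>. AE x in \<mu>. g x = f x}"

definition ae_rep :: "('g \<Rightarrow> complex) set \<Rightarrow> 'g \<Rightarrow> complex" where
  "ae_rep X = (SOME f. f \<in> X)"

text \<open>
  In multiplicative notation this is \<open>(f * g)(x) = \<integral> f(y) g(y\<inverse>x) dy\<close>. The Bochner integral is \<open>0\<close>
  where the integrand fails to be integrable; for \<open>f \<in> L\<^sup>1\<close> and \<open>g \<in> L\<^sup>p\<close> that is a null set
  of \<open>x\<close>.
\<close>

definition convolution ::
    "'g::group_add measure \<Rightarrow> ('g \<Rightarrow> complex) \<Rightarrow> ('g \<Rightarrow> complex) \<Rightarrow> 'g \<Rightarrow> complex" where
  "convolution \<mu> f g x = (\<integral>y. f y * g (- y + x) \<partial>\<mu>)"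

definition ae_convolution ::
    "'g::group_add measure \<Rightarrow> ('g \<Rightarrow> complex) set \<Rightarrow> ('g \<Rightarrow> complex) set
      \<Rightarrow> ('g \<Rightarrow> complex) set" where
  "ae_convolution \<mu> X Y = ae_class \<mu> (convolution \<mu> (ae_rep X) (ae_rep Y))"

definition Lp_functions :: "real \<Rightarrow> 'g measure \<Rightarrow> ('g \<Rightarrow> complex) set" where
  "Lp_functions p \<mu> = {f \<in> borel_measurable \<mu>. integrable \<mu> (\<lambda>x. cmod (f x) powr p)}"

definition Lp_space :: "real \<Rightarrow> 'g measure \<Rightarrow> ('g \<Rightarrow> complex) set normed_cspace" where
  "Lp_space p \<mu> = \<lparr>
     carrier = ae_class \<mu> ` Lp_functions p \<mu>,
     mult = undefined,
     one = undefined,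
     zero = ae_class \<mu> (\<lambda>_. 0),
     add = (\<lambda>X Y. ae_class \<mu> (\<lambda>x. ae_rep X x + ae_rep Y x)),
     smult = (\<lambda>c X. ae_class \<mu> (\<lambda>x. c * ae_rep X x)),
     nrm = (\<lambda>X. (\<integral>x. cmod (ae_rep X x) powr p \<partial>\<mu>) powr (1 / p))\<rparr>"

definition group_algebra :: "'g::group_add measure \<Rightarrow> ('g \<Rightarrow> complex) set normed_cspace" where
  "group_algebra \<mu> = (Lp_space 1 \<mu>)\<lparr>mult := ae_convolution \<mu>\<rparr>"

definition Lp_module ::
    "real \<Rightarrow> 'g::group_add measure \<Rightarrow> (('g \<Rightarrow> complex) set, ('g \<Rightarrow> complex) set) banach_act" where
  "Lp_module p \<mu> =
     normed_cspace.extend (Lp_space p \<mu>) (banach_act.fields (ae_convolution \<mu>))"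

definition L1_bidual ::
    "'g::group_add measure
      \<Rightarrow> (('g \<Rightarrow> complex) set, (('g \<Rightarrow> complex) set \<Rightarrow> complex) \<Rightarrow> complex) banach_act" where
  "L1_bidual \<mu> = dual_module (dual_module (Lp_module 1 \<mu>))"

end

theory Submission
  imports Defs
begin

text \<open>
  Let \<open>T : F \<rightarrow> K\<close> be an admissible monomorphism with bounded left inverse \<open>S\<close> and let
  \<open>\<phi> : F \<rightarrow> E\<close> be a morphism. Since \<open>A \<cdot> K\<close> lies in the image of \<open>T\<close>, the operator
  \<open>\<theta> = \<phi> \<circ> S\<close> satisfies \<open>\<theta> (a \<cdot> b \<cdot> k) = a \<cdot> \<theta> (b \<cdot> k)\<close>. Along a two-sided bounded
  approximate identity \<open>(e)\<close> of \<open>L\<^sup>1(G)\<close>, a limit \<open>R k\<close> of \<open>\<theta> (e \<cdot> k)\<close> satisfies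
  \<open>a \<cdot> R k = \<theta> (a \<cdot> k)\<close>, and a correction annihilated by \<open>A\<close> turns \<open>R\<close> into an extension of
  \<open>\<phi>\<close>. In a dual module such as \<open>L\<^sup>1(G)\<^sup>*\<^sup>*\<close> the limit exists by weak-star compactness; in
  \<open>L\<^sup>p(G)\<close> it is obtained from uniform convexity, and is unique because \<open>L\<^sup>p(G)\<close> is
  faithful, hence linear in \<open>k\<close>.

  The group need not be \<open>\<sigma>\<close>-finite or second countable, so Fubini's theorem is used for continuous
  functions with compact support only, and convolutions of general functions are treated as limits.
\<close>

section \<open>Normed spaces, operators and duals\<close>

text \<open>The splitting \<open>S\<close> is only linear, but on \<open>A \<cdot> K\<close> it
  inverts the morphism \<open>T\<close> and is therefore equivariant there; this is where the
  condition on \<open>A \<cdot> K\<close> enters. The two halves of the approximate identity do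
  different work. Right units give \<open>a \<cdot> \<theta> (e \<cdot> k) = \<theta> ((a * e)
  \<cdot> k)\<close>, which tends to \<open>\<theta> (a \<cdot> k)\<close>. Left units identify
  \<open>R (a \<cdot> k)\<close> in the dual case, and in L^p they show that the module is faithful.
  The obstacle is linearity of the limit, since limits chosen for each \<open>k\<close> separately
  need not fit together; in a dual module one subfilter is therefore made to converge for all
  \<open>k\<close> at once. Treating L^p as a dual module as well would call for its duality with
  the conjugate exponent, over a measure that need not be \<sigma>-finite; uniform convexity uses
  the norm alone.\<close>

context complex_normed_space
begin

lemma smult_closed' [simp, intro]: "x \<in> carrier V \<Longrightarrow> c \<odot>\<^bsub>V\<^esub> x \<in> carrier V"
  using smult_closed[of c x] by (simp add: complex_ring_def)

lemma smult_add_left: "x \<in> carrier V \<Longrightarrow> (c + d) \<odot>\<^bsub>V\<^esub> x = c \<odot>\<^bsub>V\<^esub> x \<oplus>\<^bsub>V\<^esub> d \<odot>\<^bsub>V\<^esub> x"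
  using smult_l_distr[of c d x] by (simp add: complex_ring_def)

lemma smult_add_right:
  "\<lbrakk>x \<in> carrier V; y \<in> carrier V\<rbrakk> \<Longrightarrow> c \<odot>\<^bsub>V\<^esub> (x \<oplus>\<^bsub>V\<^esub> y) = c \<odot>\<^bsub>V\<^esub> x \<oplus>\<^bsub>V\<^esub> c \<odot>\<^bsub>V\<^esub> y"
  using smult_r_distr[of c x y] by (simp add: complex_ring_def)

lemma smult_smult: "x \<in> carrier V \<Longrightarrow> c \<odot>\<^bsub>V\<^esub> (d \<odot>\<^bsub>V\<^esub> x) = (c * d) \<odot>\<^bsub>V\<^esub> x"
  using smult_assoc1[of c d x] by (simp add: complex_ring_def)

lemma one_smult [simp]: "x \<in> carrier V \<Longrightarrow> 1 \<odot>\<^bsub>V\<^esub> x = x"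
  using smult_one[of x] by (simp add: complex_ring_def)

lemma zero_smult [simp]: "x \<in> carrier V \<Longrightarrow> 0 \<odot>\<^bsub>V\<^esub> x = \<zero>\<^bsub>V\<^esub>"
  using smult_l_null[of x] by (simp add: complex_ring_def)

lemma minus_eq_smult: "x \<in> carrier V \<Longrightarrow> \<ominus>\<^bsub>V\<^esub> x = (-1) \<odot>\<^bsub>V\<^esub> x"
  using smult_add_left[of x 1 "-1"] by (simp add: M.minus_equality M.add.m_comm)

lemma diff_eq: "\<lbrakk>x \<in> carrier V; y \<in> carrier V\<rbrakk> \<Longrightarrow> x \<ominus>\<^bsub>V\<^esub> y = x \<oplus>\<^bsub>V\<^esub> (-1) \<odot>\<^bsub>V\<^esub> y"
  by (simp add: a_minus_def minus_eq_smult)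

lemma diff_closed [simp, intro]:
  "\<lbrakk>x \<in> carrier V; y \<in> carrier V\<rbrakk> \<Longrightarrow> x \<ominus>\<^bsub>V\<^esub> y \<in> carrier V"
  by (simp add: diff_eq)

lemma nrm_zero [simp]: "nrm V \<zero>\<^bsub>V\<^esub> = 0"
  using nrm_eq_0_iff[of "\<zero>\<^bsub>V\<^esub>"] by simp

lemma diff_self [simp]: "x \<in> carrier V \<Longrightarrow> x \<ominus>\<^bsub>V\<^esub> x = \<zero>\<^bsub>V\<^esub>"
  by (simp add: a_minus_def M.r_neg)

lemma diff_add_cancel:
  "\<lbrakk>x \<in> carrier V; y \<in> carrier V\<rbrakk> \<Longrightarrow> (x \<ominus>\<^bsub>V\<^esub> y) \<oplus>\<^bsub>V\<^esub> y = x"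
  by (simp add: a_minus_def M.a_assoc M.l_neg)

lemma add_diff_cancel:
  "\<lbrakk>x \<in> carrier V; y \<in> carrier V\<rbrakk> \<Longrightarrow> x \<oplus>\<^bsub>V\<^esub> (y \<ominus>\<^bsub>V\<^esub> x) = y"
  using diff_add_cancel[of y x] by (simp add: M.a_comm)

lemma nrm_diff_le:
  "\<lbrakk>x \<in> carrier V; y \<in> carrier V\<rbrakk> \<Longrightarrow> nrm V (x \<ominus>\<^bsub>V\<^esub> y) \<le> nrm V x + nrm V y"
  using nrm_triangle[of x "(-1) \<odot>\<^bsub>V\<^esub> y"] by (simp add: diff_eq nrm_smult)

lemma diff_eq_0_iff:
  "\<lbrakk>x \<in> carrier V; y \<in> carrier V\<rbrakk> \<Longrightarrow> x \<ominus>\<^bsub>V\<^esub> y = \<zero>\<^bsub>V\<^esub> \<longleftrightarrow> x = y"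
  using diff_add_cancel[of x y] by auto

lemma nrm_diff_eq_0_iff:
  "\<lbrakk>x \<in> carrier V; y \<in> carrier V\<rbrakk> \<Longrightarrow> nrm V (x \<ominus>\<^bsub>V\<^esub> y) = 0 \<longleftrightarrow> x = y"
  by (simp add: nrm_eq_0_iff diff_eq_0_iff)

lemma nrm_diff_triangle:
  assumes "x \<in> carrier V" "y \<in> carrier V" "z \<in> carrier V"
  shows "nrm V (x \<ominus>\<^bsub>V\<^esub> z) \<le> nrm V (x \<ominus>\<^bsub>V\<^esub> y) + nrm V (y \<ominus>\<^bsub>V\<^esub> z)"
proof -
  have "x \<ominus>\<^bsub>V\<^esub> z = (x \<ominus>\<^bsub>V\<^esub> y) \<oplus>\<^bsub>V\<^esub> (y \<ominus>\<^bsub>V\<^esub> z)"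
    using assms diff_add_cancel[of x y] by (simp add: a_minus_def M.a_assoc flip: M.a_assoc[of _ y])
  then show ?thesis using assms nrm_triangle by simp
qed

lemma nrm_diff_commute:
  assumes "x \<in> carrier V" "y \<in> carrier V"
  shows "nrm V (x \<ominus>\<^bsub>V\<^esub> y) = nrm V (y \<ominus>\<^bsub>V\<^esub> x)"
proof -
  have "x \<ominus>\<^bsub>V\<^esub> y = (-1) \<odot>\<^bsub>V\<^esub> (y \<ominus>\<^bsub>V\<^esub> x)"
    using assms by (simp add: diff_eq smult_add_right smult_smult M.a_comm)
  then show ?thesis using assms by (simp add: nrm_smult)
qed

lemma nrm_le_diff_add:
  assumes "x \<in> carrier V" "y \<in> carrier V"
  shows "nrm V x \<le> nrm V (x \<ominus>\<^bsub>V\<^esub> y) + nrm V y"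
  using nrm_triangle[of "x \<ominus>\<^bsub>V\<^esub> y" y] assms by (simp add: diff_add_cancel)

lemma eq_if_nrm_diff_small:
  assumes "x \<in> carrier V" "y \<in> carrier V" "\<And>e. e > 0 \<Longrightarrow> nrm V (x \<ominus>\<^bsub>V\<^esub> y) \<le> e"
  shows "x = y"
  using assms nrm_nonneg[of "x \<ominus>\<^bsub>V\<^esub> y"] nrm_diff_eq_0_iff[of x y]
  by (meson diff_closed dense_ge dual_order.antisym)

end

section \<open>Bounded operators and module morphisms\<close>

lemma bounded_opsI:
  assumes "T \<in> carrier V \<rightarrow>\<^sub>E carrier W"
    and "\<And>x y. \<lbrakk>x \<in> carrier V; y \<in> carrier V\<rbrakk> \<Longrightarrow> T (x \<oplus>\<^bsub>V\<^esub> y) = T x \<oplus>\<^bsub>W\<^esub> T y"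
    and "\<And>c x. x \<in> carrier V \<Longrightarrow> T (c \<odot>\<^bsub>V\<^esub> x) = c \<odot>\<^bsub>W\<^esub> T x"
    and "\<And>x. x \<in> carrier V \<Longrightarrow> nrm W (T x) \<le> C * nrm V x"
  shows "T \<in> bounded_ops V W"
  using assms unfolding bounded_ops_def by blast

lemma
  assumes "T \<in> bounded_ops V W"
  shows bounded_ops_extensional: "T \<in> extensional (carrier V)"
    and bounded_ops_closed: "x \<in> carrier V \<Longrightarrow> T x \<in> carrier W"
    and bounded_ops_add:
      "\<lbrakk>x \<in> carrier V; y \<in> carrier V\<rbrakk> \<Longrightarrow> T (x \<oplus>\<^bsub>V\<^esub> y) = T x \<oplus>\<^bsub>W\<^esub> T y"
    and bounded_ops_smult: "x \<in> carrier V \<Longrightarrow> T (c \<odot>\<^bsub>V\<^esub> x) = c \<odot>\<^bsub>W\<^esub> T x"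
  using assms by (auto simp: bounded_ops_def PiE_def)

lemma bounded_ops_diff:
  assumes "complex_normed_space V" "complex_normed_space W" "T \<in> bounded_ops V W"
    and "x \<in> carrier V" "y \<in> carrier V"
  shows "T (x \<ominus>\<^bsub>V\<^esub> y) = T x \<ominus>\<^bsub>W\<^esub> T y"
proof -
  interpret V: complex_normed_space V by fact
  interpret W: complex_normed_space W by fact
  show ?thesis
    using assms by (simp add: V.diff_eq W.diff_eq bounded_ops_closed bounded_ops_add
        bounded_ops_smult)
qed

text \<open>The constant in \<open>bounded_ops\<close> carries no sign. Raising it to at least 1
  makes it safe to multiply inequalities by it.\<close>

lemma bounded_ops_bound:
  assumes "complex_normed_space V" "T \<in> bounded_ops V W"
  obtains C where "C > 0" "\<And>x. x \<in> carrier V \<Longrightarrow> nrm W (T x) \<le> C * nrm V x"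
proof -
  interpret V: complex_normed_space V by fact
  obtain C where C: "\<forall>x\<in>carrier V. nrm W (T x) \<le> C * nrm V x"
    using assms(2) by (auto simp: bounded_ops_def)
  show ?thesis
  proof (rule that[of "max C 1"])
    fix x assume x: "x \<in> carrier V"
    have "nrm W (T x) \<le> C * nrm V x" using C x by auto
    also have "\<dots> \<le> max C 1 * nrm V x" using V.nrm_nonneg[OF x] by (intro mult_right_mono) auto
    finally show "nrm W (T x) \<le> max C 1 * nrm V x" .
  qed simp
qed

lemma bounded_ops_compose:
  assumes "complex_normed_space V" "complex_normed_space W"
    and "T \<in> bounded_ops V W" "R \<in> bounded_ops W U"
  shows "compose (carrier V) R T \<in> bounded_ops V U"
proof -
  interpret V: complex_normed_space V by fact
  obtain C where C: "C > 0" "\<And>x. x \<in> carrier V \<Longrightarrow> nrm W (T x) \<le> C * nrm V x"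
    using bounded_ops_bound assms(1,3) by blast
  obtain D where D: "D > 0" "\<And>x. x \<in> carrier W \<Longrightarrow> nrm U (R x) \<le> D * nrm W x"
    using bounded_ops_bound assms(2,4) by blast
  show ?thesis
  proof (rule bounded_opsI[where C = "D * C"])
    show "compose (carrier V) R T \<in> carrier V \<rightarrow>\<^sub>E carrier U"
      using assms(3,4) by (auto simp: compose_def bounded_ops_closed)
  next
    fix x assume x: "x \<in> carrier V"
    then show "compose (carrier V) R T (c \<odot>\<^bsub>V\<^esub> x) = c \<odot>\<^bsub>U\<^esub> compose (carrier V) R T x" for c
      using assms(3,4) by (simp add: compose_def bounded_ops_closed bounded_ops_smult)
    have "nrm U (R (T x)) \<le> D * nrm W (T x)"
      using D x assms(3) by (simp add: bounded_ops_closed)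
    also have "\<dots> \<le> D * (C * nrm V x)" using C(2)[OF x] D(1) by simp
    finally show "nrm U (compose (carrier V) R T x) \<le> D * C * nrm V x"
      using x by (simp add: compose_def mult.assoc)
  qed (use assms(3,4) in \<open>auto simp: compose_def bounded_ops_closed bounded_ops_add\<close>)
qed

section \<open>Extension along admissible monomorphisms\<close>

lemma module_ops_compose:
  assumes "complex_normed_space F" "complex_normed_space K"
    and act: "\<And>a x. \<lbrakk>a \<in> carrier A; x \<in> carrier F\<rbrakk> \<Longrightarrow> act F a x \<in> carrier F"
    and T: "T \<in> module_ops A F K" and R: "R \<in> module_ops A K E"
  shows "compose (carrier F) R T \<in> module_ops A F E"
  using assms bounded_ops_compose[OF assms(1,2), of T R E]
  by (auto simp: module_ops_def compose_def bounded_ops_closed)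

text \<open>
  Given an admissible monomorphism \<open>T\<close> with left inverse \<open>S\<close> and a morphism \<open>\<phi>\<close>, the operator
  \<open>\<theta> = \<phi> \<circ> S\<close> commutes with the action on \<open>A \<cdot> K\<close>. If \<open>R\<^sub>0\<close> is a morphism with
  \<open>a \<cdot> R\<^sub>0 k = \<theta> (a \<cdot> k)\<close>, then \<open>R\<^sub>0 + (\<phi> - R\<^sub>0 \<circ> T) \<circ> S\<close> extends \<open>\<phi>\<close>: the correction term
  takes values annihilated by \<open>A\<close> and vanishes on \<open>A \<cdot> K\<close>.
\<close>

lemma zero_injectiveI:
  fixes E :: "('a, 'e) banach_act"
  assumes E: "banach_left_module A E"
    and ext: "\<And>(K :: ('a, 'k) banach_act) \<theta>.
      \<lbrakk>banach_left_module A K; \<theta> \<in> bounded_ops K E;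
       \<And>a b k. \<lbrakk>a \<in> carrier A; b \<in> carrier A; k \<in> carrier K\<rbrakk>
         \<Longrightarrow> \<theta> (act K a (act K b k)) = act E a (\<theta> (act K b k))\<rbrakk>
      \<Longrightarrow> \<exists>R\<in>module_ops A K E. \<forall>a\<in>carrier A. \<forall>k\<in>carrier K. act E a (R k) = \<theta> (act K a k)"
  shows "zero_injective TYPE('f) TYPE('k) A E"
  unfolding zero_injective_def
proof (intro conjI allI impI E, elim conjE)
  fix F :: "('a, 'f) banach_act" and K :: "('a, 'k) banach_act" and T
  assume F: "banach_left_module A F" and K: "banach_left_module A K"
    and T: "T \<in> module_ops A F K" and inj: "inj_on T (carrier F)" and adm: "admissible F K T"
    and span: "cspan K {act K a k |a k. a \<in> carrier A \<and> k \<in> carrier K} \<subseteq> T ` carrier F"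
  interpret E: banach_left_module A E by fact
  interpret F: banach_left_module A F by fact
  interpret K: banach_left_module A K by fact
  have nF: "complex_normed_space F" and nK: "complex_normed_space K"
      and nE: "complex_normed_space E"
    by unfold_locales
  have Tb: "T \<in> bounded_ops F K"
    and Tact: "\<And>a x. a \<in> carrier A \<Longrightarrow> x \<in> carrier F \<Longrightarrow> T (act F a x) = act K a (T x)"
    using T by (auto simp: module_ops_def)
  obtain S where S: "S \<in> bounded_ops K F" and TST: "\<And>x. x \<in> carrier F \<Longrightarrow> T (S (T x)) = T x"
    using adm by (auto simp: admissible_def)
  \<comment> \<open>Admissibility gives only \<open>T S T = T\<close>; injectivity cancels the outer
    \<open>T\<close>.\<close>
  have ST: "S (T x) = x" if "x \<in> carrier F" for x
    using TST[OF that] inj that by (metis S Tb bounded_ops_closed inj_on_def)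
  have img: "\<exists>f\<in>carrier F. act K a k = T f" if "a \<in> carrier A" "k \<in> carrier K" for a k
  proof -
    have "act K a k \<in> cspan K {act K a k |a k. a \<in> carrier A \<and> k \<in> carrier K}"
      unfolding cspan_def using that by (intro subsetD[OF hull_subset]) auto
    then show ?thesis using span by auto
  qed
  show "(\<lambda>R. compose (carrier F) R T) ` module_ops A K E = module_ops A F E"
  proof (rule subset_antisym)
    show "(\<lambda>R. compose (carrier F) R T) ` module_ops A K E \<subseteq> module_ops A F E"
      using module_ops_compose[OF nF nK F.act_closed T] by auto
    show "module_ops A F E \<subseteq> (\<lambda>R. compose (carrier F) R T) ` module_ops A K E"
    proof
      fix \<phi> assume \<phi>: "\<phi> \<in> module_ops A F E"
      then have \<phi>b: "\<phi> \<in> bounded_ops F E"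
        and \<phi>act: "\<And>a x. a \<in> carrier A \<Longrightarrow> x \<in> carrier F \<Longrightarrow> \<phi> (act F a x) = act E a (\<phi> x)"
        by (auto simp: module_ops_def)
      define \<theta> where "\<theta> = compose (carrier K) \<phi> S"
      have \<theta>: "\<theta> \<in> bounded_ops K E"
        unfolding \<theta>_def by (rule bounded_ops_compose[OF nK nF S \<phi>b])
      have \<theta>T: "\<theta> (T f) = \<phi> f" if "f \<in> carrier F" for f
        using that Tb by (simp add: \<theta>_def compose_def bounded_ops_closed ST)
      \<comment> \<open>Both sides equal \<open>a \<cdot> \<phi> f\<close>, because \<open>T\<close>
        intertwines the actions and \<open>\<theta> \<circ> T = \<phi>\<close>. Elements of
        \<open>A \<cdot> K\<close> have the form \<open>T f\<close>, which yields the identity that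
        \<open>ext\<close> asks of \<open>\<theta>\<close>.\<close>
      have \<theta>act: "\<theta> (act K a (T f)) = act E a (\<theta> (T f))" if "a \<in> carrier A" "f \<in> carrier F" for a f
        using that \<theta>T F.act_closed by (simp flip: Tact add: \<phi>act)
      have "\<theta> (act K a (act K b k)) = act E a (\<theta> (act K b k))"
        if "a \<in> carrier A" "b \<in> carrier A" "k \<in> carrier K" for a b k
        using img[OF that(2,3)] \<theta>act[OF that(1)] by auto
      from ext[OF K \<theta> this] obtain R0 where R0: "R0 \<in> module_ops A K E"
        and aR0: "\<And>a k. a \<in> carrier A \<Longrightarrow> k \<in> carrier K \<Longrightarrow> act E a (R0 k) = \<theta> (act K a k)"
        by blast
      have R0b: "R0 \<in> bounded_ops K E"
        and R0act: "\<And>a x. a \<in> carrier A \<Longrightarrow> x \<in> carrier K \<Longrightarrow> R0 (act K a x) = act E a (R0 x)"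
        using R0 by (auto simp: module_ops_def)
      \<comment> \<open>The defect of \<open>R0\<close>: how far \<open>R0 \<circ> T\<close> is from
        \<open>\<phi>\<close>. Adding \<open>D \<circ> S\<close> repairs it on the image of
        \<open>T\<close>, where \<open>S\<close> undoes \<open>T\<close>.\<close>
      define D where "D f = \<phi> f \<ominus>\<^bsub>E\<^esub> R0 (T f)" for f
      note closed = bounded_ops_closed[OF \<phi>b] bounded_ops_closed[OF R0b] bounded_ops_closed[OF Tb]
        bounded_ops_closed[OF S]
      have D_closed [simp]: "D f \<in> carrier E" if "f \<in> carrier F" for f
        using that closed by (simp add: D_def)
      define R where "R = (\<lambda>k\<in>carrier K. R0 k \<oplus>\<^bsub>E\<^esub> D (S k))"
      obtain C1 where C1: "C1 > 0" "\<And>x. x \<in> carrier F \<Longrightarrow> nrm E (\<phi> x) \<le> C1 * nrm F x"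
        using bounded_ops_bound[OF nF \<phi>b] by blast
      obtain C2 where C2: "C2 > 0" "\<And>x. x \<in> carrier K \<Longrightarrow> nrm E (R0 x) \<le> C2 * nrm K x"
        using bounded_ops_bound[OF nK R0b] by blast
      obtain C3 where C3: "C3 > 0" "\<And>x. x \<in> carrier K \<Longrightarrow> nrm F (S x) \<le> C3 * nrm K x"
        using bounded_ops_bound[OF nK S] by blast
      obtain C4 where C4: "C4 > 0" "\<And>x. x \<in> carrier F \<Longrightarrow> nrm K (T x) \<le> C4 * nrm F x"
        using bounded_ops_bound[OF nF Tb] by blast
      have D_add: "D (x \<oplus>\<^bsub>F\<^esub> y) = D x \<oplus>\<^bsub>E\<^esub> D y" if "x \<in> carrier F" "y \<in> carrier F" for x y
        using that closed
        by (simp add: D_def bounded_ops_add[OF \<phi>b] bounded_ops_add[OF R0b] bounded_ops_add[OF Tb]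
            E.E.diff_eq E.E.smult_add_right E.E.add.m_ac)
      have D_smult: "D (c \<odot>\<^bsub>F\<^esub> x) = c \<odot>\<^bsub>E\<^esub> D x" if "x \<in> carrier F" for c x
        using that closed
        by (simp add: D_def bounded_ops_smult[OF \<phi>b] bounded_ops_smult[OF R0b]
            bounded_ops_smult[OF Tb] E.E.diff_eq E.E.smult_add_right E.E.smult_smult)
      \<comment> \<open>\<open>a \<cdot> R0 (T f) = \<theta> (a \<cdot> T f) = a \<cdot> \<phi>
        f\<close>, so the two terms of the defect agree once any \<open>a\<close> has acted.\<close>
      have D_act: "act E a (D f) = \<zero>\<^bsub>E\<^esub>" if "a \<in> carrier A" "f \<in> carrier F" for a f
      proof -
        have "act E a (D f) = act E a (\<phi> f) \<oplus>\<^bsub>E\<^esub> (-1) \<odot>\<^bsub>E\<^esub> act E a (R0 (T f))"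
          using that closed by (simp add: D_def E.E.diff_eq E.act_add_right E.act_smult_right)
        also have "\<dots> = act E a (\<phi> f) \<ominus>\<^bsub>E\<^esub> act E a (R0 (T f))"
          using that closed E.act_closed by (simp add: E.E.diff_eq)
        also have "act E a (R0 (T f)) = act E a (\<phi> f)"
          using that closed by (simp add: aR0 \<theta>act \<theta>T)
        finally show ?thesis using that closed E.act_closed by simp
      qed
      \<comment> \<open>On \<open>A \<cdot> K\<close> the operators \<open>R0\<close> and
        \<open>\<theta>\<close> coincide, and \<open>\<theta> (T f) = \<phi> f\<close>, so there is
        no defect.\<close>
      have D_img: "D (S (act K a k)) = \<zero>\<^bsub>E\<^esub>" if ak: "a \<in> carrier A" "k \<in> carrier K" for a k
      proof -
        obtain f where f: "f \<in> carrier F" "act K a k = T f" using img ak by blast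
        have "R0 (T f) = \<theta> (T f)" using aR0[OF ak] R0act[OF ak] f by simp
        then show ?thesis using f closed by (simp add: ST D_def \<theta>T)
      qed
      \<comment> \<open>The constant collects the bounds of \<open>R0\<close> (\<open>C2\<close>),
        of \<open>\<phi> \<circ> S\<close> (\<open>C1 * C3\<close>) and of
        \<open>R0 \<circ> T \<circ> S\<close> (\<open>C2 * C4 * C3\<close>).\<close>
      have "R \<in> bounded_ops K E"
      proof (rule bounded_opsI[where C = "C2 + (C1 + C2 * C4) * C3"])
        show "R \<in> carrier K \<rightarrow>\<^sub>E carrier E" using closed by (auto simp: R_def)
      next
        fix x y assume "x \<in> carrier K" "y \<in> carrier K"
        then show "R (x \<oplus>\<^bsub>K\<^esub> y) = R x \<oplus>\<^bsub>E\<^esub> R y" using closed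
          by (simp add: R_def bounded_ops_add[OF R0b] bounded_ops_add[OF S] D_add E.E.add.m_ac)
      next
        fix c x assume "x \<in> carrier K"
        then show "R (c \<odot>\<^bsub>K\<^esub> x) = c \<odot>\<^bsub>E\<^esub> R x" using closed
          by (simp add: R_def bounded_ops_smult[OF R0b] bounded_ops_smult[OF S] D_smult
              E.E.smult_add_right)
      next
        fix x assume x: "x \<in> carrier K"
        have Sx: "S x \<in> carrier F" using x closed by simp
        have "nrm E (R x) \<le> nrm E (R0 x) + nrm E (D (S x))"
          using x closed by (simp add: R_def E.E.nrm_triangle)
        also have "nrm E (D (S x)) \<le> nrm E (\<phi> (S x)) + nrm E (R0 (T (S x)))"
          unfolding D_def using x closed by (simp add: E.E.nrm_diff_le)
        finally have "nrm E (R x) \<le> nrm E (R0 x) + (nrm E (\<phi> (S x)) + nrm E (R0 (T (S x))))"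
          by simp
        moreover have "nrm E (\<phi> (S x)) \<le> C1 * (C3 * nrm K x)"
          by (rule order.trans[OF C1(2)[OF Sx] mult_left_mono[OF C3(2)[OF x]]]) (use C1(1) in simp)
        moreover have "nrm K (T (S x)) \<le> C4 * (C3 * nrm K x)"
          by (rule order.trans[OF C4(2)[OF Sx] mult_left_mono[OF C3(2)[OF x]]]) (use C4(1) in simp)
        then have "nrm E (R0 (T (S x))) \<le> C2 * (C4 * (C3 * nrm K x))"
          using C2(1) by (intro order.trans[OF C2(2) mult_left_mono]) (use closed Sx in auto)
        moreover have "nrm E (R0 x) \<le> C2 * nrm K x" using C2 x by simp
        ultimately show "nrm E (R x) \<le> (C2 + (C1 + C2 * C4) * C3) * nrm K x"
          by (simp add: algebra_simps)
      qed
      moreover have "R (act K a x) = act E a (R x)" if "a \<in> carrier A" "x \<in> carrier K" for a x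
        using that closed K.act_closed E.act_closed
        by (simp add: R_def D_img E.act_add_right D_act R0act)
      ultimately have "R \<in> module_ops A K E" by (simp add: module_ops_def)
      moreover have "compose (carrier F) R T = \<phi>"
      proof (rule extensionalityI)
        show "compose (carrier F) R T \<in> extensional (carrier F)" by (simp add: compose_def)
        show "\<phi> \<in> extensional (carrier F)" using \<phi>b by (rule bounded_ops_extensional)
        fix x assume x: "x \<in> carrier F"
        then show "compose (carrier F) R T x = \<phi> x"
          using closed by (simp add: compose_def R_def ST D_def E.E.add_diff_cancel)
      qed
      ultimately show "\<phi> \<in> (\<lambda>R. compose (carrier F) R T) ` module_ops A K E" by blast
    qed
  qed
qed

text \<open>Only these five fields enter the normed structure, so it can be moved between records
  that differ in the product or the action: an algebra and its opposite, \<open>Lp_space\<close>,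
  \<open>group_algebra\<close> and \<open>Lp_module\<close>.\<close>

lemma complex_normed_space_cong:
  assumes "complex_normed_space V"
    and eq: "carrier W = carrier V" "add W = add V" "zero W = zero V" "smult W = smult V"
      "nrm W = nrm V"
  shows "complex_normed_space W"
proof -
  interpret V: complex_normed_space V by fact
  have "abelian_group W"
  proof (rule abelian_groupI)
    fix x assume "x \<in> carrier W"
    then show "\<exists>y\<in>carrier W. y \<oplus>\<^bsub>W\<^esub> x = \<zero>\<^bsub>W\<^esub>"
      by (auto simp: eq intro!: bexI[of _ "\<ominus>\<^bsub>V\<^esub> x"] V.l_neg)
  qed (auto simp: eq V.add.m_ac)
  then have "module complex_ring W"
    by (intro moduleI cring_complex_ring)
      (auto simp: eq complex_ring_def V.smult_add_left V.smult_add_right V.smult_smult)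
  then show ?thesis
    by (intro complex_normed_space.intro complex_normed_space_axioms.intro)
      (auto simp: eq V.nrm_nonneg V.nrm_eq_0_iff V.nrm_triangle V.nrm_smult)
qed

lemma complex_banach_space_cong:
  assumes "complex_banach_space V"
    and eq: "carrier W = carrier V" "add W = add V" "zero W = zero V" "smult W = smult V"
      "nrm W = nrm V"
  shows "complex_banach_space W"
proof -
  interpret V: complex_banach_space V by fact
  interpret W: complex_normed_space W
    using complex_normed_space_cong[OF _ eq] V.complex_normed_space_axioms by blast
  have diff: "x \<ominus>\<^bsub>W\<^esub> y = x \<ominus>\<^bsub>V\<^esub> y" if "x \<in> carrier V" "y \<in> carrier V" for x y
    using that V.diff_eq[of x y] W.diff_eq[of x y] by (simp add: eq)
  show ?thesis
  proof
    fix s :: "nat \<Rightarrow> 'a"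
    assume s: "\<And>n. s n \<in> carrier W"
      and "\<And>e. e > 0 \<Longrightarrow> \<exists>N. \<forall>m\<ge>N. \<forall>n\<ge>N. nrm W (s m \<ominus>\<^bsub>W\<^esub> s n) < e"
    then have "\<exists>l\<in>carrier V. (\<lambda>n. nrm V (s n \<ominus>\<^bsub>V\<^esub> l)) \<longlonglongrightarrow> 0"
      by (intro V.complete) (auto simp: eq diff)
    then show "\<exists>l\<in>carrier W. (\<lambda>n. nrm W (s n \<ominus>\<^bsub>W\<^esub> l)) \<longlonglongrightarrow> 0"
      using s by (auto simp: eq diff)
  qed
qed

text \<open>Right modules over \<open>A\<close> are left modules over the opposite algebra, so the
  single locale \<open>banach_left_module\<close> covers both sides and dualizing can be
  iterated.\<close>

definition opposite_algebra :: "('a, 'm) normed_cspace_scheme \<Rightarrow> ('a, 'm) normed_cspace_scheme" where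
  "opposite_algebra A = A\<lparr>mult := \<lambda>a b. b \<otimes>\<^bsub>A\<^esub> a\<rparr>"

lemma opposite_algebra_simps [simp]:
  "carrier (opposite_algebra A) = carrier A" "add (opposite_algebra A) = add A"
  "zero (opposite_algebra A) = zero A" "smult (opposite_algebra A) = smult A"
  "nrm (opposite_algebra A) = nrm A" "mult (opposite_algebra A) = (\<lambda>a b. b \<otimes>\<^bsub>A\<^esub> a)"
  by (simp_all add: opposite_algebra_def)

lemma opposite_opposite [simp]: "opposite_algebra (opposite_algebra A) = A"
  by (simp add: opposite_algebra_def)

lemma banach_algebra_opposite:
  assumes "banach_algebra A"
  shows "banach_algebra (opposite_algebra A)"
proof -
  interpret A: banach_algebra A by fact
  have "complex_banach_space (opposite_algebra A)"
    by (rule complex_banach_space_cong[OF A.complex_banach_space_axioms]) simp_all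
  then show ?thesis
    by (intro banach_algebra.intro banach_algebra_axioms.intro)
      (auto simp: A.mult_closed A.mult_assoc A.mult_add_left A.mult_add_right A.mult_smult_left
        A.mult_smult_right intro: A.nrm_mult[THEN ord_le_eq_trans, OF _ _ mult.commute])
qed

section \<open>Dual spaces and dual modules\<close>

lemma dual_module_simps [simp]:
  "carrier (dual_module M) = bounded_ops M complex_space"
  "zero (dual_module M) = (\<lambda>x\<in>carrier M. 0)"
  "add (dual_module M) = (\<lambda>f g. \<lambda>x\<in>carrier M. f x + g x)"
  "smult (dual_module M) = (\<lambda>c f. \<lambda>x\<in>carrier M. c * f x)"
  "act (dual_module M) = (\<lambda>a f. \<lambda>x\<in>carrier M. f (act M a x))"
  by (simp_all add: dual_module_def)

lemma functionalI:
  assumes "f \<in> extensional (carrier V)"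
    and "\<And>x y. \<lbrakk>x \<in> carrier V; y \<in> carrier V\<rbrakk> \<Longrightarrow> f (x \<oplus>\<^bsub>V\<^esub> y) = f x + f y"
    and "\<And>c x. x \<in> carrier V \<Longrightarrow> f (c \<odot>\<^bsub>V\<^esub> x) = c * f x"
    and "\<And>x. x \<in> carrier V \<Longrightarrow> cmod (f x) \<le> C * nrm V x"
  shows "f \<in> bounded_ops V complex_space"
  by (rule bounded_opsI[where C = C]) (use assms in \<open>auto simp: complex_space_def PiE_def\<close>)

lemma
  assumes "f \<in> bounded_ops V complex_space"
  shows functional_add: "\<lbrakk>x \<in> carrier V; y \<in> carrier V\<rbrakk> \<Longrightarrow> f (x \<oplus>\<^bsub>V\<^esub> y) = f x + f y"
    and functional_smult: "x \<in> carrier V \<Longrightarrow> f (c \<odot>\<^bsub>V\<^esub> x) = c * f x"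
  using bounded_ops_add[OF assms] bounded_ops_smult[OF assms] by (auto simp: complex_space_def)

context complex_normed_space
begin

lemma functional_bound:
  assumes "f \<in> bounded_ops V complex_space"
  obtains C where "C > 0" "\<And>x. x \<in> carrier V \<Longrightarrow> cmod (f x) \<le> C * nrm V x"
  using bounded_ops_bound[OF complex_normed_space_axioms assms] by (auto simp: complex_space_def)

lemma functional_add_closed:
  assumes f: "f \<in> bounded_ops V complex_space" and g: "g \<in> bounded_ops V complex_space"
  shows "(\<lambda>x\<in>carrier V. f x + g x) \<in> bounded_ops V complex_space"
proof -
  obtain C where C: "C > 0" "\<And>x. x \<in> carrier V \<Longrightarrow> cmod (f x) \<le> C * nrm V x"
    using functional_bound[OF f] by blast
  obtain D where D: "D > 0" "\<And>x. x \<in> carrier V \<Longrightarrow> cmod (g x) \<le> D * nrm V x"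
    using functional_bound[OF g] by blast
  have "cmod (f x + g x) \<le> (C + D) * nrm V x" if "x \<in> carrier V" for x
    using C(2)[OF that] D(2)[OF that] norm_triangle_ineq[of "f x" "g x"]
        by (simp add: algebra_simps)
  then show ?thesis
    by (intro functionalI[where C = "C + D"])
      (auto simp: functional_add[OF f] functional_add[OF g] functional_smult[OF f]
        functional_smult[OF g] algebra_simps)
qed

lemma functional_smult_closed:
  assumes f: "f \<in> bounded_ops V complex_space"
  shows "(\<lambda>x\<in>carrier V. c * f x) \<in> bounded_ops V complex_space"
proof -
  obtain C where C: "C > 0" "\<And>x. x \<in> carrier V \<Longrightarrow> cmod (f x) \<le> C * nrm V x"
    using functional_bound[OF f] by blast
  have "cmod (c * f x) \<le> (cmod c * C) * nrm V x" if "x \<in> carrier V" for x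
    using mult_left_mono[OF C(2)[OF that], of "cmod c"] by (simp add: norm_mult mult.assoc)
  then show ?thesis
    by (intro functionalI[where C = "cmod c * C"])
      (simp_all add: functional_add[OF f] functional_smult[OF f] distrib_left mult.left_commute)
qed

end

lemma dual_nrm_eq:
  "nrm (dual_module M) f = (SUP x\<in>{x \<in> carrier M. nrm M x \<le> 1}. cmod (f x))"
  by (simp add: dual_module_def)

lemma dual_nrm_least:
  assumes "complex_normed_space M" "0 \<le> C"
    and "\<And>x. x \<in> carrier M \<Longrightarrow> cmod (f x) \<le> C * nrm M x"
  shows "nrm (dual_module M) f \<le> C"
proof -
  interpret M: complex_normed_space M by fact
  have "cmod (f x) \<le> C" if "x \<in> carrier M" "nrm M x \<le> 1" for x
    using assms(3)[OF that(1)] mult_left_mono[OF that(2) assms(2)] by simp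
  \<comment> \<open>A supremum of reals is controlled by upper bounds only over a nonempty set; the
    zero vector provides an element of the unit ball.\<close>
  moreover have "\<zero>\<^bsub>M\<^esub> \<in> {x \<in> carrier M. nrm M x \<le> 1}" by simp
  ultimately show ?thesis
    by (subst dual_nrm_eq, intro cSUP_least) blast+
qed

text \<open>Normalizing \<open>x\<close> reduces this to the unit ball, where boundedness of
  \<open>f\<close> makes the real supremum an upper bound.\<close>

lemma dual_nrm_bound:
  assumes "complex_normed_space M" and f: "f \<in> bounded_ops M complex_space" and x: "x \<in> carrier M"
  shows "cmod (f x) \<le> nrm (dual_module M) f * nrm M x"
proof -
  interpret M: complex_normed_space M by fact
  obtain C where C: "C > 0" "\<And>x. x \<in> carrier M \<Longrightarrow> cmod (f x) \<le> C * nrm M x"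
    using M.functional_bound[OF f] by blast
  show ?thesis
  proof (cases "nrm M x = 0")
    case True
    then show ?thesis using C(2)[OF x] by simp
  next
    case False
    then have pos: "nrm M x > 0" using M.nrm_nonneg[OF x] by simp
    define y where "y = complex_of_real (1 / nrm M x) \<odot>\<^bsub>M\<^esub> x"
    have y: "y \<in> carrier M" "nrm M y \<le> 1"
      using x pos by (auto simp: y_def M.nrm_smult norm_divide)
    have "cmod (f z) \<le> C" if "z \<in> carrier M" "nrm M z \<le> 1" for z
      using C(2)[OF that(1)] mult_left_mono[OF that(2), of C] C(1) by linarith
    then have "bdd_above ((\<lambda>x. cmod (f x)) ` {x \<in> carrier M. nrm M x \<le> 1})"
      by (intro bdd_aboveI2) auto
    then have "cmod (f y) \<le> nrm (dual_module M) f"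
      unfolding dual_nrm_eq using y by (intro cSUP_upper) simp
    moreover have "cmod (f y) = cmod (f x) / nrm M x"
      using x pos by (simp add: y_def functional_smult[OF f] norm_divide norm_mult)
    ultimately show ?thesis using pos by (simp add: field_simps)
  qed
qed

lemma dual_nrm_nonneg:
  assumes "complex_normed_space M" and f: "f \<in> bounded_ops M complex_space"
  shows "0 \<le> nrm (dual_module M) f"
proof -
  interpret M: complex_normed_space M by fact
  obtain C where C: "C > 0" "\<And>x. x \<in> carrier M \<Longrightarrow> cmod (f x) \<le> C * nrm M x"
    using M.functional_bound[OF f] by blast
  have "cmod (f z) \<le> C" if "z \<in> carrier M" "nrm M z \<le> 1" for z
    using C(2)[OF that(1)] mult_left_mono[OF that(2), of C] C(1) by linarith
  then have "bdd_above ((\<lambda>x. cmod (f x)) ` {x \<in> carrier M. nrm M x \<le> 1})"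
    by (intro bdd_aboveI2) auto
  then have "cmod (f \<zero>\<^bsub>M\<^esub>) \<le> nrm (dual_module M) f"
    unfolding dual_nrm_eq by (intro cSUP_upper) simp
  then show ?thesis using norm_ge_zero order_trans by blast
qed

lemma complex_normed_space_dual:
  fixes M :: "('a, 'v) banach_act"
  assumes "complex_normed_space M"
  shows "complex_normed_space (dual_module M)"
proof -
  interpret M: complex_normed_space M by fact
  let ?D = "dual_module M"
  have zero: "(\<lambda>x\<in>carrier M. 0) \<in> bounded_ops M complex_space"
    by (rule functionalI[where C = 0]) auto
  have "abelian_group ?D"
  proof (rule abelian_groupI)
    fix f assume f: "f \<in> carrier ?D"
    then show "\<zero>\<^bsub>?D\<^esub> \<oplus>\<^bsub>?D\<^esub> f = f"
      by (auto intro!: extensionalityI[OF _ bounded_ops_extensional])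
    show "\<exists>g\<in>carrier ?D. g \<oplus>\<^bsub>?D\<^esub> f = \<zero>\<^bsub>?D\<^esub>"
    proof (rule bexI[of _ "\<lambda>x\<in>carrier M. (-1) * f x"])
      show "(\<lambda>x\<in>carrier M. (-1) * f x) \<in> carrier ?D"
        using f M.functional_smult_closed[of f "-1"] by (simp only: dual_module_simps)
    qed (auto simp: fun_eq_iff restrict_def)
  qed (auto simp: M.functional_add_closed zero algebra_simps intro!: restrict_ext)
  then have "module complex_ring ?D"
  proof (rule moduleI[OF cring_complex_ring])
    fix f assume "f \<in> carrier ?D"
    then show "\<one>\<^bsub>complex_ring\<^esub> \<odot>\<^bsub>?D\<^esub> f = f"
      by (auto simp: complex_ring_def intro!: extensionalityI[OF _ bounded_ops_extensional])
  next
    fix c f assume "f \<in> carrier ?D"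
    then show "c \<odot>\<^bsub>?D\<^esub> f \<in> carrier ?D" by (simp add: M.functional_smult_closed)
  next
    fix c d f
    show "(c \<oplus>\<^bsub>complex_ring\<^esub> d) \<odot>\<^bsub>?D\<^esub> f = c \<odot>\<^bsub>?D\<^esub> f \<oplus>\<^bsub>?D\<^esub> d \<odot>\<^bsub>?D\<^esub> f"
      by (simp add: complex_ring_def distrib_right cong: restrict_cong)
    show "(c \<otimes>\<^bsub>complex_ring\<^esub> d) \<odot>\<^bsub>?D\<^esub> f = c \<odot>\<^bsub>?D\<^esub> (d \<odot>\<^bsub>?D\<^esub> f)"
      by (simp add: complex_ring_def mult.assoc cong: restrict_cong)
  next
    fix c f g
    show "c \<odot>\<^bsub>?D\<^esub> (f \<oplus>\<^bsub>?D\<^esub> g) = c \<odot>\<^bsub>?D\<^esub> f \<oplus>\<^bsub>?D\<^esub> c \<odot>\<^bsub>?D\<^esub> g"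
      by (simp add: distrib_left cong: restrict_cong)
  qed
  then show ?thesis
  proof (intro complex_normed_space.intro complex_normed_space_axioms.intro)
    fix f assume f: "f \<in> carrier ?D"
    then have f': "f \<in> bounded_ops M complex_space" by simp
    show nn: "0 \<le> nrm ?D f" using f dual_nrm_nonneg[OF assms] by simp
    show "nrm ?D f = 0 \<longleftrightarrow> f = \<zero>\<^bsub>?D\<^esub>"
    proof
      assume "nrm ?D f = 0"
      then have "f x = 0" if "x \<in> carrier M" for x
        using dual_nrm_bound[OF assms f' that] by simp
      then show "f = \<zero>\<^bsub>?D\<^esub>"
        by (auto intro!: extensionalityI[OF bounded_ops_extensional[OF f']])
    next
      assume "f = \<zero>\<^bsub>?D\<^esub>"
      then have "nrm ?D f \<le> 0" by (intro dual_nrm_least[OF assms]) auto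
      with nn show "nrm ?D f = 0" by simp
    qed
    show "nrm ?D (f \<oplus>\<^bsub>?D\<^esub> g) \<le> nrm ?D f + nrm ?D g" if g: "g \<in> carrier ?D" for g
    proof (rule dual_nrm_least[OF assms])
      show "0 \<le> nrm ?D f + nrm ?D g"
        using nn g dual_nrm_nonneg[OF assms, of g] by simp
      fix x assume x: "x \<in> carrier M"
      have "cmod (f x + g x) \<le> cmod (f x) + cmod (g x)" by (rule norm_triangle_ineq)
      also have "\<dots> \<le> nrm ?D f * nrm M x + nrm ?D g * nrm M x"
        using dual_nrm_bound[OF assms _ x] f' g by (intro add_mono) auto
      finally show "cmod ((f \<oplus>\<^bsub>?D\<^esub> g) x) \<le> (nrm ?D f + nrm ?D g) * nrm M x"
        using x by (simp add: algebra_simps)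
    qed
    have le: "nrm ?D (c \<odot>\<^bsub>?D\<^esub> h) \<le> cmod c * nrm ?D h"
      if h: "h \<in> bounded_ops M complex_space" for c h
    proof (rule dual_nrm_least[OF assms])
      show "0 \<le> cmod c * nrm ?D h" using dual_nrm_nonneg[OF assms h] by simp
      fix x assume x: "x \<in> carrier M"
      show "cmod ((c \<odot>\<^bsub>?D\<^esub> h) x) \<le> cmod c * nrm ?D h * nrm M x"
        using x mult_left_mono[OF dual_nrm_bound[OF assms h x], of "cmod c"]
        by (simp add: norm_mult mult.assoc)
    qed
    show "nrm ?D (c \<odot>\<^bsub>?D\<^esub> f) = cmod c * nrm ?D f" for c
    proof (cases "c = 0")
      case True
      then show ?thesis using le[OF f', of 0] dual_nrm_nonneg[OF assms M.functional_smult_closed[OF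
          f', of 0]]
        by simp
    next
      case False
      \<comment> \<open>The reverse inequality comes from \<open>le\<close> applied to the scalar
        \<open>inverse c\<close> and the functional \<open>c f\<close>.\<close>
      have "inverse c \<odot>\<^bsub>?D\<^esub> (c \<odot>\<^bsub>?D\<^esub> f) = f"
        using False bounded_ops_extensional[OF f']
        by (auto simp: fun_eq_iff restrict_def extensional_def)
      then have "nrm ?D f \<le> inverse (cmod c) * nrm ?D (c \<odot>\<^bsub>?D\<^esub> f)"
        using le[OF M.functional_smult_closed[OF f', of c], of "inverse c"]
        by (simp add: norm_inverse)
      then show ?thesis using le[OF f', of c] False by (simp add: field_simps)
    qed
  qed
qed

text \<open>The values at each point form a Cauchy sequence of complex numbers. Letting one index
  tend to infinity in the Cauchy estimate makes the pointwise limit bounded and the convergence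
  uniform on the unit ball.\<close>

lemma complex_banach_space_dual:
  fixes M :: "('a, 'v) banach_act"
  assumes "complex_normed_space M"
  shows "complex_banach_space (dual_module M)"
proof -
  interpret M: complex_normed_space M by fact
  let ?D = "dual_module M"
  interpret D: complex_normed_space ?D by (rule complex_normed_space_dual[OF assms])
  have diff: "(f \<ominus>\<^bsub>?D\<^esub> g) x = f x - g x"
    if "f \<in> carrier ?D" "g \<in> carrier ?D" "x \<in> carrier M" for f g x
    using that by (simp only: D.diff_eq) simp
  show ?thesis
  proof
    fix s :: "nat \<Rightarrow> 'v \<Rightarrow> complex"
    assume s: "\<And>n. s n \<in> carrier ?D"
      and cauchy: "\<And>e. e > 0 \<Longrightarrow> \<exists>N. \<forall>m\<ge>N. \<forall>n\<ge>N. nrm ?D (s m \<ominus>\<^bsub>?D\<^esub> s n) < e"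
    have s': "\<And>n. s n \<in> bounded_ops M complex_space" using s by simp
    have bd: "cmod (s m x - s n x) \<le> nrm ?D (s m \<ominus>\<^bsub>?D\<^esub> s n) * nrm M x" if "x \<in> carrier M" for m n x
      using dual_nrm_bound[OF assms, of "s m \<ominus>\<^bsub>?D\<^esub> s n" x] D.diff_closed[OF s s, of m n] that
      by (simp add: diff[OF s s])
    have "Cauchy (\<lambda>n. s n x)" if x: "x \<in> carrier M" for x
    proof (rule metric_CauchyI)
      fix e :: real assume e: "e > 0"
      have "e / (nrm M x + 1) > 0" using e M.nrm_nonneg[OF x] by simp
      then obtain N where N: "\<And>m n. m \<ge> N \<Longrightarrow> n \<ge> N \<Longrightarrow> nrm ?D (s m \<ominus>\<^bsub>?D\<^esub> s n) < e / (nrm M x + 1)"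
        using cauchy by blast
      have "dist (s m x) (s n x) < e" if "m \<ge> N" "n \<ge> N" for m n
      proof -
        have "dist (s m x) (s n x) \<le> nrm ?D (s m \<ominus>\<^bsub>?D\<^esub> s n) * nrm M x"
          using bd[OF x] by (simp add: dist_norm)
        also have "\<dots> \<le> e / (nrm M x + 1) * nrm M x"
          using N[OF that] M.nrm_nonneg[OF x] by (intro mult_right_mono) auto
        also have "\<dots> < e" using e M.nrm_nonneg[OF x] by (simp add: field_simps)
        finally show ?thesis .
      qed
      then show "\<exists>N. \<forall>m\<ge>N. \<forall>n\<ge>N. dist (s m x) (s n x) < e" by blast
    qed
    then have lim: "(\<lambda>n. s n x) \<longlonglongrightarrow> lim (\<lambda>n. s n x)" if "x \<in> carrier M" for x
      using that by (simp add: Cauchy_convergent_iff convergent_LIMSEQ_iff)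
    define l where "l = (\<lambda>x\<in>carrier M. lim (\<lambda>n. s n x))"
    have lim: "(\<lambda>n. s n x) \<longlonglongrightarrow> l x" if "x \<in> carrier M" for x
      using lim[OF that] that by (simp add: l_def)
    have near: "cmod (s m x - l x) \<le> e * nrm M x"
      if x: "x \<in> carrier M" and N: "\<And>n. n \<ge> N \<Longrightarrow> nrm ?D (s m \<ominus>\<^bsub>?D\<^esub> s n) < e" for m e N x
    proof (rule LIMSEQ_le_const2)
      show "(\<lambda>n. cmod (s m x - s n x)) \<longlonglongrightarrow> cmod (s m x - l x)"
        by (intro tendsto_intros lim x)
      have "cmod (s m x - s n x) \<le> e * nrm M x" if "n \<ge> N" for n
        using bd[OF x, of m n] mult_right_mono[OF less_imp_le[OF N[OF that]] M.nrm_nonneg[OF x]]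
        by linarith
      then show "\<exists>N. \<forall>n\<ge>N. cmod (s m x - s n x) \<le> e * nrm M x" by blast
    qed
    have l: "l \<in> bounded_ops M complex_space"
    proof -
      obtain N where N: "\<And>m n. m \<ge> N \<Longrightarrow> n \<ge> N \<Longrightarrow> nrm ?D (s m \<ominus>\<^bsub>?D\<^esub> s n) < 1"
        using cauchy[of 1] by auto
      show ?thesis
      proof (rule functionalI[where C = "nrm ?D (s N) + 1"])
        show "l \<in> extensional (carrier M)" by (simp add: l_def)
      next
        fix x y assume xy: "x \<in> carrier M" "y \<in> carrier M"
        have "(\<lambda>n. s n (x \<oplus>\<^bsub>M\<^esub> y)) \<longlonglongrightarrow> l x + l y"
          using xy by (simp add: functional_add[OF s'] tendsto_add lim)
        then show "l (x \<oplus>\<^bsub>M\<^esub> y) = l x + l y" using lim xy LIMSEQ_unique M.add.m_closed by blast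
      next
        fix c x assume x: "x \<in> carrier M"
        have "(\<lambda>n. s n (c \<odot>\<^bsub>M\<^esub> x)) \<longlonglongrightarrow> c * l x"
          using x by (simp add: functional_smult[OF s'] tendsto_mult lim)
        then show "l (c \<odot>\<^bsub>M\<^esub> x) = c * l x" using lim x LIMSEQ_unique M.smult_closed' by blast
      next
        fix x assume x: "x \<in> carrier M"
        have "cmod (l x) \<le> cmod (s N x) + cmod (s N x - l x)"
          using norm_triangle_ineq4[of "s N x" "s N x - l x"] by simp
        then show "cmod (l x) \<le> (nrm ?D (s N) + 1) * nrm M x"
          using near[OF x, of N N 1] N dual_nrm_bound[OF assms s' x, of N]
              by (simp add: algebra_simps)
      qed
    qed
    show "\<exists>l\<in>carrier ?D. (\<lambda>n. nrm ?D (s n \<ominus>\<^bsub>?D\<^esub> l)) \<longlonglongrightarrow> 0"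
    proof (rule bexI[of _ l])
      show "l \<in> carrier ?D" using l by simp
      show "(\<lambda>n. nrm ?D (s n \<ominus>\<^bsub>?D\<^esub> l)) \<longlonglongrightarrow> 0"
      proof (rule LIMSEQ_I)
        fix r :: real assume "r > 0"
        then obtain N where N: "\<And>m n. m \<ge> N \<Longrightarrow> n \<ge> N \<Longrightarrow> nrm ?D (s m \<ominus>\<^bsub>?D\<^esub> s n) < r / 2"
          using cauchy[of "r / 2"] by auto
        have "nrm ?D (s m \<ominus>\<^bsub>?D\<^esub> l) \<le> r / 2" if "m \<ge> N" for m
          using near[of _ N m "r / 2"] N that \<open>r > 0\<close> l s
          by (intro dual_nrm_least[OF assms]) (auto simp: diff[simplified])
        moreover have "0 \<le> nrm ?D (s m \<ominus>\<^bsub>?D\<^esub> l)" for m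
          using D.nrm_nonneg D.diff_closed s l by simp
        ultimately show "\<exists>N. \<forall>n\<ge>N. norm (nrm ?D (s n \<ominus>\<^bsub>?D\<^esub> l) - 0) < r"
          using \<open>r > 0\<close> by (intro exI[of _ N]) (auto intro: le_less_trans[of _ "r / 2"])
      qed
    qed
  qed
qed

text \<open>Precomposing with the action reverses the order of products. A left module over the
  opposite algebra, that is, a right module over \<open>A\<close>, therefore has a left
  \<open>A\<close>-module as its dual.\<close>

lemma banach_left_module_dual:
  fixes M :: "('a, 'v) banach_act"
  assumes "banach_left_module (opposite_algebra A) M"
  shows "banach_left_module A (dual_module M)"
proof -
  interpret M: banach_left_module "opposite_algebra A" M by fact
  interpret A: banach_algebra A
    using banach_algebra_opposite[OF M.A.banach_algebra_axioms] by simp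
  have nM: "complex_normed_space M" by unfold_locales
  let ?D = "dual_module M"
  interpret D: complex_banach_space ?D by (rule complex_banach_space_dual[OF nM])
  have act_closed: "act M a x \<in> carrier M" if "a \<in> carrier A" "x \<in> carrier M" for a x
    using M.act_closed that by simp
  obtain C where C: "\<And>a x. a \<in> carrier A \<Longrightarrow> x \<in> carrier M \<Longrightarrow> nrm M (act M a x)
      \<le> C * nrm A a * nrm M x"
    using M.act_bounded by auto
  have C': "nrm M (act M a x) \<le> max C 0 * nrm A a * nrm M x"
    if "a \<in> carrier A" "x \<in> carrier M" for a x
  proof -
    have "C * nrm A a * nrm M x \<le> max C 0 * nrm A a * nrm M x"
      using that by (intro mult_right_mono M.E.nrm_nonneg A.nrm_nonneg) auto
    then show ?thesis using C[OF that] by linarith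
  qed
  have bd: "cmod (f (act M a x)) \<le> max C 0 * nrm A a * nrm ?D f * nrm M x"
    if "a \<in> carrier A" "x \<in> carrier M" "f \<in> bounded_ops M complex_space" for a x f
  proof -
    have "cmod (f (act M a x)) \<le> nrm ?D f * nrm M (act M a x)"
      by (rule dual_nrm_bound[OF nM that(3) act_closed[OF that(1,2)]])
    also have "\<dots> \<le> nrm ?D f * (max C 0 * nrm A a * nrm M x)"
      using C'[OF that(1,2)] dual_nrm_nonneg[OF nM that(3)] by (rule mult_left_mono)
    finally show ?thesis by (simp add: mult_ac)
  qed
  have closed: "(\<lambda>x\<in>carrier M. f (act M a x)) \<in> bounded_ops M complex_space"
    if "a \<in> carrier A" "f \<in> bounded_ops M complex_space" for a f
    using that bd[OF that(1) _ that(2)] act_closed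
    by (intro functionalI[where C = "max C 0 * nrm A a * nrm ?D f"])
      (auto simp: M.act_add_right M.act_smult_right functional_add functional_smult)
  show ?thesis
  proof
    show "\<exists>C. \<forall>a\<in>carrier A. \<forall>f\<in>carrier ?D. nrm ?D (act ?D a f) \<le> C * nrm A a * nrm ?D f"
    proof (intro exI ballI)
      fix a f assume "a \<in> carrier A" "f \<in> carrier ?D"
      then show "nrm ?D (act ?D a f) \<le> max C 0 * nrm A a * nrm ?D f"
        using bd A.nrm_nonneg dual_nrm_nonneg[OF nM] by (intro dual_nrm_least[OF nM]) auto
    qed
  next
    fix a b f assume "a \<in> carrier A" "b \<in> carrier A" "f \<in> carrier ?D"
    then show "act ?D (a \<otimes>\<^bsub>A\<^esub> b) f = act ?D a (act ?D b f)"
      using M.act_mult[of b a] act_closed by (auto simp: fun_eq_iff restrict_def)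
  next
    fix a b f assume "a \<in> carrier A" "b \<in> carrier A" "f \<in> carrier ?D"
    then show "act ?D (a \<oplus>\<^bsub>A\<^esub> b) f = act ?D a f \<oplus>\<^bsub>?D\<^esub> act ?D b f"
      using M.act_add_left[of a b] act_closed by (auto simp: fun_eq_iff functional_add)
  next
    fix a f k assume "a \<in> carrier A" "f \<in> carrier ?D"
    then show "act ?D (k \<odot>\<^bsub>A\<^esub> a) f = k \<odot>\<^bsub>?D\<^esub> act ?D a f"
      using M.act_smult_left[of a] act_closed by (auto simp: fun_eq_iff functional_smult)
  qed (use closed act_closed in \<open>auto simp: fun_eq_iff restrict_def\<close>)
qed

section \<open>0-injectivity from a bounded approximate identity\<close>

text \<open>
  The members of \<open>\<L>\<close> play the role of the tails of a two-sided approximate identity. Closure under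
  midpoints allows minimal norm arguments in place of weak compactness.
\<close>

locale approximate_identity = banach_algebra A for A :: "('a, 'm) normed_cspace_scheme" +
  fixes \<L> :: "'a set set"
  assumes nonempty: "\<L> \<noteq> {}" and nonempty_mem: "X \<in> \<L> \<Longrightarrow> X \<noteq> {}"
    and subset_carrier: "X \<in> \<L> \<Longrightarrow> X \<subseteq> carrier A"
    and midpoint: "\<lbrakk>X \<in> \<L>; x \<in> X; y \<in> X\<rbrakk> \<Longrightarrow> (1/2) \<odot>\<^bsub>A\<^esub> (x \<oplus>\<^bsub>A\<^esub> y) \<in> X"
    and directed: "\<lbrakk>X \<in> \<L>; Y \<in> \<L>\<rbrakk> \<Longrightarrow> \<exists>Z\<in>\<L>. Z \<subseteq> X \<inter> Y"
    and nrm_le_1: "\<lbrakk>X \<in> \<L>; e \<in> X\<rbrakk> \<Longrightarrow> nrm A e \<le> 1"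
    and left_unit: "\<lbrakk>a \<in> carrier A; \<epsilon> > 0\<rbrakk> \<Longrightarrow> \<exists>X\<in>\<L>. \<forall>e\<in>X. nrm A (e \<otimes>\<^bsub>A\<^esub> a \<ominus>\<^bsub>A\<^esub> a) < \<epsilon>"
    and right_unit: "\<lbrakk>a \<in> carrier A; \<epsilon> > 0\<rbrakk> \<Longrightarrow> \<exists>X\<in>\<L>. \<forall>e\<in>X. nrm A (a \<otimes>\<^bsub>A\<^esub> e \<ominus>\<^bsub>A\<^esub> a) < \<epsilon>"

text \<open>Tychonoff's theorem for a product of closed discs. A single subfilter works for all
  \<open>z\<close>, so a linear relation between finitely many of the values \<open>h i z\<close>
  that holds along \<open>F\<close> survives in the limit.\<close>

lemma pointwise_convergent_subfilter:
  fixes h :: "'i \<Rightarrow> 'z \<Rightarrow> complex"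
  assumes "F \<noteq> bot" and bd: "eventually (\<lambda>i. \<forall>z. cmod (h i z) \<le> B z) F"
  obtains G L where "G \<le> F" "G \<noteq> bot" "\<And>z. ((\<lambda>i. h i z) \<longlongrightarrow> L z) G"
proof -
  have "compactin (product_topology (\<lambda>_. euclidean) UNIV) (PiE UNIV (\<lambda>z. cball (0::complex) (B z)))"
    by (simp add: compactin_PiE)
  then have "compact (PiE UNIV (\<lambda>z. cball (0::complex) (B z)))"
    by (simp add: euclidean_product_topology)
  moreover have "eventually (\<lambda>g. g \<in> PiE UNIV (\<lambda>z. cball (0::complex) (B z))) (filtermap h F)"
    using bd by (simp add: eventually_filtermap PiE_def Pi_def extensional_def)
  moreover have "filtermap h F \<noteq> bot" using assms(1) by (simp add: filtermap_bot_iff)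
  ultimately obtain L where L: "inf (nhds L) (filtermap h F) \<noteq> bot"
    unfolding compact_filter by meson
  \<comment> \<open>A cluster point \<open>L\<close> of the image filter becomes a limit along
    \<open>F\<close> refined by the preimages of the neighbourhoods of \<open>L\<close>.\<close>
  define G where "G = inf F (filtercomap h (nhds L))"
  show ?thesis
  proof (rule that[of G L])
    show "G \<le> F" by (simp add: G_def)
    show "G \<noteq> bot"
    proof
      assume "G = bot"
      then have "eventually (\<lambda>_. False) (inf F (filtercomap h (nhds L)))" by (simp add: G_def)
      then obtain P Q where PQ: "eventually P F" "eventually Q (nhds L)" "\<And>x. P x \<Longrightarrow> Q (h x) \<Longrightarrow> False"
        unfolding eventually_inf eventually_filtercomap by blast
      have "eventually (\<lambda>g. \<not> Q g) (filtermap h F)"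
        unfolding eventually_filtermap by (rule eventually_mono[OF PQ(1)]) (use PQ(3) in blast)
      then have "eventually (\<lambda>_. False) (inf (nhds L) (filtermap h F))"
        unfolding eventually_inf using PQ(2) by blast
      then show False using L by (simp add: eventually_False)
    qed
    fix z
    have "filterlim h (nhds L) G"
      unfolding G_def filterlim_iff_le_filtercomap by simp
    moreover have "((\<lambda>g. g z) \<longlongrightarrow> L z) (nhds L)"
    proof (rule topological_tendstoI)
      fix S :: "complex set" assume S: "open S" "L z \<in> S"
      have "open ((\<lambda>g :: 'z \<Rightarrow> complex. g z) -` S)"
        by (rule open_vimage[OF S(1) continuous_on_product_coordinates])
      then show "\<forall>\<^sub>F g in nhds L. g z \<in> S" using S(2) unfolding eventually_nhds by blast
    qed
    ultimately show "((\<lambda>i. h i z) \<longlongrightarrow> L z) G" by (rule filterlim_compose[rotated])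
  qed
qed

context approximate_identity
begin

definition tails :: "'a filter" where
  "tails = (INF X\<in>\<L>. principal X)"

lemma eventually_tails: "eventually P tails \<longleftrightarrow> (\<exists>X\<in>\<L>. \<forall>e\<in>X. P e)"
  unfolding tails_def
  by (subst eventually_INF_base) (use nonempty directed in \<open>auto simp: eventually_principal\<close>)

lemma tails_neq_bot: "tails \<noteq> bot"
  using nonempty_mem unfolding trivial_limit_def eventually_tails by fast

lemma eventually_tails_carrier: "eventually (\<lambda>e. e \<in> carrier A) tails"
  using nonempty subset_carrier unfolding eventually_tails by blast

lemma eventually_tails_nrm: "eventually (\<lambda>e. nrm A e \<le> 1) tails"
  using nonempty nrm_le_1 unfolding eventually_tails by blast

lemma tendsto_nrm_unit:
  assumes "a \<in> carrier A"
  shows "((\<lambda>e. nrm A (e \<otimes>\<^bsub>A\<^esub> a \<ominus>\<^bsub>A\<^esub> a)) \<longlongrightarrow> 0) tails"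
    and "((\<lambda>e. nrm A (a \<otimes>\<^bsub>A\<^esub> e \<ominus>\<^bsub>A\<^esub> a)) \<longlongrightarrow> 0) tails"
proof -
  have "\<forall>\<^sub>F e in tails. dist (nrm A (e \<otimes>\<^bsub>A\<^esub> a \<ominus>\<^bsub>A\<^esub> a)) 0 < \<epsilon>" if "\<epsilon> > 0" for \<epsilon>
  proof -
    have "\<forall>\<^sub>F e in tails. nrm A (e \<otimes>\<^bsub>A\<^esub> a \<ominus>\<^bsub>A\<^esub> a) < \<epsilon>"
      unfolding eventually_tails by (rule left_unit[OF assms that])
    with eventually_tails_carrier show ?thesis
      by eventually_elim (use assms nrm_nonneg mult_closed in auto)
  qed
  then show "((\<lambda>e. nrm A (e \<otimes>\<^bsub>A\<^esub> a \<ominus>\<^bsub>A\<^esub> a)) \<longlongrightarrow> 0) tails" by (rule tendstoI)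
  have "\<forall>\<^sub>F e in tails. dist (nrm A (a \<otimes>\<^bsub>A\<^esub> e \<ominus>\<^bsub>A\<^esub> a)) 0 < \<epsilon>" if "\<epsilon> > 0" for \<epsilon>
  proof -
    have "\<forall>\<^sub>F e in tails. nrm A (a \<otimes>\<^bsub>A\<^esub> e \<ominus>\<^bsub>A\<^esub> a) < \<epsilon>"
      unfolding eventually_tails by (rule right_unit[OF assms that])
    with eventually_tails_carrier show ?thesis
      by eventually_elim (use assms nrm_nonneg mult_closed in auto)
  qed
  then show "((\<lambda>e. nrm A (a \<otimes>\<^bsub>A\<^esub> e \<ominus>\<^bsub>A\<^esub> a)) \<longlongrightarrow> 0) tails" by (rule tendstoI)
qed

lemma act_diff_left:
  assumes "banach_left_module A K" "a \<in> carrier A" "b \<in> carrier A" "k \<in> carrier K"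
  shows "act K (a \<ominus>\<^bsub>A\<^esub> b) k = act K a k \<ominus>\<^bsub>K\<^esub> act K b k"
proof -
  interpret K: banach_left_module A K by fact
  show ?thesis using assms
    by (simp add: diff_eq K.E.diff_eq K.act_add_left K.act_smult_left K.act_closed)
qed

lemma act_diff_right:
  assumes "banach_left_module A K" "a \<in> carrier A" "k \<in> carrier K" "l \<in> carrier K"
  shows "act K a (k \<ominus>\<^bsub>K\<^esub> l) = act K a k \<ominus>\<^bsub>K\<^esub> act K a l"
proof -
  interpret K: banach_left_module A K by fact
  show ?thesis using assms
    by (simp add: K.E.diff_eq K.act_add_right K.act_smult_right K.act_closed)
qed

lemma act_bound:
  assumes "banach_left_module A K"
  obtains C where "C > 0"
    "\<And>a k. \<lbrakk>a \<in> carrier A; k \<in> carrier K\<rbrakk> \<Longrightarrow> nrm K (act K a k) \<le> C * nrm A a * nrm K k"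
proof -
  interpret K: banach_left_module A K by fact
  obtain C where C: "\<forall>a\<in>carrier A. \<forall>x\<in>carrier K. nrm K (act K a x) \<le> C * nrm A a * nrm K x"
    using K.act_bounded by blast
  show ?thesis
  proof (rule that[of "max C 1"])
    fix a k assume ak: "a \<in> carrier A" "k \<in> carrier K"
    have "C * nrm A a * nrm K k \<le> max C 1 * nrm A a * nrm K k"
      using ak by (intro mult_right_mono nrm_nonneg K.E.nrm_nonneg) auto
    then show "nrm K (act K a k) \<le> max C 1 * nrm A a * nrm K k" using C ak by fastforce
  qed simp
qed

lemma act_theta_bound:
  assumes "banach_left_module A K" "\<theta> \<in> bounded_ops K E"
  obtains C where "C > 0"
    "\<And>a k. \<lbrakk>a \<in> carrier A; k \<in> carrier K\<rbrakk> \<Longrightarrow> nrm E (\<theta> (act K a k)) \<le> C * nrm A a * nrm K k"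
proof -
  interpret K: banach_left_module A K by fact
  obtain C where C: "C > 0"
    "\<And>a k. \<lbrakk>a \<in> carrier A; k \<in> carrier K\<rbrakk> \<Longrightarrow> nrm K (act K a k) \<le> C * nrm A a * nrm K k"
    using act_bound[OF assms(1)] by blast
  obtain D where D: "D > 0" "\<And>k. k \<in> carrier K \<Longrightarrow> nrm E (\<theta> k) \<le> D * nrm K k"
    using bounded_ops_bound[OF K.E.complex_normed_space_axioms assms(2)] by blast
  show ?thesis
  proof (rule that[of "D * C"])
    fix a k assume ak: "a \<in> carrier A" "k \<in> carrier K"
    have "nrm E (\<theta> (act K a k)) \<le> D * nrm K (act K a k)" using D ak K.act_closed by blast
    also have "\<dots> \<le> D * (C * nrm A a * nrm K k)" using C(2)[OF ak] D(1) by simp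
    finally show "nrm E (\<theta> (act K a k)) \<le> D * C * nrm A a * nrm K k" by (simp add: mult.assoc)
  qed (use C D in simp)
qed

text \<open>Banach-Alaoglu in elementary form: with one subfilter for all pairs
  \<open>(k, x)\<close>, the limit of \<open>\<theta> (e \<cdot> k) x\<close> is linear in
  \<open>k\<close> and in \<open>x\<close>, and bounded by the uniform bound on the units.\<close>

theorem zero_injective_dual_module:
  fixes X :: "('a, 'x) banach_act"
  assumes X: "banach_left_module (opposite_algebra A) X"
  shows "zero_injective TYPE('f) TYPE('k) A (dual_module X)"
proof (rule zero_injectiveI)
  let ?E = "dual_module X"
  show E: "banach_left_module A ?E" by (rule banach_left_module_dual[OF X])
  fix K :: "('a, 'k) banach_act" and \<theta>
  assume K: "banach_left_module A K" and \<theta>: "\<theta> \<in> bounded_ops K ?E"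
    and \<theta>act: "\<And>a b k. \<lbrakk>a \<in> carrier A; b \<in> carrier A; k \<in> carrier K\<rbrakk>
         \<Longrightarrow> \<theta> (act K a (act K b k)) = act ?E a (\<theta> (act K b k))"
  interpret X: banach_left_module "opposite_algebra A" X by fact
  interpret E: banach_left_module A ?E by fact
  interpret K: banach_left_module A K by fact
  have nX: "complex_normed_space X" by unfold_locales
  have nE: "complex_normed_space ?E" and nK: "complex_normed_space K" by unfold_locales
  have Xact: "act X a x \<in> carrier X" if "a \<in> carrier A" "x \<in> carrier X" for a x
    using X.act_closed that by simp
  have \<theta>f: "\<theta> k \<in> bounded_ops X complex_space" if "k \<in> carrier K" for k
    using bounded_ops_closed[OF \<theta> that] by simp
  obtain C where C: "C > 0"
    "\<And>a k. \<lbrakk>a \<in> carrier A; k \<in> carrier K\<rbrakk> \<Longrightarrow> nrm ?E (\<theta> (act K a k)) \<le> C * nrm A a * nrm K k"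
    using act_theta_bound[OF K \<theta>] by blast
  have bd: "cmod (\<theta> (act K a k) x) \<le> C * nrm A a * nrm K k * nrm X x"
    if "a \<in> carrier A" "k \<in> carrier K" "x \<in> carrier X" for a k x
  proof -
    have "cmod (\<theta> (act K a k) x) \<le> nrm ?E (\<theta> (act K a k)) * nrm X x"
      using that by (intro dual_nrm_bound[OF nX] \<theta>f K.act_closed)
    also have "\<dots> \<le> C * nrm A a * nrm K k * nrm X x"
      using that by (intro mult_right_mono C X.E.nrm_nonneg)
    finally show ?thesis .
  qed
  \<comment> \<open>Indexing by pairs lets one application of the compactness lemma serve all
    \<open>k\<close> and \<open>x\<close>; the value 0 off the carriers keeps the bound valid for
    every pair.\<close>
  define h where "h e = (\<lambda>(k, x). if k \<in> carrier K \<and> x \<in> carrier X then \<theta> (act K e k) x else 0)"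
      for e
  define B where "B = (\<lambda>(k, x). if k \<in> carrier K \<and> x \<in> carrier X then C * nrm K k * nrm X x else 0)"
  have "\<forall>\<^sub>F e in tails. \<forall>z. cmod (h e z) \<le> B z"
    using eventually_tails_carrier eventually_tails_nrm
  proof eventually_elim
    case (elim e)
    have "C * nrm A e * nrm K k * nrm X x \<le> C * 1 * nrm K k * nrm X x"
      if "k \<in> carrier K" "x \<in> carrier X" for k x
      using that elim C(1) by (intro mult_right_mono mult_left_mono K.E.nrm_nonneg X.E.nrm_nonneg)
          auto
    then show ?case
      using bd[OF elim(1)] by (fastforce simp: h_def B_def)
  qed
  from pointwise_convergent_subfilter[OF tails_neq_bot this]
  obtain G L where G: "G \<le> tails" "G \<noteq> bot" and L: "\<And>z. ((\<lambda>e. h e z) \<longlongrightarrow> L z) G"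
    by metis
  have lim: "((\<lambda>e. \<theta> (act K e k) x) \<longlongrightarrow> L (k, x)) G" if "k \<in> carrier K" "x \<in> carrier X" for k x
    using L[of "(k, x)"] that by (simp add: h_def)
  have evG: "eventually P G" if "eventually P tails" for P
    using that G(1) by (simp add: le_filter_def)
  have carrG: "\<forall>\<^sub>F e in G. e \<in> carrier A" by (rule evG[OF eventually_tails_carrier])
  have L_unique: "L (k, x) = l"
    if "k \<in> carrier K" "x \<in> carrier X" "((\<lambda>e. \<theta> (act K e k) x) \<longlongrightarrow> l) G" for k x l
    using tendsto_unique[OF G(2) lim that(3)] that by blast
  define R where "R = (\<lambda>k\<in>carrier K. \<lambda>x\<in>carrier X. L (k, x))"
  have L_bd: "cmod (L (k, x)) \<le> C * nrm K k * nrm X x" if "k \<in> carrier K" "x \<in> carrier X" for k x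
  proof (rule tendsto_upperbound[OF tendsto_norm[OF lim[OF that]] _ G(2)])
    show "\<forall>\<^sub>F e in G. cmod (\<theta> (act K e k) x) \<le> C * nrm K k * nrm X x"
      using carrG evG[OF eventually_tails_nrm]
    proof eventually_elim
      case (elim e)
      have "C * nrm A e * nrm K k * nrm X x \<le> C * 1 * nrm K k * nrm X x"
        using that elim C(1) by (intro mult_right_mono mult_left_mono K.E.nrm_nonneg X.E.nrm_nonneg)
            auto
      then show ?case using bd[OF elim(1) that] by simp
    qed
  qed
  have R_dual: "R k \<in> bounded_ops X complex_space" if k: "k \<in> carrier K" for k
  proof (rule functionalI[where C = "C * nrm K k"])
    show "R k \<in> extensional (carrier X)" using k by (simp add: R_def)
  next
    fix x y assume xy: "x \<in> carrier X" "y \<in> carrier X"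
    have "((\<lambda>e. \<theta> (act K e k) (x \<oplus>\<^bsub>X\<^esub> y)) \<longlongrightarrow> L (k, x) + L (k, y)) G"
    proof (rule Lim_transform_eventually[OF tendsto_add[OF lim lim]])
      show "\<forall>\<^sub>F e in G. \<theta> (act K e k) x + \<theta> (act K e k) y = \<theta> (act K e k) (x \<oplus>\<^bsub>X\<^esub> y)"
        using carrG by eventually_elim (simp add: functional_add[OF \<theta>f] K.act_closed k xy)
    qed (use k xy in auto)
    then show "R k (x \<oplus>\<^bsub>X\<^esub> y) = R k x + R k y"
      using L_unique[of k "x \<oplus>\<^bsub>X\<^esub> y"] k xy by (simp add: R_def)
  next
    fix c x assume x: "x \<in> carrier X"
    have "((\<lambda>e. \<theta> (act K e k) (c \<odot>\<^bsub>X\<^esub> x)) \<longlongrightarrow> c * L (k, x)) G"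
    proof (rule Lim_transform_eventually[OF tendsto_mult_left[OF lim]])
      show "\<forall>\<^sub>F e in G. c * \<theta> (act K e k) x = \<theta> (act K e k) (c \<odot>\<^bsub>X\<^esub> x)"
        using carrG by eventually_elim (simp add: functional_smult[OF \<theta>f] K.act_closed k x)
    qed (use k x in auto)
    then show "R k (c \<odot>\<^bsub>X\<^esub> x) = c * R k x"
      using L_unique[of k "c \<odot>\<^bsub>X\<^esub> x"] k x by (simp add: R_def)
  next
    fix x assume "x \<in> carrier X"
    then show "cmod (R k x) \<le> C * nrm K k * nrm X x" using L_bd k by (simp add: R_def)
  qed
  have R_bdd: "R \<in> bounded_ops K ?E"
  proof (rule bounded_opsI[where C = C])
    show "R \<in> carrier K \<rightarrow>\<^sub>E carrier ?E" using R_dual by (auto simp: R_def)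
  next
    fix k l assume kl: "k \<in> carrier K" "l \<in> carrier K"
    have "L (k \<oplus>\<^bsub>K\<^esub> l, x) = L (k, x) + L (l, x)" if x: "x \<in> carrier X" for x
    proof (rule L_unique[OF _ x])
      show "((\<lambda>e. \<theta> (act K e (k \<oplus>\<^bsub>K\<^esub> l)) x) \<longlongrightarrow> L (k, x) + L (l, x)) G"
      proof (rule Lim_transform_eventually[OF tendsto_add[OF lim lim]])
        show "\<forall>\<^sub>F e in G. \<theta> (act K e k) x + \<theta> (act K e l) x = \<theta> (act K e (k \<oplus>\<^bsub>K\<^esub> l)) x"
          using carrG
          by eventually_elim (simp add: bounded_ops_add[OF \<theta>] K.act_closed K.act_add_right kl x)
      qed (use kl x in auto)
    qed (use kl in simp)
    then show "R (k \<oplus>\<^bsub>K\<^esub> l) = R k \<oplus>\<^bsub>?E\<^esub> R l" using kl by (simp add: R_def cong: restrict_cong)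
  next
    fix c k assume k: "k \<in> carrier K"
    have "L (c \<odot>\<^bsub>K\<^esub> k, x) = c * L (k, x)" if x: "x \<in> carrier X" for x
    proof (rule L_unique[OF _ x])
      show "((\<lambda>e. \<theta> (act K e (c \<odot>\<^bsub>K\<^esub> k)) x) \<longlongrightarrow> c * L (k, x)) G"
      proof (rule Lim_transform_eventually[OF tendsto_mult_left[OF lim]])
        show "\<forall>\<^sub>F e in G. c * \<theta> (act K e k) x = \<theta> (act K e (c \<odot>\<^bsub>K\<^esub> k)) x"
          using carrG
          by eventually_elim (simp add: bounded_ops_smult[OF \<theta>] K.act_closed K.act_smult_right k x)
      qed (use k x in auto)
    qed (use k in simp)
    then show "R (c \<odot>\<^bsub>K\<^esub> k) = c \<odot>\<^bsub>?E\<^esub> R k" using k by (simp add: R_def cong: restrict_cong)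
  next
    fix k assume k: "k \<in> carrier K"
    show "nrm ?E (R k) \<le> C * nrm K k"
      using k L_bd C(1) K.E.nrm_nonneg[OF k] by (intro dual_nrm_least[OF nX]) (auto simp: R_def)
  qed
  \<comment> \<open>To be used with \<open>u e = a * e\<close> and with \<open>u e = e * a\<close>,
    where the two halves of the approximate identity supply the convergence of \<open>u e\<close> to
    \<open>a\<close>.\<close>
  have \<theta>lim: "((\<lambda>e. \<theta> (act K (u e) k) x) \<longlongrightarrow> \<theta> (act K a k) x) G"
    if a: "a \<in> carrier A" and k: "k \<in> carrier K" and x: "x \<in> carrier X"
      and u: "\<And>e. e \<in> carrier A \<Longrightarrow> u e \<in> carrier A"
      and lim: "((\<lambda>e. nrm A (u e \<ominus>\<^bsub>A\<^esub> a)) \<longlongrightarrow> 0) tails" for u a k x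
  proof -
    have "((\<lambda>e. \<theta> (act K (u e) k) x - \<theta> (act K a k) x) \<longlongrightarrow> 0) G"
    proof (rule Lim_null_comparison)
      show "\<forall>\<^sub>F e in G. norm (\<theta> (act K (u e) k) x - \<theta> (act K a k) x)
          \<le> C * nrm A (u e \<ominus>\<^bsub>A\<^esub> a) * nrm K k * nrm X x"
        using carrG
      proof eventually_elim
        case (elim e)
        have "\<theta> (act K (u e \<ominus>\<^bsub>A\<^esub> a) k) = \<theta> (act K (u e) k) \<ominus>\<^bsub>?E\<^esub> \<theta> (act K a k)"
          using elim a k u K.act_closed
          by (simp add: act_diff_left[OF K] bounded_ops_diff[OF nK nE \<theta>])
        then have "\<theta> (act K (u e \<ominus>\<^bsub>A\<^esub> a) k) x = \<theta> (act K (u e) k) x - \<theta> (act K a k) x"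
          using elim a k x u K.act_closed bounded_ops_closed[OF \<theta>]
          by (subst (asm) E.E.diff_eq) simp_all
        then show ?case using bd[of "u e \<ominus>\<^bsub>A\<^esub> a" k x] elim a k x u by simp
      qed
      have "((\<lambda>e. nrm A (u e \<ominus>\<^bsub>A\<^esub> a)) \<longlongrightarrow> 0) G" using lim G(1) tendsto_mono by blast
      then show "((\<lambda>e. C * nrm A (u e \<ominus>\<^bsub>A\<^esub> a) * nrm K k * nrm X x) \<longlongrightarrow> 0) G"
        using tendsto_mult_left_zero tendsto_mult_right_zero by blast
    qed
    then show ?thesis by (simp add: LIM_zero_iff)
  qed
  have aR: "act ?E a (R k) = \<theta> (act K a k)" if a: "a \<in> carrier A" and k: "k \<in> carrier K" for a k
  proof (rule extensionalityI)
    show "act ?E a (R k) \<in> extensional (carrier X)" by simp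
    show "\<theta> (act K a k) \<in> extensional (carrier X)"
      using \<theta>f[OF K.act_closed[OF a k]] by (rule bounded_ops_extensional)
    fix x assume x: "x \<in> carrier X"
    \<comment> \<open>Moving \<open>a\<close> from the vector to the functional gives
      \<open>\<theta> (e \<cdot> k) (a \<cdot> x) = \<theta> ((a * e) \<cdot> k) x\<close>, to which
      the right units apply.\<close>
    have "L (k, act X a x) = \<theta> (act K a k) x"
    proof (rule L_unique[OF k Xact[OF a x]])
      show "((\<lambda>e. \<theta> (act K e k) (act X a x)) \<longlongrightarrow> \<theta> (act K a k) x) G"
      proof (rule Lim_transform_eventually[OF \<theta>lim[OF a k x _ tendsto_nrm_unit(2)[OF a]]])
        show "\<forall>\<^sub>F e in G. \<theta> (act K (a \<otimes>\<^bsub>A\<^esub> e) k) x = \<theta> (act K e k) (act X a x)"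
          using carrG by eventually_elim (simp add: K.act_mult \<theta>act a k x)
      qed (use a mult_closed in auto)
    qed
    then show "act ?E a (R k) x = \<theta> (act K a k) x"
      using x k Xact[OF a x] by (simp add: R_def)
  qed
  have "R (act K a k) = act ?E a (R k)" if a: "a \<in> carrier A" and k: "k \<in> carrier K" for a k
  proof (rule extensionalityI)
    have ak: "act K a k \<in> carrier K" using a k by (rule K.act_closed)
    show "act ?E a (R k) \<in> extensional (carrier X)" by simp
    show "R (act K a k) \<in> extensional (carrier X)" using ak by (simp add: R_def)
    fix x assume x: "x \<in> carrier X"
    \<comment> \<open>Here \<open>e \<cdot> (a \<cdot> k) = (e * a) \<cdot> k\<close>, so the left
      units give the limit \<open>\<theta> (a \<cdot> k)\<close>, which is
      \<open>a \<cdot> R k\<close> by \<open>aR\<close>.\<close>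
    have "L (act K a k, x) = \<theta> (act K a k) x"
    proof (rule L_unique[OF ak x])
      show "((\<lambda>e. \<theta> (act K e (act K a k)) x) \<longlongrightarrow> \<theta> (act K a k) x) G"
      proof (rule Lim_transform_eventually[OF \<theta>lim[OF a k x _ tendsto_nrm_unit(1)[OF a]]])
        show "\<forall>\<^sub>F e in G. \<theta> (act K (e \<otimes>\<^bsub>A\<^esub> a) k) x = \<theta> (act K e (act K a k)) x"
          using carrG by eventually_elim (simp add: K.act_mult a k)
      qed (use a mult_closed in auto)
    qed
    then show "R (act K a k) x = act ?E a (R k) x"
      using aR[OF a k] x ak by (simp add: R_def del: dual_module_simps)
  qed
  with R_bdd have "R \<in> module_ops A K ?E" by (simp add: module_ops_def)
  then show "\<exists>R\<in>module_ops A K ?E. \<forall>a\<in>carrier A. \<forall>k\<in>carrier K. act ?E a (R k) = \<theta> (act K a k)"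
    using aR by blast
qed

end

text \<open>For \<open>r > 0\<close> this is the usual notion scaled to radius \<open>r\<close>,
  with a slack \<open>\<delta>\<close> in place of normalized vectors; for \<open>r = 0\<close> it
  holds in every normed space. The form suits vectors whose norms are only known to be close to a
  limit value \<open>r\<close>.\<close>

definition uniformly_convex :: "('v, 'm) normed_cspace_scheme \<Rightarrow> bool" where
  "uniformly_convex V \<longleftrightarrow> (\<forall>r\<ge>0. \<forall>\<epsilon>>0. \<exists>\<delta>>0. \<forall>x\<in>carrier V. \<forall>y\<in>carrier V.
     nrm V x \<le> r + \<delta> \<longrightarrow> nrm V y \<le> r + \<delta> \<longrightarrow> r - \<delta> \<le> nrm V ((1/2) \<odot>\<^bsub>V\<^esub> (x \<oplus>\<^bsub>V\<^esub> y)) \<longrightarrow>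
     nrm V (x \<ominus>\<^bsub>V\<^esub> y) \<le> \<epsilon>)"

lemma uniformly_convex_cong:
  assumes V: "complex_normed_space V" "uniformly_convex V"
    and eq: "carrier W = carrier V" "add W = add V" "zero W = zero V" "smult W = smult V"
      "nrm W = nrm V"
  shows "uniformly_convex W"
proof -
  interpret V: complex_normed_space V by fact
  interpret W: complex_normed_space W by (rule complex_normed_space_cong[OF V(1) eq])
  have "x \<ominus>\<^bsub>W\<^esub> y = x \<ominus>\<^bsub>V\<^esub> y" if "x \<in> carrier V" "y \<in> carrier V" for x y
    using that V.diff_eq[of x y] W.diff_eq[of x y] by (simp add: eq)
  then show ?thesis using V(2) unfolding uniformly_convex_def by (simp add: eq)
qed

text \<open>Elements of almost minimal norm of the members of \<open>\<C>\<close> form a Cauchy net.\<close>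

lemma (in complex_banach_space) uniformly_convex_cluster_point:
  assumes uc: "uniformly_convex V"
    and ne: "\<C> \<noteq> {}" "\<And>C. C \<in> \<C> \<Longrightarrow> C \<noteq> {}" "\<And>C. C \<in> \<C> \<Longrightarrow> C \<subseteq> carrier V"
    and mid: "\<And>C x y. \<lbrakk>C \<in> \<C>; x \<in> C; y \<in> C\<rbrakk> \<Longrightarrow> (1/2) \<odot>\<^bsub>V\<^esub> (x \<oplus>\<^bsub>V\<^esub> y) \<in> C"
    and dir: "\<And>C D. \<lbrakk>C \<in> \<C>; D \<in> \<C>\<rbrakk> \<Longrightarrow> \<exists>Z\<in>\<C>. Z \<subseteq> C \<inter> D"
    and bd: "\<And>C x. \<lbrakk>C \<in> \<C>; x \<in> C\<rbrakk> \<Longrightarrow> nrm V x \<le> B"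
  obtains g where "g \<in> carrier V" "nrm V g \<le> B"
    "\<And>C \<epsilon>. \<lbrakk>C \<in> \<C>; \<epsilon> > 0\<rbrakk> \<Longrightarrow> \<exists>x\<in>C. nrm V (x \<ominus>\<^bsub>V\<^esub> g) < \<epsilon>"
proof -
  define d where "d C = Inf (nrm V ` C)" for C
  \<comment> \<open>The infima of the norms increase as the sets shrink; \<open>r\<close> is their
    limit along the directed family.\<close>
  define r where "r = Sup (d ` \<C>)"
  have bdd: "bdd_below (nrm V ` C)" if "C \<in> \<C>" for C
    using ne(3)[OF that] nrm_nonneg by (intro bdd_belowI2[where m = 0]) auto
  have d_le: "d C \<le> nrm V x" if "C \<in> \<C>" "x \<in> C" for C x
    unfolding d_def using bdd that by (intro cInf_lower) auto
  have d_nonneg: "0 \<le> d C" if "C \<in> \<C>" for C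
    unfolding d_def using ne(2,3)[OF that] nrm_nonneg by (intro cInf_greatest) auto
  have d_B: "d C \<le> B" if "C \<in> \<C>" for C
    using ne(2)[OF that] d_le[OF that] bd[OF that] by (meson all_not_in_conv order_trans)
  have d_r: "d C \<le> r" if "C \<in> \<C>" for C
    unfolding r_def using that d_B by (intro cSup_upper bdd_aboveI2[where M = B]) auto
  have r0: "0 \<le> r" using ne(1) d_nonneg d_r by (meson all_not_in_conv order_trans)
  have almost: "\<exists>x\<in>C. nrm V x \<le> r + \<delta>" if "C \<in> \<C>" "\<delta> > 0" for C \<delta>
  proof -
    have "Inf (nrm V ` C) < r + \<delta>" using d_r[OF that(1)] that(2) by (simp add: d_def)
    then have "\<exists>y\<in>nrm V ` C. y < r + \<delta>"
      using ne(2)[OF that(1)] bdd[OF that(1)] by (subst (asm) cInf_less_iff) auto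
    then show ?thesis by force
  qed
  have "\<exists>C\<in>\<C>. \<exists>\<delta>>0. \<forall>x\<in>C. \<forall>y\<in>C. nrm V x \<le> r + \<delta> \<longrightarrow> nrm V y \<le> r + \<delta> \<longrightarrow> nrm V (x \<ominus>\<^bsub>V\<^esub> y) \<le> \<epsilon>"
    if "\<epsilon> > 0" for \<epsilon>
  proof -
    obtain \<delta> where \<delta>: "\<delta> > 0" "\<forall>x\<in>carrier V. \<forall>y\<in>carrier V.
     nrm V x \<le> r + \<delta> \<longrightarrow> nrm V y \<le> r + \<delta> \<longrightarrow> r - \<delta> \<le> nrm V ((1/2) \<odot>\<^bsub>V\<^esub> (x \<oplus>\<^bsub>V\<^esub> y)) \<longrightarrow>
     nrm V (x \<ominus>\<^bsub>V\<^esub> y) \<le> \<epsilon>"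
      using uc r0 \<open>\<epsilon> > 0\<close> unfolding uniformly_convex_def by meson
    have "\<exists>y\<in>d ` \<C>. r - \<delta> < y"
      using \<delta>(1) ne(1) d_B unfolding r_def
      by (subst less_cSup_iff[symmetric]) (auto intro: bdd_aboveI2[where M = B])
    then obtain C where C: "C \<in> \<C>" "r - \<delta> < d C" by auto
    \<comment> \<open>Closure under midpoints enters here: the midpoint lies in \<open>C\<close>, so
      its norm is at least \<open>d C\<close>.\<close>
    have "r - \<delta> \<le> nrm V ((1/2) \<odot>\<^bsub>V\<^esub> (x \<oplus>\<^bsub>V\<^esub> y))" if "x \<in> C" "y \<in> C" for x y
      using d_le[OF C(1) mid[OF C(1) that]] C(2) by linarith
    then show ?thesis using \<delta> C(1) ne(3)[OF C(1)] by (meson subsetD)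
  qed
  then have "\<forall>n. \<exists>C. C \<in> \<C> \<and> (\<exists>\<delta>>0. \<forall>x\<in>C. \<forall>y\<in>C. nrm V x \<le> r + \<delta> \<longrightarrow> nrm V y \<le> r + \<delta> \<longrightarrow>
      nrm V (x \<ominus>\<^bsub>V\<^esub> y) \<le> inverse (real (Suc n)))"
    by (metis inverse_positive_iff_positive of_nat_0_less_iff zero_less_Suc)
  then obtain C \<delta> where C: "\<And>n. C n \<in> \<C>" and \<delta>: "\<And>n. \<delta> n > (0::real)"
    and close: "\<And>n x y. \<lbrakk>x \<in> C n; y \<in> C n; nrm V x \<le> r + \<delta> n; nrm V y \<le> r + \<delta> n\<rbrakk>
      \<Longrightarrow> nrm V (x \<ominus>\<^bsub>V\<^esub> y) \<le> inverse (real (Suc n))"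
    by metis
  \<comment> \<open>Directedness handles finitely many sets at a time: \<open>Z n\<close> lies in
    each of \<open>C 0, ..., C n\<close>.\<close>
  have "\<exists>Z\<in>\<C>. \<forall>m\<le>n. Z \<subseteq> C m" for n
  proof (induction n)
    case 0
    then show ?case using C by auto
  next
    case (Suc n)
    then obtain Z where "Z \<in> \<C>" "\<forall>m\<le>n. Z \<subseteq> C m" by auto
    then show ?case using dir[of Z "C (Suc n)"] C by (metis le_Suc_eq le_inf_iff subset_trans)
  qed
  then obtain Z where Z: "\<And>n. Z n \<in> \<C>" and ZC: "\<And>m n. m \<le> n \<Longrightarrow> Z n \<subseteq> C m" by metis
  \<comment> \<open>Small enough that \<open>s n\<close> passes the norm test of every
    \<open>C m\<close> with \<open>m \<le> n\<close>.\<close>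
  define \<eta> where "\<eta> n = Min (\<delta> ` {..n})" for n
  have \<eta>: "\<eta> n > 0" "m \<le> n \<Longrightarrow> \<eta> n \<le> \<delta> m" for m n
    using \<delta> by (auto simp: \<eta>_def)
  have "\<exists>x. x \<in> Z n \<and> nrm V x \<le> r + \<eta> n" for n using almost[OF Z \<eta>(1)] by blast
  then obtain s where s: "\<And>n. s n \<in> Z n" and s_nrm: "\<And>n. nrm V (s n) \<le> r + \<eta> n"
    by metis
  have s_carrier: "s n \<in> carrier V" for n using s Z ne(3) by blast
  have s_close: "nrm V (x \<ominus>\<^bsub>V\<^esub> s n) \<le> inverse (real (Suc N))"
    if "N \<le> n" "x \<in> C N" "nrm V x \<le> r + \<delta> N" for N n x
    using that s[of n] ZC[OF that(1)] s_nrm[of n] \<eta>(2)[OF that(1)]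
        by (intro close) (auto intro: order_trans)
  have "\<exists>l\<in>carrier V. (\<lambda>n. nrm V (s n \<ominus>\<^bsub>V\<^esub> l)) \<longlonglongrightarrow> 0"
  proof (rule complete[OF s_carrier])
    fix e :: real assume "e > 0"
    then obtain N where N: "inverse (real (Suc N)) < e" using reals_Archimedean by blast
    have "nrm V (s m \<ominus>\<^bsub>V\<^esub> s n) < e" if "m \<ge> N" "n \<ge> N" for m n
      using s_close[OF that(2), of "s m"] s[of m] ZC[OF that(1)] s_nrm[of m] \<eta>(2)[OF that(1)] N
      by (meson add_left_mono order_trans subsetD le_less_trans)
    then show "\<exists>N. \<forall>m\<ge>N. \<forall>n\<ge>N. nrm V (s m \<ominus>\<^bsub>V\<^esub> s n) < e" by blast
  qed
  then obtain g where g: "g \<in> carrier V" and lim: "(\<lambda>n. nrm V (s n \<ominus>\<^bsub>V\<^esub> g)) \<longlonglongrightarrow> 0" by blast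
  show ?thesis
  proof (rule that[OF g])
    show "nrm V g \<le> B"
    proof (rule LIMSEQ_le_const)
      show "(\<lambda>n. nrm V (s n \<ominus>\<^bsub>V\<^esub> g) + B) \<longlonglongrightarrow> B" using tendsto_add[OF lim tendsto_const] by simp
      have "nrm V g \<le> nrm V (s n \<ominus>\<^bsub>V\<^esub> g) + B" for n
        using nrm_le_diff_add[OF g s_carrier, of n] nrm_diff_commute[OF g s_carrier, of n]
          bd[OF Z s, of n] by linarith
      then show "\<exists>N. \<forall>n\<ge>N. nrm V g \<le> nrm V (s n \<ominus>\<^bsub>V\<^esub> g) + B" by blast
    qed
    fix D and \<epsilon> :: real assume D: "D \<in> \<C>" and "\<epsilon> > 0"
    then obtain N where N: "inverse (real (Suc N)) < \<epsilon> / 2" using reals_Archimedean[of "\<epsilon> / 2"]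
        by auto
    \<comment> \<open>The sequence \<open>s\<close> determines \<open>g\<close>, but the family may
      be uncountable. An arbitrary \<open>D\<close> is reached by intersecting it with a single
      \<open>C N\<close>, whose almost minimal elements are all close to \<open>s n\<close> for
      large \<open>n\<close> and hence to \<open>g\<close>.\<close>
    obtain Y where Y: "Y \<in> \<C>" "Y \<subseteq> D \<inter> C N" using dir[OF D C] by blast
    obtain x where x: "x \<in> Y" "nrm V x \<le> r + \<delta> N" using almost[OF Y(1) \<delta>] by blast
    have xc: "x \<in> carrier V" using x Y ne(3) by blast
    have "\<forall>\<^sub>F n in sequentially. nrm V (s n \<ominus>\<^bsub>V\<^esub> g) < \<epsilon> / 2"
      using order_tendstoD(2)[OF lim, of "\<epsilon> / 2"] \<open>\<epsilon> > 0\<close> by simp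
    then obtain n where n: "n \<ge> N" "nrm V (s n \<ominus>\<^bsub>V\<^esub> g) < \<epsilon> / 2"
      using eventually_happens[OF eventually_conj[OF eventually_ge_at_top[of N]]] by force
    have "nrm V (x \<ominus>\<^bsub>V\<^esub> g) < \<epsilon>"
      using nrm_diff_triangle[OF xc s_carrier[of n] g] s_close[OF n(1), of x] x Y n N by auto
    then show "\<exists>x\<in>D. nrm V (x \<ominus>\<^bsub>V\<^esub> g) < \<epsilon>" using x Y by blast
  qed
qed

text \<open>A cluster point of \<open>\<theta> (e \<cdot> k)\<close> is found for each
  \<open>k\<close> separately; \<open>unique\<close> then serves three times, for additivity,
  homogeneity and equivariance of this choice.\<close>

theorem (in approximate_identity) zero_injective_uniformly_convex:
  fixes E :: "('a, 'e) banach_act"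
  assumes E: "banach_left_module A E" and uc: "uniformly_convex E"
    and faithful: "\<And>x. \<lbrakk>x \<in> carrier E; \<And>a. a \<in> carrier A \<Longrightarrow> act E a x = \<zero>\<^bsub>E\<^esub>\<rbrakk> \<Longrightarrow> x = \<zero>\<^bsub>E\<^esub>"
  shows "zero_injective TYPE('f) TYPE('k) A E"
proof (rule zero_injectiveI[OF E])
  fix K :: "('a, 'k) banach_act" and \<theta>
  assume K: "banach_left_module A K" and \<theta>: "\<theta> \<in> bounded_ops K E"
    and \<theta>act: "\<And>a b k. \<lbrakk>a \<in> carrier A; b \<in> carrier A; k \<in> carrier K\<rbrakk>
         \<Longrightarrow> \<theta> (act K a (act K b k)) = act E a (\<theta> (act K b k))"
  interpret E: banach_left_module A E by fact
  interpret K: banach_left_module A K by fact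
  have nE: "complex_normed_space E" and nK: "complex_normed_space K" by unfold_locales
  obtain C where C: "C > 0"
    "\<And>a k. \<lbrakk>a \<in> carrier A; k \<in> carrier K\<rbrakk> \<Longrightarrow> nrm E (\<theta> (act K a k)) \<le> C * nrm A a * nrm K k"
    using act_theta_bound[OF K \<theta>] by blast
  obtain D where D: "D > 0"
    "\<And>a x. \<lbrakk>a \<in> carrier A; x \<in> carrier E\<rbrakk> \<Longrightarrow> nrm E (act E a x) \<le> D * nrm A a * nrm E x"
    using act_bound[OF E] by blast
  have \<theta>c: "\<theta> (act K a k) \<in> carrier E" if "a \<in> carrier A" "k \<in> carrier K" for a k
    using that by (intro bounded_ops_closed[OF \<theta>] K.act_closed)
  have unique: "x = y"
    if "x \<in> carrier E" "y \<in> carrier E" "\<And>a. a \<in> carrier A \<Longrightarrow> act E a x = act E a y" for x y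
    using that faithful[of "x \<ominus>\<^bsub>E\<^esub> y"]
    by (simp add: act_diff_right[OF E] E.E.diff_eq_0_iff E.act_closed)
  have "\<exists>g\<in>carrier E. nrm E g \<le> C * nrm K k \<and> (\<forall>a\<in>carrier A. act E a g = \<theta> (act K a k))"
    if k: "k \<in> carrier K" for k
  proof -
    \<comment> \<open>The map \<open>e \<mapsto> \<theta> (e \<cdot> k)\<close> is linear and
      bounded, so the images of the members of \<open>\<L>\<close> are again closed under midpoints,
      directed and uniformly bounded.\<close>
    let ?D = "\<lambda>X. (\<lambda>e. \<theta> (act K e k)) ` X"
    obtain g where g: "g \<in> carrier E" "nrm E g \<le> C * nrm K k"
      and near: "\<And>X \<epsilon>. \<lbrakk>X \<in> ?D ` \<L>; \<epsilon> > 0\<rbrakk> \<Longrightarrow> \<exists>x\<in>X. nrm E (x \<ominus>\<^bsub>E\<^esub> g) < \<epsilon>"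
    proof (rule E.E.uniformly_convex_cluster_point[OF uc, of "?D ` \<L>" "C * nrm K k"])
      show "?D ` \<L> \<noteq> {}" using nonempty by simp
      show "\<And>Y. Y \<in> ?D ` \<L> \<Longrightarrow> Y \<noteq> {}" using nonempty_mem by auto
      show "\<And>Y. Y \<in> ?D ` \<L> \<Longrightarrow> Y \<subseteq> carrier E" using subset_carrier \<theta>c k by blast
      show "\<exists>Z\<in>?D ` \<L>. Z \<subseteq> Y \<inter> Y'" if YY: "Y \<in> ?D ` \<L>" "Y' \<in> ?D ` \<L>" for Y Y'
      proof -
        obtain X X' where X: "X \<in> \<L>" "X' \<in> \<L>" "Y = ?D X" "Y' = ?D X'" using YY by auto
        obtain Z where "Z \<in> \<L>" "Z \<subseteq> X \<inter> X'" using directed[OF X(1,2)] by blast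
        then show ?thesis using X by (intro bexI[of _ "?D Z"]) auto
      qed
    next
      fix Y x y assume "Y \<in> ?D ` \<L>" "x \<in> Y" "y \<in> Y"
      then obtain X e f where X: "X \<in> \<L>" "Y = ?D X" and ef: "e \<in> X" "f \<in> X"
        and xy: "x = \<theta> (act K e k)" "y = \<theta> (act K f k)" by auto
      have efc: "e \<in> carrier A" "f \<in> carrier A" using subset_carrier X ef by auto
      have "(1/2) \<odot>\<^bsub>E\<^esub> (x \<oplus>\<^bsub>E\<^esub> y) = \<theta> (act K ((1/2) \<odot>\<^bsub>A\<^esub> (e \<oplus>\<^bsub>A\<^esub> f)) k)"
        using efc k K.act_closed
        by (simp only: xy K.act_smult_left K.act_add_left bounded_ops_smult[OF \<theta>]
            bounded_ops_add[OF \<theta>] M.add.m_closed K.E.add.m_closed)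
      then show "(1/2) \<odot>\<^bsub>E\<^esub> (x \<oplus>\<^bsub>E\<^esub> y) \<in> Y" using midpoint[OF X(1) ef] X(2) by blast
    next
      fix Y x assume "Y \<in> ?D ` \<L>" "x \<in> Y"
      then obtain X e where X: "X \<in> \<L>" "e \<in> X" and x: "x = \<theta> (act K e k)" by auto
      have e: "e \<in> carrier A" using subset_carrier X by auto
      have "nrm E x \<le> C * nrm A e * nrm K k" using C(2)[OF e k] x by simp
      also have "\<dots> \<le> C * 1 * nrm K k"
        using nrm_le_1[OF X] C(1) k by (intro mult_right_mono mult_left_mono K.E.nrm_nonneg) auto
      finally show "nrm E x \<le> C * nrm K k" by simp
    qed (rule that)
    have "act E a g = \<theta> (act K a k)" if a: "a \<in> carrier A" for a
    proof (rule E.E.eq_if_nrm_diff_small)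
      fix \<epsilon> :: real assume \<epsilon>: "\<epsilon> > 0"
      \<comment> \<open>Replacing \<open>g\<close> by \<open>\<theta> (e \<cdot> k)\<close>, and
        \<open>a * e\<close> by \<open>a\<close>, may each cost \<open>\<epsilon> / 2\<close>;
        adding 1 keeps the denominators positive.\<close>
      define \<epsilon>1 where "\<epsilon>1 = \<epsilon> / 2 / (D * (nrm A a + 1))"
      define \<epsilon>2 where "\<epsilon>2 = \<epsilon> / 2 / (C * (nrm K k + 1))"
      have pos: "\<epsilon>1 > 0" "\<epsilon>2 > 0"
        using \<epsilon> C(1) D(1) nrm_nonneg[OF a] K.E.nrm_nonneg[OF k] by (auto simp: \<epsilon>1_def \<epsilon>2_def)
      obtain X where X: "X \<in> \<L>" and X2: "\<And>e. e \<in> X \<Longrightarrow> nrm A (a \<otimes>\<^bsub>A\<^esub> e \<ominus>\<^bsub>A\<^esub> a) < \<epsilon>2"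
        using right_unit[OF a pos(2)] by blast
      obtain e where e: "e \<in> X" "nrm E (\<theta> (act K e k) \<ominus>\<^bsub>E\<^esub> g) < \<epsilon>1"
        using near[of "?D X", OF _ pos(1)] X by blast
      have ec: "e \<in> carrier A" using subset_carrier X e by auto
      have ae: "a \<otimes>\<^bsub>A\<^esub> e \<in> carrier A" using a ec by (rule mult_closed)
      have "act E a (\<theta> (act K e k)) = \<theta> (act K (a \<otimes>\<^bsub>A\<^esub> e) k)"
        using a ec k by (simp add: \<theta>act K.act_mult)
      then have "nrm E (act E a g \<ominus>\<^bsub>E\<^esub> \<theta> (act K (a \<otimes>\<^bsub>A\<^esub> e) k))
          = nrm E (act E a (g \<ominus>\<^bsub>E\<^esub> \<theta> (act K e k)))"
        using a ec k g \<theta>c by (simp add: act_diff_right[OF E])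
      also have "\<dots> \<le> D * nrm A a * nrm E (g \<ominus>\<^bsub>E\<^esub> \<theta> (act K e k))"
        using a ec k g \<theta>c by (intro D) auto
      also have "\<dots> \<le> D * nrm A a * \<epsilon>1"
        using e g \<theta>c[OF ec k] D(1) nrm_nonneg[OF a]
        by (intro mult_left_mono) (auto simp: E.E.nrm_diff_commute)
      also have "\<dots> \<le> D * (nrm A a + 1) * \<epsilon>1"
        using pos D(1) by (intro mult_right_mono mult_left_mono) auto
      also have "\<dots> = \<epsilon> / 2"
        using D(1) nrm_nonneg[OF a] by (simp add: \<epsilon>1_def)
      finally have 1: "nrm E (act E a g \<ominus>\<^bsub>E\<^esub> \<theta> (act K (a \<otimes>\<^bsub>A\<^esub> e) k)) \<le> \<epsilon> / 2" .
      have "nrm E (\<theta> (act K (a \<otimes>\<^bsub>A\<^esub> e) k) \<ominus>\<^bsub>E\<^esub> \<theta> (act K a k))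
          = nrm E (\<theta> (act K (a \<otimes>\<^bsub>A\<^esub> e \<ominus>\<^bsub>A\<^esub> a) k))"
        using a ae k K.act_closed by (simp add: act_diff_left[OF K] bounded_ops_diff[OF nK nE \<theta>])
      also have "\<dots> \<le> C * nrm A (a \<otimes>\<^bsub>A\<^esub> e \<ominus>\<^bsub>A\<^esub> a) * nrm K k" using a ae k by (intro C) auto
      also have "\<dots> \<le> C * \<epsilon>2 * nrm K k"
        using X2[OF e(1)] C(1) k by (intro mult_right_mono mult_left_mono K.E.nrm_nonneg) auto
      also have "\<dots> \<le> C * \<epsilon>2 * (nrm K k + 1)"
        using pos C(1) by (intro mult_left_mono) auto
      also have "\<dots> = \<epsilon> / 2"
        using C(1) K.E.nrm_nonneg[OF k] by (simp add: \<epsilon>2_def divide_simps)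
      finally have 2: "nrm E (\<theta> (act K (a \<otimes>\<^bsub>A\<^esub> e) k) \<ominus>\<^bsub>E\<^esub> \<theta> (act K a k)) \<le> \<epsilon> / 2" .
      show "nrm E (act E a g \<ominus>\<^bsub>E\<^esub> \<theta> (act K a k)) \<le> \<epsilon>"
        using E.E.nrm_diff_triangle[OF E.act_closed[OF a g(1)] \<theta>c[OF ae k] \<theta>c[OF a k]] 1 2
            by linarith
    qed (use a k g \<theta>c E.act_closed in auto)
    then show ?thesis using g by blast
  qed
  then obtain g where g: "\<And>k. k \<in> carrier K \<Longrightarrow> g k \<in> carrier E"
    and g_nrm: "\<And>k. k \<in> carrier K \<Longrightarrow> nrm E (g k) \<le> C * nrm K k"
    and g_act: "\<And>a k. \<lbrakk>a \<in> carrier A; k \<in> carrier K\<rbrakk> \<Longrightarrow> act E a (g k) = \<theta> (act K a k)"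
    by metis
  define R where "R = restrict g (carrier K)"
  have "R \<in> bounded_ops K E"
  proof (rule bounded_opsI[where C = C])
    show "R \<in> carrier K \<rightarrow>\<^sub>E carrier E" using g by (auto simp: R_def)
    fix k l assume kl: "k \<in> carrier K" "l \<in> carrier K"
    have "g (k \<oplus>\<^bsub>K\<^esub> l) = g k \<oplus>\<^bsub>E\<^esub> g l"
      by (rule unique) (use kl g K.act_closed in
          \<open>auto simp: g_act E.act_add_right K.act_add_right bounded_ops_add[OF \<theta>]\<close>)
    then show "R (k \<oplus>\<^bsub>K\<^esub> l) = R k \<oplus>\<^bsub>E\<^esub> R l" using kl by (simp add: R_def)
  next
    fix c k assume k: "k \<in> carrier K"
    have "g (c \<odot>\<^bsub>K\<^esub> k) = c \<odot>\<^bsub>E\<^esub> g k"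
      by (rule unique) (use k g K.act_closed in
          \<open>auto simp: g_act E.act_smult_right K.act_smult_right bounded_ops_smult[OF \<theta>]\<close>)
    then show "R (c \<odot>\<^bsub>K\<^esub> k) = c \<odot>\<^bsub>E\<^esub> R k" using k by (simp add: R_def)
  qed (use g_nrm in \<open>simp add: R_def\<close>)
  \<comment> \<open>After any \<open>b\<close> has acted, both sides become
    \<open>b \<cdot> \<theta> (a \<cdot> k)\<close>: on the left by the partial equivariance of
    \<open>\<theta>\<close>, on the right by \<open>g_act\<close>.\<close>
  moreover have "g (act K a k) = act E a (g k)" if "a \<in> carrier A" "k \<in> carrier K" for a k
    by (rule unique) (use that g K.act_closed E.act_closed mult_closed in
        \<open>auto simp: g_act \<theta>act \<theta>c\<close>)
  then have "\<forall>a\<in>carrier A. \<forall>k\<in>carrier K. R (act K a k) = act E a (R k)"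
    using K.act_closed by (simp add: R_def)
  ultimately have "R \<in> module_ops A K E" by (simp add: module_ops_def)
  then show "\<exists>R\<in>module_ops A K E. \<forall>a\<in>carrier A. \<forall>k\<in>carrier K. act E a (R k) = \<theta> (act K a k)"
    using g_act by (intro bexI[of _ R]) (auto simp: R_def)
qed

section \<open>Lebesgue spaces\<close>

text \<open>Strict convexity, by the mean value theorem on either side of \<open>s\<close>. At
  \<open>t = 0\<close>, outside the range of the derivative formula, the left side is
  \<open>(1 - p) * s powr p\<close> and hence negative.\<close>

lemma powr_above_tangent:
  fixes s t p :: real
  assumes "1 < p" "0 < s" "0 \<le> t" "t \<noteq> s"
  shows "s powr p + p * s powr (p - 1) * (t - s) < t powr p"
proof (cases "t = 0")
  case True
  have "s powr (p - 1) * s = s powr p" using assms by (simp add: powr_diff)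
  then show ?thesis using assms True by (simp add: mult.assoc)
next
  case False
  then have t: "t > 0" using assms by simp
  have der: "DERIV (\<lambda>x. x powr p) x :> p * x powr (p - 1)" if "x > 0" for x :: real
    using that by (auto intro!: derivative_eq_intros simp: powr_diff)
  show ?thesis
  proof (cases "s < t")
    case True
    obtain z where z: "s < z" "z < t" "t powr p - s powr p = (t - s) * (p * z powr (p - 1))"
      using MVT2[OF True, of "\<lambda>x. x powr p" "\<lambda>x. p * x powr (p - 1)"] der assms(2)
      by (metis dual_order.strict_trans1)
    have "s powr (p - 1) < z powr (p - 1)"
      using z assms by (intro powr_less_mono2) auto
    then have "(t - s) * (p * s powr (p - 1)) < (t - s) * (p * z powr (p - 1))"
      using True assms(1) by simp
    then show ?thesis using z(3) by (simp add: mult_ac)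
  next
    case False
    then have ts: "t < s" using assms(4) by simp
    obtain z where z: "t < z" "z < s" "s powr p - t powr p = (s - t) * (p * z powr (p - 1))"
      using MVT2[OF ts, of "\<lambda>x. x powr p" "\<lambda>x. p * x powr (p - 1)"] der t
      by (metis dual_order.strict_trans1)
    have "z powr (p - 1) < s powr (p - 1)"
      using z t assms by (intro powr_less_mono2) auto
    then have "(s - t) * (p * z powr (p - 1)) < (s - t) * (p * s powr (p - 1))"
      using ts assms(1) by simp
    then show ?thesis using z(3) by (simp add: algebra_simps)
  qed
qed

lemma powr_above_tangent_le:
  fixes s t p :: real
  assumes "1 \<le> p" "0 < s" "0 \<le> t"
  shows "s powr p + p * s powr (p - 1) * (t - s) \<le> t powr p"
  using powr_above_tangent[of p s t] assms
  by (cases "t = s"; cases "p = 1") (auto simp: less_imp_le)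

text \<open>Jensen's inequality for two points: average the tangent inequalities at the mean
  \<open>m\<close>, where the linear terms cancel.\<close>

lemma powr_convex_comb:
  fixes s t p u v :: real
  assumes p: "1 \<le> p" and st: "0 \<le> s" "0 \<le> t" and uv: "0 \<le> u" "0 \<le> v" "u + v = 1"
  shows "(u * s + v * t) powr p \<le> u * s powr p + v * t powr p"
proof (cases "u * s + v * t = 0")
  case False
  define m where "m = u * s + v * t"
  have m: "m > 0" using False st uv by (simp add: m_def less_le)
  have v: "v = 1 - u" using uv(3) by simp
  have "u * (m powr p + p * m powr (p - 1) * (s - m)) \<le> u * s powr p"
    "v * (m powr p + p * m powr (p - 1) * (t - m)) \<le> v * t powr p"
    using uv powr_above_tangent_le[OF p m] st by (auto intro!: mult_left_mono)
  moreover have "u * (m powr p + p * m powr (p - 1) * (s - m)) + v * (m powr p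
      + p * m powr (p - 1) * (t - m))
      = (u + v) * m powr p + p * m powr (p - 1) * (u * s + v * t - (u + v) * m)"
    by (simp add: algebra_simps)
  ultimately show ?thesis using uv(3) by (simp add: m_def)
qed (use assms in simp)

lemma powr_midpoint_strict:
  fixes s t p :: real
  assumes p: "1 < p" and st: "0 \<le> s" "0 \<le> t" "s \<noteq> t"
  shows "((s + t) / 2) powr p < (s powr p + t powr p) / 2"
proof -
  define m where "m = (s + t) / 2"
  have m: "m > 0" "s \<noteq> m" "t \<noteq> m" using st by (auto simp: m_def)
  have "p * m powr (p - 1) * (s - m) + p * m powr (p - 1) * (t - m)
      = p * m powr (p - 1) * (s + t - 2 * m)"
    by (simp add: algebra_simps)
  then have "p * m powr (p - 1) * (s - m) + p * m powr (p - 1) * (t - m) = 0"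
    by (simp add: m_def)
  then show ?thesis
    using powr_above_tangent[OF p m(1) st(1) m(2)] powr_above_tangent[OF p m(1) st(2) m(3)]
    by (simp add: m_def[symmetric])
qed

text \<open>For \<open>1 \<le> p\<close> a seminorm on \<open>Lp_functions\<close>; working with
  functions postpones the quotient by null functions. If the integrand is not integrable the
  integral is 0 by default, so the value is meaningful on \<open>Lp_functions\<close> only.\<close>

definition Lp_nrm :: "real \<Rightarrow> 'g measure \<Rightarrow> ('g \<Rightarrow> complex) \<Rightarrow> real" where
  "Lp_nrm p M f = (\<integral>x. cmod (f x) powr p \<partial>M) powr (1 / p)"

lemma Lp_functionsD [dest]:
  assumes "f \<in> Lp_functions p M"
  shows "f \<in> borel_measurable M" "integrable M (\<lambda>x. cmod (f x) powr p)"
  using assms by (auto simp: Lp_functions_def)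

lemma Lp_nrm_nonneg [simp]: "0 \<le> Lp_nrm p M f"
  by (simp add: Lp_nrm_def)

lemma Lp_nrm_powr: "p > 0 \<Longrightarrow> Lp_nrm p M f powr p = (\<integral>x. cmod (f x) powr p \<partial>M)"
  by (simp add: Lp_nrm_def powr_powr)

lemma Lp_nrm_leI:
  assumes "p > 0" "0 \<le> C" "(\<integral>x. cmod (f x) powr p \<partial>M) \<le> C powr p"
  shows "Lp_nrm p M f \<le> C"
proof -
  have "Lp_nrm p M f \<le> (C powr p) powr (1 / p)"
    unfolding Lp_nrm_def using assms by (intro powr_mono2) auto
  then show ?thesis using assms by (simp add: powr_powr)
qed

lemma Lp_functions_cong_AE:
  assumes "f \<in> Lp_functions p M" "g \<in> borel_measurable M" "AE x in M. f x = g x"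
  shows "g \<in> Lp_functions p M"
proof -
  have "integrable M (\<lambda>x. cmod (g x) powr p)"
    using Lp_functionsD[OF assms(1)] assms(2,3)
        by (subst integrable_cong_AE[of _ M "\<lambda>x. cmod (f x) powr p"]) auto
  then show ?thesis using assms by (simp add: Lp_functions_def)
qed

lemma Lp_nrm_cong_AE:
  assumes "f \<in> borel_measurable M" "g \<in> borel_measurable M" "AE x in M. f x = g x"
  shows "Lp_nrm p M f = Lp_nrm p M g"
  unfolding Lp_nrm_def using assms by (intro arg_cong2[where f = "(powr)"] integral_cong_AE) auto

lemma Lp_nrm_mono:
  assumes "p > 0" "f \<in> borel_measurable M" "g \<in> Lp_functions p M" "AE x in M. cmod (f x)
      \<le> cmod (g x)"
  shows "f \<in> Lp_functions p M" "Lp_nrm p M f \<le> Lp_nrm p M g"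
proof -
  have le: "AE x in M. cmod (f x) powr p \<le> cmod (g x) powr p"
    using assms(4) by eventually_elim (use assms(1) in \<open>auto intro!: powr_mono2\<close>)
  have int: "integrable M (\<lambda>x. cmod (f x) powr p)"
    by (rule Bochner_Integration.integrable_bound[OF Lp_functionsD(2)[OF assms(3)]])
      (use assms(2) le in auto)
  then show "f \<in> Lp_functions p M" using assms(2) by (simp add: Lp_functions_def)
  have "(\<integral>x. cmod (f x) powr p \<partial>M) \<le> (\<integral>x. cmod (g x) powr p \<partial>M)"
    by (rule integral_mono_AE[OF int Lp_functionsD(2)[OF assms(3)] le])
  then show "Lp_nrm p M f \<le> Lp_nrm p M g"
    using assms(1) by (auto simp: Lp_nrm_def intro!: powr_mono2)
qed

lemma Lp_functions_norm: "f \<in> Lp_functions p M \<Longrightarrow> (\<lambda>x. complex_of_real (cmod (f x))) \<in> Lp_functions p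
    M"
  by (auto simp: Lp_functions_def)

lemma Lp_nrm_norm: "Lp_nrm p M (\<lambda>x. complex_of_real (cmod (f x))) = Lp_nrm p M f"
  by (simp add: Lp_nrm_def)

lemma Lp_functions_zero [simp]: "(\<lambda>_. 0) \<in> Lp_functions p M"
  by (simp add: Lp_functions_def)

lemma Lp_nrm_zero [simp]: "Lp_nrm p M (\<lambda>_. 0) = 0"
  by (simp add: Lp_nrm_def)

lemma Lp_functions_cmult:
  assumes "f \<in> Lp_functions p M"
  shows "(\<lambda>x. c * f x) \<in> Lp_functions p M"
proof -
  have "integrable M (\<lambda>x. cmod c powr p * cmod (f x) powr p)"
    using assms by (intro integrable_mult_right) auto
  moreover have "(\<lambda>x. c * f x) \<in> borel_measurable M" using assms
      by (auto intro: borel_measurable_times)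
  ultimately show ?thesis by (simp add: Lp_functions_def norm_mult powr_mult)
qed

lemma Lp_nrm_cmult:
  assumes "p > 0"
  shows "Lp_nrm p M (\<lambda>x. c * f x) = cmod c * Lp_nrm p M f"
proof -
  have "Lp_nrm p M (\<lambda>x. c * f x) = (cmod c powr p * (\<integral>x. cmod (f x) powr p \<partial>M)) powr (1 / p)"
    by (simp add: Lp_nrm_def norm_mult powr_mult)
  also have "\<dots> = (cmod c powr p) powr (1 / p) * Lp_nrm p M f"
    by (simp add: Lp_nrm_def powr_mult)
  finally show ?thesis using assms by (simp add: powr_powr)
qed

text \<open>The convexity proof of Minkowski's inequality before integration:
  \<open>|a + b| / (u + v)\<close> is at most a convex combination of \<open>|a| / u\<close> and
  \<open>|b| / v\<close>, with weights proportional to \<open>u\<close> and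
  \<open>v\<close>.\<close>

lemma powr_norm_add_le:
  fixes a b :: complex
  assumes "1 \<le> p" "0 < u" "0 < v"
  shows "cmod (a + b) powr p \<le> (u + v) powr p *
    (u / (u + v) * (cmod a powr p / u powr p) + v / (u + v) * (cmod b powr p / v powr p))"
proof -
  have "(u + v) * (u / (u + v) * (cmod a / u) + v / (u + v) * (cmod b / v)) = cmod a + cmod b"
    using assms by (simp add: distrib_left)
  then have "cmod (a + b) \<le> (u + v) * (u / (u + v) * (cmod a / u) + v / (u + v) * (cmod b / v))"
    using norm_triangle_ineq[of a b] by simp
  then have "cmod (a + b) powr p \<le> ((u + v) * (u / (u + v) * (cmod a / u) + v / (u
      + v) * (cmod b / v))) powr p"
    using assms by (intro powr_mono2) auto
  also have "\<dots> = (u + v) powr p * (u / (u + v) * (cmod a / u) + v / (u + v) * (cmod b / v)) powr p"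
    using assms by (simp add: powr_mult)
  also have "(u / (u + v) * (cmod a / u) + v / (u + v) * (cmod b / v)) powr p
      \<le> u / (u + v) * (cmod a / u) powr p + v / (u + v) * (cmod b / v) powr p"
    using assms by (intro powr_convex_comb) (auto simp flip: add_divide_distrib)
  finally show ?thesis using assms by (simp add: powr_divide mult_left_mono)
qed

lemma
  assumes p: "1 \<le> p" and f: "f \<in> Lp_functions p M" and g: "g \<in> Lp_functions p M"
  shows Lp_functions_add: "(\<lambda>x. f x + g x) \<in> Lp_functions p M"
    and Lp_nrm_triangle: "Lp_nrm p M (\<lambda>x. f x + g x) \<le> Lp_nrm p M f + Lp_nrm p M g"
proof -
  note [measurable] = Lp_functionsD(1)[OF f] Lp_functionsD(1)[OF g]
  let ?F = "\<lambda>u v x. (u + v) powr p *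
      (u / (u + v) * (cmod (f x) powr p / u powr p) + v / (u + v) * (cmod (g x) powr p / v powr p))"
  have intF: "integrable M (?F u v)" for u v :: real
    using Lp_functionsD(2)[OF f] Lp_functionsD(2)[OF g] by simp
  have int: "integrable M (\<lambda>x. cmod (f x + g x) powr p)"
    by (rule Bochner_Integration.integrable_bound[OF intF[of 1 1]])
      (use powr_norm_add_le[OF p, of 1 1] in auto)
  then show "(\<lambda>x. f x + g x) \<in> Lp_functions p M" by (simp add: Lp_functions_def)
  \<comment> \<open>Numbers strictly above the two norms stay positive even when a norm is 0. With
    them the integrated convex combination is at most 1; letting them descend to the norms gives the
    triangle inequality.\<close>
  have *: "Lp_nrm p M (\<lambda>x. f x + g x) \<le> u + v" if u: "u > Lp_nrm p M f" and v: "v > Lp_nrm p M g"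
      for u v
  proof (rule Lp_nrm_leI)
    have pos: "u > 0" "v > 0" using u v Lp_nrm_nonneg le_less_trans by blast+
    then show "0 \<le> u + v" by simp
    have "(\<integral>x. cmod (f x + g x) powr p \<partial>M) \<le> (\<integral>x. ?F u v x \<partial>M)"
      using powr_norm_add_le[OF p pos] by (intro integral_mono int intF) auto
    also have "\<dots> = (u + v) powr p * (u / (u + v) * (Lp_nrm p M f powr p / u powr p)
        + v / (u + v) * (Lp_nrm p M g powr p / v powr p))"
      using Lp_functionsD(2)[OF f] Lp_functionsD(2)[OF g] p by (simp add: Lp_nrm_powr)
    also have "\<dots> \<le> (u + v) powr p * (u / (u + v) * 1 + v / (u + v) * 1)"
      using pos u v p by (intro mult_left_mono add_mono) (auto simp: divide_le_eq_1 intro!: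
          powr_mono2)
    also have "\<dots> = (u + v) powr p" using pos by (simp flip: add_divide_distrib)
    finally show "(\<integral>x. cmod (f x + g x) powr p \<partial>M) \<le> (u + v) powr p" .
  qed (use p in simp)
  show "Lp_nrm p M (\<lambda>x. f x + g x) \<le> Lp_nrm p M f + Lp_nrm p M g"
  proof (rule field_le_epsilon)
    fix e :: real assume "e > 0"
    then show "Lp_nrm p M (\<lambda>x. f x + g x) \<le> Lp_nrm p M f + Lp_nrm p M g + e"
      using *[of "Lp_nrm p M f + e / 2" "Lp_nrm p M g + e / 2"] by simp
  qed
qed

lemma
  assumes p: "1 \<le> p" and f: "f \<in> Lp_functions p M" and g: "g \<in> Lp_functions p M"
  shows Lp_functions_diff: "(\<lambda>x. f x - g x) \<in> Lp_functions p M"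
    and Lp_nrm_diff_le: "Lp_nrm p M (\<lambda>x. f x - g x) \<le> Lp_nrm p M f + Lp_nrm p M g"
  using Lp_functions_add[OF p f Lp_functions_cmult[OF g, of "-1"]]
    Lp_nrm_triangle[OF p f Lp_functions_cmult[OF g, of "-1"]] Lp_nrm_cmult[of p M "-1" g] p
  by simp_all

lemma Lp_nrm_diff_commute: "Lp_nrm p M (\<lambda>x. f x - g x) = Lp_nrm p M (\<lambda>x. g x - f x)"
  by (simp add: Lp_nrm_def norm_minus_commute)

lemma Lp_nrm_diff_triangle:
  assumes p: "1 \<le> p" and f: "f \<in> Lp_functions p M" and g: "g \<in> Lp_functions p M"
      and h: "h \<in> Lp_functions p M"
  shows "Lp_nrm p M (\<lambda>x. f x - h x) \<le> Lp_nrm p M (\<lambda>x. f x - g x) + Lp_nrm p M (\<lambda>x. g x - h x)"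
  using Lp_nrm_triangle[OF p Lp_functions_diff[OF p f g] Lp_functions_diff[OF p g h]] by simp

lemma
  assumes p: "1 \<le> p" and f: "\<And>n. n \<in> I \<Longrightarrow> f n \<in> Lp_functions p M" and "finite I"
  shows Lp_functions_sum: "(\<lambda>x. \<Sum>n\<in>I. f n x) \<in> Lp_functions p M"
    and Lp_nrm_sum: "Lp_nrm p M (\<lambda>x. \<Sum>n\<in>I. f n x) \<le> (\<Sum>n\<in>I. Lp_nrm p M (f n))"
proof -
  have "(\<lambda>x. \<Sum>n\<in>I. f n x) \<in> Lp_functions p M \<and>
    Lp_nrm p M (\<lambda>x. \<Sum>n\<in>I. f n x) \<le> (\<Sum>n\<in>I. Lp_nrm p M (f n))"
    using \<open>finite I\<close> f
  proof (induction I)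
    case (insert i I)
    then show ?case
      using Lp_functions_add[OF p, of "f i" M "\<lambda>x. \<Sum>n\<in>I. f n x"]
        Lp_nrm_triangle[OF p, of "f i" M "\<lambda>x. \<Sum>n\<in>I. f n x"] by auto
  qed simp
  then show "(\<lambda>x. \<Sum>n\<in>I. f n x) \<in> Lp_functions p M"
    "Lp_nrm p M (\<lambda>x. \<Sum>n\<in>I. f n x) \<le> (\<Sum>n\<in>I. Lp_nrm p M (f n))" by auto
qed

lemma Lp_nrm_eq_0_iff:
  assumes "p > 0" "f \<in> Lp_functions p M"
  shows "Lp_nrm p M f = 0 \<longleftrightarrow> (AE x in M. f x = 0)"
proof -
  have "Lp_nrm p M f = 0 \<longleftrightarrow> (\<integral>x. cmod (f x) powr p \<partial>M) = 0"
    using assms by (simp add: Lp_nrm_def)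
  also have "\<dots> \<longleftrightarrow> (AE x in M. cmod (f x) powr p = 0)"
    using assms by (intro integral_nonneg_eq_0_iff_AE) auto
  finally show ?thesis using assms by simp
qed

section \<open>Fatou's lemma, monotone limits and series in L^p\<close>

lemma Lp_nrm_fatou:
  assumes p: "0 < p" and f: "\<And>n. f n \<in> Lp_functions p M" and g: "g \<in> borel_measurable M"
    and lim: "AE x in M. (\<lambda>n. f n x) \<longlonglongrightarrow> g x" and bd: "\<And>n. Lp_nrm p M (f n) \<le> B"
  shows "g \<in> Lp_functions p M" "Lp_nrm p M g \<le> B"
proof -
  note [measurable] = Lp_functionsD(1)[OF f] g
  have B: "0 \<le> B" using bd[of 0] Lp_nrm_nonneg order_trans by blast
  have int: "(\<integral>\<^sup>+x. ennreal (cmod (f n x) powr p) \<partial>M) \<le> ennreal (B powr p)" for n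
  proof -
    have "(\<integral>\<^sup>+x. ennreal (cmod (f n x) powr p) \<partial>M) = ennreal (Lp_nrm p M (f n) powr p)"
      using Lp_functionsD(2)[OF f] p by (simp add: nn_integral_eq_integral Lp_nrm_powr)
    also have "\<dots> \<le> ennreal (B powr p)"
      using bd p by (intro ennreal_leI powr_mono2) auto
    finally show ?thesis .
  qed
  have "(\<integral>\<^sup>+x. ennreal (cmod (g x) powr p) \<partial>M)
      = (\<integral>\<^sup>+x. liminf (\<lambda>n. ennreal (cmod (f n x) powr p)) \<partial>M)"
  proof (rule nn_integral_cong_AE, use lim in eventually_elim)
    case (elim x)
    have "(\<lambda>n. ennreal (cmod (f n x) powr p)) \<longlonglongrightarrow> ennreal (cmod (g x) powr p)"
      using p elim by (intro tendsto_ennrealI tendsto_powr' tendsto_norm tendsto_const) auto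
    then show ?case using lim_imp_Liminf[OF trivial_limit_sequentially] by metis
  qed
  also have "\<dots> \<le> liminf (\<lambda>n. \<integral>\<^sup>+x. ennreal (cmod (f n x) powr p) \<partial>M)"
    by (rule nn_integral_liminf) simp
  also have "\<dots> \<le> ennreal (B powr p)"
    using int by (intro Liminf_le) auto
  finally have le: "(\<integral>\<^sup>+x. ennreal (cmod (g x) powr p) \<partial>M) \<le> ennreal (B powr p)" .
  then have "integrable M (\<lambda>x. cmod (g x) powr p)"
    by (intro integrableI_bounded) (auto simp: less_top[symmetric] top_unique)
  then show "g \<in> Lp_functions p M" using g by (simp add: Lp_functions_def)
  have "ennreal (\<integral>x. cmod (g x) powr p \<partial>M) \<le> ennreal (B powr p)"
    using le \<open>integrable M _\<close> by (simp add: nn_integral_eq_integral)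
  then show "Lp_nrm p M g \<le> B"
    using p B by (intro Lp_nrm_leI) (auto simp: ennreal_le_iff)
qed

text \<open>By monotone convergence the supremum of \<open>T N x powr p\<close> has finite integral
  and so is finite almost everywhere. It is applied to partial sums of absolute values and to
  convolutions of such sums.\<close>

lemma Lp_bounded_incseq:
  assumes p: "0 < p" and T: "\<And>N. (\<lambda>x. complex_of_real (T N x)) \<in> Lp_functions p M"
    and nn: "\<And>N x. 0 \<le> T N x" and mono: "\<And>x. incseq (\<lambda>N. T N x)"
    and bd: "\<And>N. Lp_nrm p M (\<lambda>x. complex_of_real (T N x)) \<le> B"
  shows "AE x in M. \<exists>C. \<forall>N. T N x \<le> C"
proof -
  define U where "U N x = ennreal (cmod (complex_of_real (T N x)) powr p)" for N x
  have U_meas [measurable]: "U N \<in> borel_measurable M" for N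
    unfolding U_def using Lp_functionsD(2)[OF T[of N]] by measurable
  have U_mono: "U m x \<le> U n x" if "m \<le> n" for m n x
    unfolding U_def using that p nn incseqD[OF mono that] by (intro ennreal_leI powr_mono2) auto
  have "(\<integral>\<^sup>+x. (SUP N. U N x) \<partial>M) = (SUP N. \<integral>\<^sup>+x. U N x \<partial>M)"
    by (rule nn_integral_monotone_convergence_SUP) (auto simp: incseq_def le_fun_def U_mono)
  also have "\<dots> \<le> ennreal (B powr p)"
  proof (rule SUP_least)
    fix N
    have "(\<integral>\<^sup>+x. U N x \<partial>M) = ennreal (Lp_nrm p M (\<lambda>x. complex_of_real (T N x)) powr p)"
      unfolding U_def using Lp_functionsD(2)[OF T] p
      by (subst nn_integral_eq_integral) (simp_all add: Lp_nrm_powr)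
    also have "\<dots> \<le> ennreal (B powr p)" using bd p by (intro ennreal_leI powr_mono2) auto
    finally show "(\<integral>\<^sup>+x. U N x \<partial>M) \<le> ennreal (B powr p)" .
  qed
  finally have "(\<integral>\<^sup>+x. (SUP N. U N x) \<partial>M) \<noteq> \<infinity>" by (auto simp: top_unique)
  then have "AE x in M. (SUP N. U N x) \<noteq> \<infinity>"
    by (intro nn_integral_PInf_AE) auto
  then show ?thesis
  proof eventually_elim
    case (elim x)
    then obtain C where C: "0 \<le> C" "(SUP N. U N x) = ennreal C"
      by (cases "SUP N. U N x") (auto simp: top_ennreal_def)
    have "T N x \<le> C powr (1 / p)" for N
    proof -
      have "ennreal (T N x powr p) \<le> ennreal C"
        using C SUP_upper[of N UNIV "\<lambda>N. U N x"] nn by (simp add: U_def)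
      then have "T N x powr p \<le> C" using C(1) by simp
      then have "(T N x powr p) powr (1 / p) \<le> C powr (1 / p)"
        using p by (intro powr_mono2) auto
      then show ?thesis using p nn by (simp add: powr_powr)
    qed
    then show ?case by blast
  qed
qed

text \<open>The Riesz-Fischer theorem for series. Summable norms force absolute convergence almost
  everywhere, and Fatou's lemma applied to the tails bounds the remainders by the tails of the
  series of norms.\<close>

lemma Lp_series:
  assumes p: "1 \<le> p" and h: "\<And>n. h n \<in> Lp_functions p M" and sum: "summable (\<lambda>n. Lp_nrm p M (h n))"
  obtains s where "s \<in> Lp_functions p M"
    "AE x in M. summable (\<lambda>n. cmod (h n x))" "AE x in M. (\<lambda>n. h n x) sums s x"
    "(\<lambda>N. Lp_nrm p M (\<lambda>x. s x - (\<Sum>n<N. h n x))) \<longlonglongrightarrow> 0"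
proof -
  note [measurable] = Lp_functionsD(1)[OF h]
  define T where "T N x = (\<Sum>n<N. cmod (h n x))" for N x
  have abs_h: "(\<lambda>x. complex_of_real (cmod (h n x))) \<in> Lp_functions p M" for n
    by (intro Lp_functions_norm h)
  have T_eq: "complex_of_real (T N x) = (\<Sum>n<N. complex_of_real (cmod (h n x)))" for N x
    by (simp add: T_def)
  have "AE x in M. \<exists>C. \<forall>N. T N x \<le> C"
  proof (rule Lp_bounded_incseq)
    show "(\<lambda>x. complex_of_real (T N x)) \<in> Lp_functions p M" for N
      unfolding T_eq by (intro Lp_functions_sum p abs_h) auto
    show "0 \<le> T N x" for N x by (simp add: T_def sum_nonneg)
    show "incseq (\<lambda>N. T N x)" for x
      unfolding incseq_def T_def by (auto intro!: sum_mono2)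
    show "Lp_nrm p M (\<lambda>x. complex_of_real (T N x)) \<le> (\<Sum>n. Lp_nrm p M (h n))" for N
    proof -
      have "Lp_nrm p M (\<lambda>x. complex_of_real (T N x)) \<le> (\<Sum>n<N. Lp_nrm p M (h n))"
        unfolding T_eq using Lp_nrm_sum[OF p abs_h, of "{..<N}"] by (simp add: Lp_nrm_norm)
      also have "\<dots> \<le> (\<Sum>n. Lp_nrm p M (h n))" by (rule sum_le_suminf[OF sum]) auto
      finally show ?thesis .
    qed
  qed (use p in simp)
  then have summ: "AE x in M. summable (\<lambda>n. cmod (h n x))"
  proof eventually_elim
    case (elim x)
    then obtain C where "\<And>N. (\<Sum>n<N. cmod (h n x)) \<le> C" by (auto simp: T_def)
    then show ?case
      by (intro bounded_imp_summable[where B = C])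
        (simp_all only: lessThan_Suc_atMost[symmetric] norm_ge_zero)
  qed
  \<comment> \<open>Taking \<open>lim\<close> at every point makes \<open>s\<close> measurable at
    once; the points of divergence form a null set, so the value of \<open>lim\<close> there does no
    harm.\<close>
  define s where "s x = lim (\<lambda>N. \<Sum>n<N. h n x)" for x
  have s_meas [measurable]: "s \<in> borel_measurable M"
    unfolding s_def by (rule borel_measurable_lim_metric) simp
  have sums: "AE x in M. (\<lambda>n. h n x) sums s x"
    using summ
  proof eventually_elim
    case (elim x)
    then have "summable (\<lambda>n. h n x)" by (rule summable_norm_cancel)
    then show ?case unfolding s_def sums_def summable_iff_convergent convergent_LIMSEQ_iff .
  qed
  have tail: "(\<lambda>x. s x - (\<Sum>n<N. h n x)) \<in> Lp_functions p M \<and>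
      Lp_nrm p M (\<lambda>x. s x - (\<Sum>n<N. h n x)) \<le> (\<Sum>n. Lp_nrm p M (h (n + N)))" for N
  proof -
    have sum': "summable (\<lambda>n. Lp_nrm p M (h (n + N)))" using sum
        by (rule summable_ignore_initial_segment)
    have 1: "(\<lambda>x. \<Sum>n<m. h (n + N) x) \<in> Lp_functions p M" for m by (intro Lp_functions_sum p h) auto
    have "Lp_nrm p M (\<lambda>x. \<Sum>n<m. h (n + N) x) \<le> (\<Sum>n<m. Lp_nrm p M (h (n + N)))" for m
      by (intro Lp_nrm_sum p h) auto
    also have "(\<Sum>n<m. Lp_nrm p M (h (n + N))) \<le> (\<Sum>n. Lp_nrm p M (h (n + N)))" for m
      by (rule sum_le_suminf[OF sum']) auto
    finally have 2: "Lp_nrm p M (\<lambda>x. \<Sum>n<m. h (n + N) x) \<le> (\<Sum>n. Lp_nrm p M (h (n + N)))" for m .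
    have "AE x in M. (\<lambda>m. \<Sum>n<m. h (n + N) x) \<longlonglongrightarrow> s x - (\<Sum>n<N. h n x)"
      using sums by eventually_elim (use sums_split_initial_segment in \<open>simp add: sums_def\<close>)
    from Lp_nrm_fatou[OF _ 1 _ this 2] p show ?thesis by simp
  qed
  show ?thesis
  proof (rule that[OF _ summ sums])
    show "s \<in> Lp_functions p M" using tail[of 0] by simp
    show "(\<lambda>N. Lp_nrm p M (\<lambda>x. s x - (\<Sum>n<N. h n x))) \<longlonglongrightarrow> 0"
    proof (rule tendsto_sandwich[OF _ _ tendsto_const])
      show "(\<lambda>N. \<Sum>n. Lp_nrm p M (h (n + N))) \<longlonglongrightarrow> 0"
      proof (rule LIMSEQ_I)
        fix r :: real assume "r > 0"
        then show "\<exists>N0. \<forall>N\<ge>N0. norm ((\<Sum>n. Lp_nrm p M (h (n + N))) - 0) < r"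
          using suminf_exist_split[OF _ sum] by simp
      qed
      show "\<forall>\<^sub>F N in sequentially. Lp_nrm p M (\<lambda>x. s x - (\<Sum>n<N. h n x)) \<le> (\<Sum>n. Lp_nrm p M (h (n
          + N)))"
        using tail by simp
    qed simp
  qed
qed

section \<open>Uniform convexity of L^p\<close>

lemma powr_norm_midpoint_strict:
  fixes a b :: complex
  assumes p: "1 < p" and "a \<noteq> b"
  shows "cmod ((a + b) / 2) powr p < (cmod a powr p + cmod b powr p) / 2"
proof (cases "cmod a = cmod b")
  case False
  have "cmod ((a + b) / 2) powr p \<le> ((cmod a + cmod b) / 2) powr p"
    using p norm_triangle_ineq[of a b] by (intro powr_mono2) (auto simp: norm_divide)
  also have "\<dots> < (cmod a powr p + cmod b powr p) / 2"
    using False p by (intro powr_midpoint_strict) auto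
  finally show ?thesis .
next
  case True
  \<comment> \<open>Equality in the triangle inequality puts \<open>a\<close> and \<open>b\<close>
    on one ray, and equal moduli then make them equal.\<close>
  have "cmod (a + b) \<noteq> cmod a + cmod b"
  proof
    assume "cmod (a + b) = cmod a + cmod b"
    then have "cmod a *\<^sub>R b = cmod b *\<^sub>R a" by (simp add: norm_triangle_eq)
    then show False using True \<open>a \<noteq> b\<close> by (cases "cmod a = 0") auto
  qed
  then have "cmod ((a + b) / 2) < cmod a"
    using norm_triangle_ineq[of a b] True by (simp add: norm_divide)
  then have "cmod ((a + b) / 2) powr p < cmod a powr p" using p by (intro powr_less_mono2) auto
  then show ?thesis using True by simp
qed

text \<open>
  By homogeneity it suffices to consider \<open>|a|\<^sup>p + |b|\<^sup>p = 1\<close>, where compactness and strict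
  convexity apply.
\<close>

lemma uniform_convexity_pointwise:
  fixes p \<epsilon> :: real
  assumes p: "1 < p" and \<epsilon>: "\<epsilon> > 0"
  obtains C where "C > 0" "\<And>a b :: complex. cmod (a - b) powr p \<le> \<epsilon> * (cmod a powr p
      + cmod b powr p)
    + C * ((cmod a powr p + cmod b powr p) / 2 - cmod ((a + b) / 2) powr p)"
proof -
  \<comment> \<open>Only pairs that are far apart need the term with \<open>C\<close>; among the
    normalized ones the convexity defect \<open>D\<close> attains a positive minimum.\<close>
  define S where "S = {z :: complex \<times> complex. cmod (fst z) powr p + cmod (snd z) powr p = 1 \<and>
    cmod (fst z - snd z) powr p \<ge> \<epsilon>}"
  define D where "D z = (cmod (fst z) powr p + cmod (snd z) powr p) / 2 - cmod ((fst z
      + snd z) / 2) powr p"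
    for z :: "complex \<times> complex"
  have le1: "x \<le> 1" if "x powr p \<le> 1" for x :: real
  proof (rule ccontr)
    assume "\<not> x \<le> 1"
    then have "1 powr p < x powr p" using p by (intro powr_less_mono2) auto
    then show False using that by simp
  qed
  have cont: "continuous_on UNIV (\<lambda>z :: complex \<times> complex. cmod (f z) powr p)"
    if "continuous_on UNIV f" for f
    by (rule continuous_on_powr') (use that p in \<open>auto intro: continuous_on_norm\<close>)
  have contD: "continuous_on UNIV D"
    unfolding D_def by (intro continuous_on_diff continuous_on_divide continuous_on_add cont
        continuous_on_fst continuous_on_snd continuous_on_id continuous_on_const) auto
  have D_nonneg: "0 \<le> D z" for z
    unfolding D_def using powr_norm_midpoint_strict[OF p, of "fst z" "snd z"]
    by (cases "fst z = snd z") (auto simp: less_imp_le)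
  have "closed {z :: complex \<times> complex. cmod (fst z) powr p + cmod (snd z) powr p = 1}"
    by (intro closed_Collect_eq continuous_on_add cont continuous_on_fst continuous_on_snd
        continuous_on_id continuous_on_const)
  moreover have "closed {z :: complex \<times> complex. \<epsilon> \<le> cmod (fst z - snd z) powr p}"
    by (intro closed_Collect_le continuous_on_diff cont continuous_on_fst continuous_on_snd
        continuous_on_id continuous_on_const)
  ultimately have "closed S" unfolding S_def by (simp add: closed_Collect_conj)
  moreover have "bounded S"
  proof (rule boundedI)
    fix z assume "z \<in> S"
    then have "cmod (fst z) powr p + cmod (snd z) powr p = 1" by (simp add: S_def)
    then have "cmod (fst z) powr p \<le> 1" "cmod (snd z) powr p \<le> 1"
      using powr_ge_zero[of "cmod (fst z)" p] powr_ge_zero[of "cmod (snd z)" p] by linarith+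
    then have "cmod (fst z) \<le> 1" "cmod (snd z) \<le> 1"
      using le1 by auto
    then show "norm z \<le> 2" using norm_Pair_le[of "fst z" "snd z"] by simp
  qed
  ultimately have "compact S" by (simp add: compact_eq_bounded_closed)
  obtain \<delta> where \<delta>: "\<delta> > 0" "\<And>z. z \<in> S \<Longrightarrow> \<delta> \<le> D z"
  proof (cases "S = {}")
    case True
    then show ?thesis using that[of 1] by simp
  next
    case False
    obtain z0 where z0: "z0 \<in> S" "\<And>z. z \<in> S \<Longrightarrow> D z0 \<le> D z"
      using continuous_attains_inf[OF \<open>compact S\<close> False continuous_on_subset[OF contD]] by auto
    have "fst z0 \<noteq> snd z0" using z0(1) \<epsilon> by (auto simp: S_def)
    then have "D z0 > 0" unfolding D_def using powr_norm_midpoint_strict[OF p] by simp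
    then show ?thesis using that z0(2) by blast
  qed
  \<comment> \<open>A far pair with \<open>m = |a|^p + |b|^p\<close> satisfies
    \<open>|a - b|^p \<le> 2^p m\<close> and \<open>\<delta> m \<le> D (a, b)\<close>; this quotient
    combines the two.\<close>
  define C where "C = 2 powr p / \<delta>"
  have C: "C > 0" using \<delta> by (simp add: C_def)
  have diff_le: "cmod (a - b) powr p \<le> 2 powr p * (cmod a powr p + cmod b powr p)"
      for a b :: complex
  proof -
    have "cmod (a - b) \<le> 2 * max (cmod a) (cmod b)" using norm_triangle_ineq4[of a b] by simp
    then have "cmod (a - b) powr p \<le> (2 * max (cmod a) (cmod b)) powr p"
      using p by (intro powr_mono2) auto
    also have "\<dots> = 2 powr p * max (cmod a) (cmod b) powr p" by (simp add: powr_mult)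
    also have "\<dots> \<le> 2 powr p * (cmod a powr p + cmod b powr p)"
      by (intro mult_left_mono) (auto simp: max_def)
    finally show ?thesis .
  qed
  show ?thesis
  proof (rule that[OF C])
    fix a b :: complex
    define m where "m = cmod a powr p + cmod b powr p"
    have m_nonneg: "m \<ge> 0" by (simp add: m_def)
    have D_ab: "0 \<le> D (a, b)" by (rule D_nonneg)
    have "cmod (a - b) powr p \<le> \<epsilon> * m + C * D (a, b)"
    proof (cases "cmod (a - b) powr p \<le> \<epsilon> * m")
      case True
      moreover have "0 \<le> C * D (a, b)" using C D_ab by simp
      ultimately show ?thesis by linarith
    next
      case False
      have "m > 0"
      proof (rule ccontr)
        assume "\<not> m > 0"
        then have "m = 0" using m_nonneg by simp
        then have "a = 0 \<and> b = 0"
          unfolding m_def by (subst (asm) add_nonneg_eq_0_iff) auto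
        then show False using False m_nonneg \<epsilon> by simp
      qed
      \<comment> \<open>Multiplication by \<open>t\<close> divides every p-th power by
        \<open>m\<close>, so the pair becomes normalized and its defect is divided by
        \<open>m\<close>.\<close>
      define t where "t = complex_of_real (m powr (- (1 / p)))"
      have "cmod t powr p = (m powr (- (1 / p))) powr p" unfolding t_def norm_of_real by simp
      also have "\<dots> = m powr (-1)" using p by (simp add: powr_powr)
      also have "\<dots> = inverse m" using \<open>m > 0\<close> by (subst powr_minus) simp
      finally have t: "cmod (t * w) powr p = cmod w powr p / m" for w
        by (simp add: norm_mult powr_mult divide_inverse)
      have Dt: "D (t * a, t * b) = D (a, b) / m"
      proof -
        have "(t * a + t * b) / 2 = t * ((a + b) / 2)" by (simp add: algebra_simps)
        then have "D (t * a, t * b)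
            = (cmod a powr p / m + cmod b powr p / m) / 2 - cmod ((a + b) / 2) powr p / m"
          unfolding D_def fst_conv snd_conv by (simp only: t)
        then show ?thesis unfolding D_def fst_conv snd_conv
          by (simp only: diff_divide_distrib add_divide_distrib divide_divide_eq_left mult.commute)
      qed
      have "t * a - t * b = t * (a - b)" by (simp add: algebra_simps)
      then have "(t * a, t * b) \<in> S"
        using False \<open>m > 0\<close> unfolding S_def mem_Collect_eq fst_conv snd_conv
        by (simp only: t) (simp add: pos_le_divide_eq flip: add_divide_distrib m_def)
      from \<delta>(2)[OF this] have "\<delta> * m \<le> D (a, b)" using \<open>m > 0\<close> unfolding Dt
          by (simp add: pos_le_divide_eq)
      then have "2 powr p * m \<le> C * D (a, b)" using \<delta>(1) by (simp add: C_def field_simps)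
      moreover have "cmod (a - b) powr p \<le> 2 powr p * m" unfolding m_def by (rule diff_le)
      moreover have "0 \<le> \<epsilon> * m" using \<epsilon> m_nonneg by simp
      ultimately show ?thesis by linarith
    qed
    then show "cmod (a - b) powr p \<le> \<epsilon> * (cmod a powr p + cmod b powr p)
      + C * ((cmod a powr p + cmod b powr p) / 2 - cmod ((a + b) / 2) powr p)"
      by (simp add: m_def D_def)
  qed
qed

text \<open>Integrating the pointwise inequality turns the defect into a difference of p-th powers
  of norms. It is small when the norms of \<open>f\<close> and \<open>g\<close> at most barely
  exceed \<open>r\<close> and that of the midpoint is at worst barely below it.\<close>

lemma Lp_uniform_convexity:
  fixes M :: "'g measure"
  assumes p: "1 < p" and r: "0 \<le> r" and \<epsilon>: "0 < \<epsilon>"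
  obtains \<delta> where "\<delta> > 0"
    "\<And>f g :: 'g \<Rightarrow> complex. \<lbrakk>f \<in> Lp_functions p M; g \<in> Lp_functions p M; Lp_nrm p M f \<le> r
        + \<delta>; Lp_nrm p M g \<le> r + \<delta>;
      r - \<delta> \<le> Lp_nrm p M (\<lambda>x. (f x + g x) / 2)\<rbrakk> \<Longrightarrow> Lp_nrm p M (\<lambda>x. f x - g x) \<le> \<epsilon>"
proof -
  \<comment> \<open>With \<open>\<delta> < 1\<close> the term with \<open>\<eta>\<close> is at most
    \<open>2 * \<eta> * (r + 1) powr p = \<epsilon> powr p / 2\<close>, half of what is
    allowed.\<close>
  define \<eta> where "\<eta> = \<epsilon> powr p / (4 * (r + 1) powr p)"
  have \<eta>: "\<eta> > 0" using \<epsilon> r by (simp add: \<eta>_def)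
  obtain C where C: "C > 0" "\<And>a b :: complex. cmod (a - b) powr p \<le> \<eta> * (cmod a powr p
      + cmod b powr p)
    + C * ((cmod a powr p + cmod b powr p) / 2 - cmod ((a + b) / 2) powr p)"
    using uniform_convexity_pointwise[OF p \<eta>] by blast
  \<comment> \<open>\<open>r - \<delta>\<close> may be negative when \<open>r\<close> is small;
    \<open>max 0\<close> keeps the base in the range where the power is monotone.\<close>
  have "((\<lambda>\<delta>. (r + \<delta>) powr p - max 0 (r - \<delta>) powr p) \<longlongrightarrow> (r
      + 0) powr p - max 0 (r - 0) powr p) (at_right 0)"
    using p r by (intro tendsto_diff tendsto_powr' tendsto_max tendsto_intros)
      (auto intro!: always_eventually simp: eventually_at_right_less eventually_at_filter)
  then have "((\<lambda>\<delta>. (r + \<delta>) powr p - max 0 (r - \<delta>) powr p) \<longlongrightarrow> 0) (at_right 0)" using r by simp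
  then have "\<forall>\<^sub>F \<delta> in at_right 0. (r + \<delta>) powr p - max 0 (r - \<delta>) powr p < \<epsilon> powr p / (2 * C)"
    using \<epsilon> C(1) by (intro order_tendstoD(2)) auto
  moreover have "\<forall>\<^sub>F \<delta> in at_right 0. \<delta> < (1::real)"
      by (intro eventually_at_right_real[THEN eventually_mono]) auto
  moreover have "\<forall>\<^sub>F \<delta> in at_right 0. (0::real) < \<delta>" by (rule eventually_at_right_less)
  ultimately have "\<forall>\<^sub>F \<delta> in at_right 0. 0 < \<delta> \<and> \<delta> < 1 \<and>
      (r + \<delta>) powr p - max 0 (r - \<delta>) powr p < \<epsilon> powr p / (2 * C)"
    by eventually_elim auto
  then obtain \<delta> :: real where \<delta>: "0 < \<delta>" "\<delta> < 1" "(r + \<delta>) powr p - max 0 (r - \<delta>) powr p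
      < \<epsilon> powr p / (2 * C)"
    using eventually_happens'[OF trivial_limit_at_right_real] by blast
  show ?thesis
  proof (rule that[OF \<delta>(1)])
    fix f g :: "'g \<Rightarrow> complex"
    assume f: "f \<in> Lp_functions p M" and g: "g \<in> Lp_functions p M"
      and fr: "Lp_nrm p M f \<le> r + \<delta>" and gr: "Lp_nrm p M g \<le> r + \<delta>"
      and fg: "r - \<delta> \<le> Lp_nrm p M (\<lambda>x. (f x + g x) / 2)"
    have p1: "1 \<le> p" "0 < p" using p by auto
    let ?m = "\<lambda>x. (f x + g x) / 2"
    have m: "?m \<in> Lp_functions p M"
      using Lp_functions_cmult[OF Lp_functions_add[OF p1(1) f g], of "1/2"] by simp
    have d: "(\<lambda>x. f x - g x) \<in> Lp_functions p M" by (rule Lp_functions_diff[OF p1(1) f g])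
    note int = Lp_functionsD(2)[OF f] Lp_functionsD(2)[OF g] Lp_functionsD(2)[OF m]
        Lp_functionsD(2)[OF d]
    have "(\<integral>x. cmod (f x - g x) powr p \<partial>M) \<le> (\<integral>x. \<eta> * (cmod (f x) powr p + cmod (g x) powr p)
      + C * ((cmod (f x) powr p + cmod (g x) powr p) / 2 - cmod (?m x) powr p) \<partial>M)"
      using C(2) int by (intro integral_mono) auto
    also have "\<dots> = \<eta> * (Lp_nrm p M f powr p + Lp_nrm p M g powr p)
      + C * ((Lp_nrm p M f powr p + Lp_nrm p M g powr p) / 2 - Lp_nrm p M ?m powr p)"
      using int p1 by (simp add: Lp_nrm_powr)
    also have "\<dots> \<le> \<eta> * ((r + \<delta>) powr p + (r + \<delta>) powr p)
      + C * (((r + \<delta>) powr p + (r + \<delta>) powr p) / 2 - max 0 (r - \<delta>) powr p)"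
      using \<eta> C(1) fr gr fg p1
      by (intro add_mono mult_left_mono diff_mono divide_right_mono powr_mono2) auto
    also have "\<dots> = 2 * (\<eta> * (r + \<delta>) powr p) + C * ((r + \<delta>) powr p - max 0 (r - \<delta>) powr p)"
      by simp
    also have "\<dots> \<le> \<epsilon> powr p / 2 + \<epsilon> powr p / 2"
    proof (rule add_mono)
      have "\<eta> * (r + \<delta>) powr p \<le> \<eta> * (r + 1) powr p"
        using \<eta> \<delta> r p1 by (intro mult_left_mono powr_mono2) auto
      also have "\<dots> = \<epsilon> powr p / 4" using r by (simp add: \<eta>_def)
      finally show "2 * (\<eta> * (r + \<delta>) powr p) \<le> \<epsilon> powr p / 2" by simp
      show "C * ((r + \<delta>) powr p - max 0 (r - \<delta>) powr p) \<le> \<epsilon> powr p / 2"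
        using \<delta>(3) C(1) by (simp add: field_simps)
    qed
    finally show "Lp_nrm p M (\<lambda>x. f x - g x) \<le> \<epsilon>"
      using \<epsilon> p1 by (intro Lp_nrm_leI) auto
  qed
qed

section \<open>Classes of functions and completeness of L^p\<close>

lemma ae_class_cong: "AE x in M. f x = g x \<Longrightarrow> ae_class M f = ae_class M g"
  unfolding ae_class_def by (intro Collect_cong conj_cong refl) (auto elim!: AE_mp[rotated])

lemma ae_rep_ae_class:
  assumes "f \<in> borel_measurable M"
  shows "ae_rep (ae_class M f) \<in> borel_measurable M" "AE x in M. ae_rep (ae_class M f) x = f x"
proof -
  have "f \<in> ae_class M f" using assms by (simp add: ae_class_def)
  then have "ae_rep (ae_class M f) \<in> ae_class M f" unfolding ae_rep_def
      by (rule someI[of "\<lambda>h. h \<in> ae_class M f"])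
  then show "ae_rep (ae_class M f) \<in> borel_measurable M" "AE x in M. ae_rep (ae_class M f) x = f x"
    by (auto simp: ae_class_def)
qed

lemma ae_class_eq_iff:
  assumes "f \<in> borel_measurable M"
  shows "ae_class M f = ae_class M g \<longleftrightarrow> (AE x in M. f x = g x)"
proof
  assume "ae_class M f = ae_class M g"
  moreover have "f \<in> ae_class M f" using assms by (simp add: ae_class_def)
  ultimately show "AE x in M. f x = g x" by (auto simp: ae_class_def)
qed (rule ae_class_cong)

lemma Lp_space_simps:
  "carrier (Lp_space p M) = ae_class M ` Lp_functions p M"
  "zero (Lp_space p M) = ae_class M (\<lambda>_. 0)"
  by (simp_all add: Lp_space_def)

lemma Lp_space_closed [simp, intro]: "f \<in> Lp_functions p M \<Longrightarrow> ae_class M f \<in> carrier (Lp_space p M)"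
  by (simp add: Lp_space_simps)

lemma Lp_rep:
  assumes "f \<in> Lp_functions p M"
  shows "ae_rep (ae_class M f) \<in> Lp_functions p M" "AE x in M. ae_rep (ae_class M f) x = f x"
proof -
  have m: "f \<in> borel_measurable M" using assms by auto
  show ae: "AE x in M. ae_rep (ae_class M f) x = f x" by (rule ae_rep_ae_class(2)[OF m])
  have ae': "AE x in M. f x = ae_rep (ae_class M f) x" using ae by eventually_elim simp
  show "ae_rep (ae_class M f) \<in> Lp_functions p M"
    by (rule Lp_functions_cong_AE[OF assms ae_rep_ae_class(1)[OF m] ae'])
qed

lemma Lp_space_rep:
  assumes "X \<in> carrier (Lp_space p M)"
  shows "ae_rep X \<in> Lp_functions p M" "ae_class M (ae_rep X) = X"
proof -
  obtain f where f: "f \<in> Lp_functions p M" "X = ae_class M f" using assms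
      by (auto simp: Lp_space_simps)
  show "ae_rep X \<in> Lp_functions p M" "ae_class M (ae_rep X) = X"
    using Lp_rep[OF f(1)] ae_class_cong[OF Lp_rep(2)[OF f(1)]] f(2) by simp_all
qed

lemma Lp_space_cases:
  assumes "X \<in> carrier (Lp_space p M)"
  obtains f where "f \<in> Lp_functions p M" "X = ae_class M f"
  using assms by (auto simp: Lp_space_simps)

lemma Lp_space_add:
  assumes "f \<in> Lp_functions p M" "g \<in> Lp_functions p M"
  shows "ae_class M f \<oplus>\<^bsub>Lp_space p M\<^esub> ae_class M g = ae_class M (\<lambda>x. f x + g x)"
proof -
  have "AE x in M. ae_rep (ae_class M f) x + ae_rep (ae_class M g) x = f x + g x"
    using Lp_rep(2)[OF assms(1)] Lp_rep(2)[OF assms(2)] by eventually_elim simp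
  then show ?thesis by (simp add: Lp_space_def ae_class_cong)
qed

lemma Lp_space_smult:
  assumes "f \<in> Lp_functions p M"
  shows "c \<odot>\<^bsub>Lp_space p M\<^esub> ae_class M f = ae_class M (\<lambda>x. c * f x)"
proof -
  have "AE x in M. c * ae_rep (ae_class M f) x = c * f x"
    using Lp_rep(2)[OF assms(1)] by eventually_elim simp
  then show ?thesis by (simp add: Lp_space_def ae_class_cong)
qed

lemma Lp_space_nrm:
  assumes "f \<in> Lp_functions p M"
  shows "nrm (Lp_space p M) (ae_class M f) = Lp_nrm p M f"
proof -
  have "nrm (Lp_space p M) (ae_class M f) = Lp_nrm p M (ae_rep (ae_class M f))"
    by (simp add: Lp_space_def Lp_nrm_def)
  also have "\<dots> = Lp_nrm p M f" using Lp_rep[OF assms] assms by (intro Lp_nrm_cong_AE) auto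
  finally show ?thesis .
qed

lemma complex_normed_space_Lp:
  assumes p: "1 \<le> p"
  shows "complex_normed_space (Lp_space p M)"
proof -
  let ?L = "Lp_space p M"
  note closed = Lp_functions_add[OF p] Lp_functions_cmult
  have zero: "\<zero>\<^bsub>?L\<^esub> = ae_class M (\<lambda>_. 0)" by (simp add: Lp_space_simps)
  have "abelian_group ?L"
  proof (rule abelian_groupI)
    fix X assume "X \<in> carrier ?L"
    then obtain f where f: "f \<in> Lp_functions p M" "X = ae_class M f" by (rule Lp_space_cases)
    show "\<exists>Y\<in>carrier ?L. Y \<oplus>\<^bsub>?L\<^esub> X = \<zero>\<^bsub>?L\<^esub>"
      using f closed(2)[OF f(1), of "-1"]
      by (intro bexI[of _ "ae_class M (\<lambda>x. (-1) * f x)"]) (auto simp: zero Lp_space_add)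
  qed (auto elim!: Lp_space_cases simp: zero Lp_space_add closed add_ac)
  then have "module complex_ring ?L"
    by (intro moduleI cring_complex_ring)
      (auto elim!: Lp_space_cases simp: complex_ring_def Lp_space_add Lp_space_smult closed
          distrib_left
        distrib_right mult.assoc)
  then show ?thesis
  proof (intro complex_normed_space.intro complex_normed_space_axioms.intro)
    fix X assume "X \<in> carrier ?L"
    then obtain f where f: "f \<in> Lp_functions p M" "X = ae_class M f" by (rule Lp_space_cases)
    show "nrm ?L X = 0 \<longleftrightarrow> X = \<zero>\<^bsub>?L\<^esub>"
      using f p by (simp add: Lp_space_nrm zero Lp_nrm_eq_0_iff ae_class_eq_iff Lp_functionsD(1))
  qed (use p in \<open>auto elim!: Lp_space_cases simp: Lp_space_nrm Lp_space_add Lp_space_smult closed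
      Lp_nrm_triangle Lp_nrm_cmult\<close>)
qed

lemma Lp_space_diff:
  assumes p: "1 \<le> p" and f: "f \<in> Lp_functions p M" and g: "g \<in> Lp_functions p M"
  shows "ae_class M f \<ominus>\<^bsub>Lp_space p M\<^esub> ae_class M g = ae_class M (\<lambda>x. f x - g x)"
proof -
  interpret complex_normed_space "Lp_space p M" by (rule complex_normed_space_Lp[OF p])
  show ?thesis using f g Lp_functions_cmult[OF g, of "-1"]
    by (simp add: diff_eq Lp_space_smult Lp_space_add)
qed

lemma Lp_space_nrm_diff:
  assumes p: "1 \<le> p" and f: "f \<in> Lp_functions p M" and g: "g \<in> Lp_functions p M"
  shows "nrm (Lp_space p M) (ae_class M f \<ominus>\<^bsub>Lp_space p M\<^esub> ae_class M g)
      = Lp_nrm p M (\<lambda>x. f x - g x)"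
  using assms by (simp add: Lp_space_diff Lp_space_nrm Lp_functions_diff)

lemma Lp_complete:
  assumes p: "1 \<le> p" and F: "\<And>n. F n \<in> Lp_functions p M"
    and cauchy: "\<And>e. e > 0 \<Longrightarrow> \<exists>N. \<forall>m\<ge>N. \<forall>n\<ge>N. Lp_nrm p M (\<lambda>x. F m x - F n x) < e"
  obtains g where "g \<in> Lp_functions p M" "(\<lambda>n. Lp_nrm p M (\<lambda>x. F n x - g x)) \<longlonglongrightarrow> 0"
proof -
  have "\<forall>k. \<exists>N. \<forall>m\<ge>N. \<forall>n\<ge>N. Lp_nrm p M (\<lambda>x. F m x - F n x) < (1/2) ^ k"
    by (intro allI cauchy) simp
  then obtain N where N: "\<And>k m n. m \<ge> N k \<Longrightarrow> n \<ge> N k \<Longrightarrow> Lp_nrm p M (\<lambda>x. F m x - F n x) < (1/2) ^ k"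
    by metis
  \<comment> \<open>Running maxima make both \<open>r k\<close> and \<open>r (Suc k)\<close> at
    least \<open>N k\<close>, so consecutive terms of the subsequence differ by less than
    \<open>(1/2) ^ k\<close> and the telescoping series has summable norms.\<close>
  define r where "r k = Max (N ` {..k})" for k
  have r: "N k \<le> r j" if "k \<le> j" for k j using that by (auto simp: r_def)
  define h where "h k x = F (r (Suc k)) x - F (r k) x" for k x
  have h: "h k \<in> Lp_functions p M" for k
    unfolding h_def[abs_def] by (intro Lp_functions_diff p F)
  have "Lp_nrm p M (h k) \<le> (1/2) ^ k" for k
    using N[of k "r (Suc k)" "r k"] r by (simp add: h_def[abs_def] less_imp_le)
  then have "summable (\<lambda>k. Lp_nrm p M (h k))"
    by (intro summable_comparison_test[OF _ summable_geometric[of "1/2::real"]]) auto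
  then obtain s where s: "s \<in> Lp_functions p M"
    and "AE x in M. summable (\<lambda>n. cmod (h n x))" "AE x in M. (\<lambda>n. h n x) sums s x"
    and lim: "(\<lambda>K. Lp_nrm p M (\<lambda>x. s x - (\<Sum>k<K. h k x))) \<longlonglongrightarrow> 0"
    by (rule Lp_series[OF p h])
  have tele: "(\<Sum>k<K. h k x) = F (r K) x - F (r 0) x" for K x
    unfolding h_def by (rule sum_lessThan_telescope)
  define g where "g x = s x + F (r 0) x" for x
  have g: "g \<in> Lp_functions p M" unfolding g_def[abs_def] by (intro Lp_functions_add p s F)
  have eq: "(\<lambda>x. s x - (\<Sum>k<K. h k x)) = (\<lambda>x. g x - F (r K) x)" for K
    by (simp add: tele g_def fun_eq_iff)
  have lim': "(\<lambda>K. Lp_nrm p M (\<lambda>x. F (r K) x - g x)) \<longlonglongrightarrow> 0"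
    using lim unfolding eq by (subst Lp_nrm_diff_commute)
  show ?thesis
  proof (rule that[OF g LIMSEQ_I])
    fix e :: real assume e: "e > 0"
    have "(\<lambda>K. (1/2::real) ^ K + Lp_nrm p M (\<lambda>x. F (r K) x - g x)) \<longlonglongrightarrow> 0 + 0"
      by (intro tendsto_add lim' LIMSEQ_realpow_zero) auto
    then have "\<forall>\<^sub>F K in sequentially. (1/2::real) ^ K + Lp_nrm p M (\<lambda>x. F (r K) x - g x) < e"
      using e by (intro order_tendstoD(2)) auto
    then obtain K where K: "(1/2::real) ^ K + Lp_nrm p M (\<lambda>x. F (r K) x - g x) < e"
      using eventually_happens by force
    have "Lp_nrm p M (\<lambda>x. F n x - g x) < e" if "n \<ge> N K" for n
      using Lp_nrm_diff_triangle[OF p F[of n] F[of "r K"] g] N[OF that r[OF order_refl]] K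
          by linarith
    then show "\<exists>N. \<forall>n\<ge>N. norm (Lp_nrm p M (\<lambda>x. F n x - g x) - 0) < e" by auto
  qed
qed

lemma complex_banach_space_Lp:
  assumes p: "1 \<le> p"
  shows "complex_banach_space (Lp_space p M)"
proof -
  let ?L = "Lp_space p M"
  interpret complex_normed_space ?L by (rule complex_normed_space_Lp[OF p])
  show ?thesis
  proof
    fix s :: "nat \<Rightarrow> ('a \<Rightarrow> complex) set"
    assume s: "\<And>n. s n \<in> carrier ?L"
      and cauchy: "\<And>e. e > 0 \<Longrightarrow> \<exists>N. \<forall>m\<ge>N. \<forall>n\<ge>N. nrm ?L (s m \<ominus>\<^bsub>?L\<^esub> s n) < e"
    define F where "F n = ae_rep (s n)" for n
    have F: "F n \<in> Lp_functions p M" "s n = ae_class M (F n)" for n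
      using Lp_space_rep[OF s] by (auto simp: F_def)
    have "\<exists>N. \<forall>m\<ge>N. \<forall>n\<ge>N. Lp_nrm p M (\<lambda>x. F m x - F n x) < e" if "e > 0" for e
      using cauchy[OF that] by (simp add: F Lp_space_nrm_diff[OF p])
    then obtain g where "g \<in> Lp_functions p M" "(\<lambda>n. Lp_nrm p M (\<lambda>x. F n x - g x)) \<longlonglongrightarrow> 0"
      by (rule Lp_complete[OF p F(1)])
    then show "\<exists>l\<in>carrier ?L. (\<lambda>n. nrm ?L (s n \<ominus>\<^bsub>?L\<^esub> l)) \<longlonglongrightarrow> 0"
      by (intro bexI[of _ "ae_class M g"]) (auto simp: F Lp_space_nrm_diff[OF p])
  qed
qed

lemma uniformly_convex_Lp:
  assumes p: "1 < p"
  shows "uniformly_convex (Lp_space p M)"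
  unfolding uniformly_convex_def
proof (intro allI impI)
  fix r \<epsilon> :: real assume "0 \<le> r" "0 < \<epsilon>"
  then obtain \<delta> where \<delta>: "\<delta> > 0"
    "\<And>f g :: 'a \<Rightarrow> complex. \<lbrakk>f \<in> Lp_functions p M; g \<in> Lp_functions p M; Lp_nrm p M f \<le> r
        + \<delta>; Lp_nrm p M g \<le> r + \<delta>;
      r - \<delta> \<le> Lp_nrm p M (\<lambda>x. (f x + g x) / 2)\<rbrakk> \<Longrightarrow> Lp_nrm p M (\<lambda>x. f x - g x) \<le> \<epsilon>"
    using Lp_uniform_convexity[OF p] by blast
  let ?L = "Lp_space p M"
  have p1: "1 \<le> p" using p by simp
  show "\<exists>\<delta>>0. \<forall>x\<in>carrier ?L. \<forall>y\<in>carrier ?L. nrm ?L x \<le> r + \<delta> \<longrightarrow> nrm ?L y \<le> r + \<delta> \<longrightarrow>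
      r - \<delta> \<le> nrm ?L ((1/2) \<odot>\<^bsub>?L\<^esub> (x \<oplus>\<^bsub>?L\<^esub> y)) \<longrightarrow> nrm ?L (x \<ominus>\<^bsub>?L\<^esub> y) \<le> \<epsilon>"
  proof (rule exI[of _ \<delta>], intro conjI ballI impI \<delta>(1))
    fix X Y assume XY: "X \<in> carrier ?L" "Y \<in> carrier ?L" "nrm ?L X \<le> r + \<delta>" "nrm ?L Y \<le> r + \<delta>"
      and mid: "r - \<delta> \<le> nrm ?L ((1/2) \<odot>\<^bsub>?L\<^esub> (X \<oplus>\<^bsub>?L\<^esub> Y))"
    obtain f where f: "f \<in> Lp_functions p M" "X = ae_class M f" using XY(1) by (rule Lp_space_cases)
    obtain g where g: "g \<in> Lp_functions p M" "Y = ae_class M g" using XY(2) by (rule Lp_space_cases)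
    have fg: "(\<lambda>x. f x + g x) \<in> Lp_functions p M" by (rule Lp_functions_add[OF p1 f(1) g(1)])
    have "(1/2) \<odot>\<^bsub>?L\<^esub> (X \<oplus>\<^bsub>?L\<^esub> Y) = ae_class M (\<lambda>x. (1/2) * (f x + g x))"
      using f g fg by (simp add: Lp_space_add Lp_space_smult del: times_divide_eq_left)
    then have "nrm ?L ((1/2) \<odot>\<^bsub>?L\<^esub> (X \<oplus>\<^bsub>?L\<^esub> Y)) = Lp_nrm p M (\<lambda>x. (f x + g x) / 2)"
      using Lp_functions_cmult[OF fg, of "1/2"] by (simp add: Lp_space_nrm)
    then show "nrm ?L (X \<ominus>\<^bsub>?L\<^esub> Y) \<le> \<epsilon>"
      using \<delta>(2)[OF f(1) g(1)] XY mid f g by (simp add: Lp_space_nrm_diff[OF p1] Lp_space_nrm)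
  qed
qed

section \<open>Continuous functions with compact support\<close>

text \<open>Polymorphic in the values, so that real cutoff functions and complex integrands share
  one set of closure lemmas.\<close>

definition Cc :: "('a::topological_space \<Rightarrow> 'b::real_normed_vector) set" where
  "Cc = {f. continuous_on UNIV f \<and> (\<exists>K. compact K \<and> (\<forall>x. x \<notin> K \<longrightarrow> f x = 0))}"

lemma CcI: "\<lbrakk>continuous_on UNIV f; compact K; \<And>x. x \<notin> K \<Longrightarrow> f x = 0\<rbrakk> \<Longrightarrow> f \<in> Cc"
  by (auto simp: Cc_def)

lemma Cc_continuous: "f \<in> Cc \<Longrightarrow> continuous_on UNIV f"
  by (simp add: Cc_def)

lemma Cc_compose:
  assumes "f \<in> Cc" "continuous_on UNIV h" "h 0 = 0"
  shows "(\<lambda>x. h (f x)) \<in> Cc"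
proof -
  obtain K where K: "continuous_on UNIV f" "compact K" "\<And>x. x \<notin> K \<Longrightarrow> f x = 0"
    using assms(1) by (auto simp: Cc_def)
  show ?thesis
    by (rule CcI[OF _ K(2)]) (use K assms in \<open>auto intro: continuous_on_compose2\<close>)
qed

lemma Cc_zero [simp]: "(\<lambda>_. 0) \<in> Cc"
  by (rule CcI[of _ "{}"]) auto

lemma Cc_add:
  assumes "f \<in> Cc" "g \<in> Cc"
  shows "(\<lambda>x. f x + g x) \<in> Cc"
proof -
  obtain K where K: "continuous_on UNIV f" "compact K" "\<And>x. x \<notin> K \<Longrightarrow> f x = 0"
    using assms(1) by (auto simp: Cc_def)
  obtain L where L: "continuous_on UNIV g" "compact L" "\<And>x. x \<notin> L \<Longrightarrow> g x = 0"
    using assms(2) by (auto simp: Cc_def)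
  show ?thesis
    by (rule CcI[of _ "K \<union> L"]) (use K L in \<open>auto intro!: continuous_intros\<close>)
qed

lemma Cc_mult:
  fixes f g :: "'a::topological_space \<Rightarrow> 'b::real_normed_algebra"
  assumes "f \<in> Cc" "continuous_on UNIV g"
  shows "(\<lambda>x. f x * g x) \<in> Cc" "(\<lambda>x. g x * f x) \<in> Cc"
proof -
  obtain K where K: "continuous_on UNIV f" "compact K" "\<And>x. x \<notin> K \<Longrightarrow> f x = 0"
    using assms(1) by (auto simp: Cc_def)
  show "(\<lambda>x. f x * g x) \<in> Cc" "(\<lambda>x. g x * f x) \<in> Cc"
    by (rule CcI[of _ K]; use K assms(2) in \<open>auto intro!: continuous_intros\<close>)+
qed

lemma Cc_cmult:
  fixes f :: "'a::topological_space \<Rightarrow> 'b::real_normed_algebra"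
  shows "f \<in> Cc \<Longrightarrow> (\<lambda>x. c * f x) \<in> Cc"
  by (rule Cc_mult(2)) auto

lemma Cc_sum: "(\<And>i. i \<in> I \<Longrightarrow> f i \<in> Cc) \<Longrightarrow> (\<lambda>x. \<Sum>i\<in>I. f i x) \<in> Cc"
  by (induction I rule: infinite_finite_induct) (auto intro: Cc_add)

lemma Cc_norm: "f \<in> Cc \<Longrightarrow> (\<lambda>x. norm (f x)) \<in> Cc"
  by (rule Cc_compose) (auto intro!: continuous_intros)

lemma Cc_of_real: "f \<in> Cc \<Longrightarrow> (\<lambda>x. complex_of_real (f x)) \<in> Cc"
  by (rule Cc_compose[of _ complex_of_real]) (auto intro!: continuous_intros)

lemma Cc_powr:
  fixes f :: "'a::topological_space \<Rightarrow> complex"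
  assumes "f \<in> Cc" "p > 0"
  shows "(\<lambda>x. cmod (f x) powr p) \<in> Cc"
  by (rule Cc_compose[OF assms(1), of "\<lambda>z. cmod z powr p"])
    (use assms(2) in \<open>auto intro!: continuous_on_powr' continuous_on_norm\<close>)

lemma compact_add:
  fixes K L :: "'a::topological_group_add set"
  assumes "compact K" "compact L"
  shows "compact {x + y | x y. x \<in> K \<and> y \<in> L}"
proof -
  have "compact ((\<lambda>(x, y). x + y) ` (K \<times> L))"
    using assms by (intro compact_continuous_image compact_Times)
      (auto simp: split_beta intro!: continuous_intros)
  moreover have "(\<lambda>(x, y). x + y) ` (K \<times> L) = {x + y | x y. x \<in> K \<and> y \<in> L}" by auto
  ultimately show ?thesis by simp
qed

lemma image_add_left_eq: "(+) g ` A = (+) (- g) -` A" for g :: "'a::group_add"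
proof safe
  fix x assume "- g + x \<in> A"
  then show "x \<in> (+) g ` A" by (intro image_eqI[of _ _ "- g + x"]) (simp_all flip: add.assoc)
qed (simp flip: add.assoc)

lemma uminus_image_eq: "uminus ` A = uminus -` A" for A :: "'a::group_add set"
  by force

lemma open_translation_group:
  fixes g :: "'a::topological_group_add"
  shows "open U \<Longrightarrow> open ((+) g ` U)"
  unfolding image_add_left_eq by (rule open_vimage) (auto intro!: continuous_intros)

lemma Hausdorff_space_t2: "Hausdorff_space (euclidean :: 'a::t2_space topology)"
  unfolding Hausdorff_space_def by (simp add: disjnt_def) (meson hausdorff)

section \<open>Cutoff functions and invariance of Haar measure\<close>

locale locally_compact_haar = left_haar_measure \<mu>
  for \<mu> :: "'g::{topological_group_add, t2_space} measure" +
  assumes locally_compact: "locally_compact_space (euclidean :: 'g topology)"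
begin

lemma space_eq [simp]: "space \<mu> = UNIV"
  using sets_eq_imp_space_eq[OF sets_eq_borel] by simp

lemma borel_measurable_eq: "borel_measurable \<mu> = borel_measurable borel"
  by (rule measurable_cong_sets[OF sets_eq_borel refl])

lemma compact_nbhd:
  fixes K :: "'g set"
  assumes "compact K"
  obtains O' C where "open O'" "compact C" "K \<subseteq> O'" "O' \<subseteq> C"
proof -
  have "\<forall>x\<in>K. \<exists>U C. open U \<and> compact C \<and> x \<in> U \<and> U \<subseteq> C"
    using locally_compact unfolding locally_compact_space_def by simp
  then obtain U C where U: "\<And>x. x \<in> K \<Longrightarrow> open (U x) \<and> compact (C x) \<and> x \<in> U x \<and> U x \<subseteq> C x"
    by metis
  then obtain D where D: "D \<subseteq> K" "finite D" "K \<subseteq> (\<Union>x\<in>D. U x)"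
    using compactE_image[OF assms, of K U] by (metis UN_I subsetI)
  show ?thesis
  proof (rule that[of "\<Union>x\<in>D. U x" "\<Union>x\<in>D. C x"])
    show "open (\<Union>x\<in>D. U x)" using U D(1) by (intro open_UN) auto
    show "compact (\<Union>x\<in>D. C x)" using U D by (intro compact_UN) auto
    show "(\<Union>x\<in>D. U x) \<subseteq> (\<Union>x\<in>D. C x)" using U D(1) by blast
  qed (fact D(3))
qed

text \<open>A locally compact Hausdorff space is completely regular. Cutting \<open>U\<close> down
  to its intersection with a relatively compact neighbourhood of \<open>K\<close> forces the
  separating function to have compact support.\<close>

lemma Cc_urysohn:
  assumes K: "compact K" and U: "open U" "K \<subseteq> U"
  obtains \<phi> :: "'g \<Rightarrow> real" where "\<phi> \<in> Cc" "\<And>x. 0 \<le> \<phi> x" "\<And>x. \<phi> x \<le> 1"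
    "\<And>x. x \<in> K \<Longrightarrow> \<phi> x = 1" "\<And>x. x \<notin> U \<Longrightarrow> \<phi> x = 0"
proof -
  obtain O' C where O: "open O'" "compact C" "K \<subseteq> O'" "O' \<subseteq> C" using compact_nbhd[OF K] by blast
  have "regular_space (euclidean :: 'g topology)"
    using locally_compact Hausdorff_space_t2 by (rule locally_compact_Hausdorff_imp_regular_space)
  then have "completely_regular_space (euclidean :: 'g topology)"
    using locally_compact by (intro locally_compact_regular_imp_completely_regular_space) auto
  note zero_le_one[where 'a = real] this
  moreover have "compactin euclidean K" "closedin euclidean (- (U \<inter> O'))" "disjnt K (- (U \<inter> O'))"
    using K U O by (auto simp: disjnt_def)
  ultimately obtain f where f: "continuous_map euclidean (top_of_set {0..1::real}) f"
    "f ` (- (U \<inter> O')) \<subseteq> {0}" "f ` K \<subseteq> {1}"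
    by (rule Urysohn_completely_regular_compact_closed)
  have cont: "continuous_on UNIV f"
    using continuous_map_into_fulltopology[OF f(1)] by simp
  have range: "f x \<in> {0..1}" for x
    using f(1) by (simp add: continuous_map_in_subtopology Pi_iff)
  show ?thesis
  proof (rule that[of f])
    show "f \<in> Cc"
      by (rule CcI[OF cont O(2)]) (use f(2) O(4) in \<open>auto simp: image_subset_iff\<close>)
  qed (use range f in \<open>auto simp: image_subset_iff\<close>)
qed

text \<open>Finitely many translates of a nonempty open null set would cover any compact set, so all
  compact sets would be null, and by inner regularity the whole group.\<close>

lemma emeasure_open_pos:
  assumes U: "open U" "U \<noteq> {}"
  shows "emeasure \<mu> U > 0"
proof (rule ccontr)
  assume "\<not> emeasure \<mu> U > 0"
  then have U0: "emeasure \<mu> U = 0" by simp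
  obtain u where u: "u \<in> U" using U(2) by blast
  have K0: "emeasure \<mu> K = 0" if K: "compact K" for K
  proof -
    have "x \<in> (+) (x - u) ` U" for x using u by (intro image_eqI[of _ _ u]) simp_all
    then have "K \<subseteq> (\<Union>x\<in>K. (+) (x - u) ` U)" by blast
    then obtain D where D: "D \<subseteq> K" "finite D" "K \<subseteq> (\<Union>x\<in>D. (+) (x - u) ` U)"
      using compactE_image[OF K, of K "\<lambda>x. (+) (x - u) ` U"] open_translation_group[OF U(1)]
          by metis
    have "emeasure \<mu> K \<le> emeasure \<mu> (\<Union>x\<in>D. (+) (x - u) ` U)"
      using D open_translation_group[OF U(1)]
      by (intro emeasure_mono) (auto simp: sets_eq_borel)
    also have "\<dots> \<le> (\<Sum>x\<in>D. emeasure \<mu> ((+) (x - u) ` U))"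
      using D open_translation_group[OF U(1)]
      by (intro emeasure_subadditive_finite) (auto simp: sets_eq_borel)
    also have "\<dots> = 0" using U U0 by (simp add: left_invariant)
    finally show ?thesis by simp
  qed
  have "emeasure \<mu> UNIV = (SUP K\<in>{K. compact K \<and> K \<subseteq> UNIV}. emeasure \<mu> K)"
    by (rule inner_regular) simp
  also have "\<dots> = 0" using K0 by (auto intro!: SUP_eq_const)
  finally show False using nonzero by simp
qed

lemma distr_add_left: "distr \<mu> \<mu> ((+) g) = \<mu>"
proof (rule measure_eqI)
  fix A assume "A \<in> sets (distr \<mu> \<mu> ((+) g))"
  then have A: "A \<in> sets borel" by (simp add: sets_eq_borel)
  have "(+) g \<in> measurable \<mu> \<mu>"
    unfolding measurable_cong_sets[OF sets_eq_borel sets_eq_borel]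
    by (intro borel_measurable_continuous_onI continuous_intros)
  then have "emeasure (distr \<mu> \<mu> ((+) g)) A = emeasure \<mu> ((+) g -` A)"
    using A by (simp add: emeasure_distr sets_eq_borel)
  also have "\<dots> = emeasure \<mu> ((+) (- g) ` A)" by (simp add: image_add_left_eq)
  also have "\<dots> = emeasure \<mu> A" by (rule left_invariant[OF A])
  finally show "emeasure (distr \<mu> \<mu> ((+) g)) A = emeasure \<mu> A" .
qed simp

lemma measurable_add_left [measurable]: "(+) g \<in> measurable \<mu> \<mu>"
  unfolding measurable_cong_sets[OF sets_eq_borel sets_eq_borel]
  by (intro borel_measurable_continuous_onI continuous_intros)

lemma integral_add_left:
  fixes f :: "'g \<Rightarrow> 'b::{banach, second_countable_topology}"
  assumes "f \<in> borel_measurable \<mu>"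
  shows "(\<integral>x. f (g + x) \<partial>\<mu>) = (\<integral>x. f x \<partial>\<mu>)"
  using integral_distr[OF measurable_add_left assms, of g] by (simp add: distr_add_left)

section \<open>Integration of functions with compact support\<close>

lemma Cc_measurable:
  fixes f :: "'g \<Rightarrow> 'b::real_normed_vector"
  shows "f \<in> Cc \<Longrightarrow> f \<in> borel_measurable \<mu>"
  unfolding borel_measurable_eq by (intro borel_measurable_continuous_onI Cc_continuous)

lemma compact_in_sets: "compact K \<Longrightarrow> K \<in> sets \<mu>" for K :: "'g set"
  by (simp add: sets_eq_borel borel_closed compact_imp_closed)

lemma continuous_bounded_on_compact:
  fixes f :: "'a::topological_space \<Rightarrow> 'b::real_normed_vector"
  assumes "continuous_on UNIV f" "compact K"
  obtains B where "B \<ge> 0" "\<And>x. x \<in> K \<Longrightarrow> norm (f x) \<le> B"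
proof -
  have "bounded (f ` K)"
    using assms continuous_on_subset by (intro compact_imp_bounded compact_continuous_image) blast+
  then obtain B where "\<And>x. x \<in> K \<Longrightarrow> norm (f x) \<le> B" by (auto simp: bounded_iff)
  then show ?thesis using that[of "max 0 B"] by (auto simp: le_max_iff_disj)
qed

lemma integral_supported_le:
  fixes f :: "'g \<Rightarrow> 'b::{banach, second_countable_topology}"
  assumes K: "compact K" and f: "f \<in> borel_measurable \<mu>" and out: "\<And>x. x \<notin> K \<Longrightarrow> f x = 0"
    and bd: "\<And>x. x \<in> K \<Longrightarrow> norm (f x) \<le> B"
  shows "integrable \<mu> f" "norm (\<integral>x. f x \<partial>\<mu>) \<le> B * measure \<mu> K"
proof -
  have fin: "emeasure \<mu> K < \<infinity>" by (rule finite_on_compact[OF K])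
  have int: "integrable \<mu> (\<lambda>x. indicator K x * B)"
    using fin compact_in_sets[OF K] by (intro integrable_mult_left) auto
  have le: "norm (f x) \<le> indicator K x * B" for x using out bd by (auto simp: indicator_def)
  show f_int: "integrable \<mu> f"
    by (rule Bochner_Integration.integrable_bound[OF int f]) (intro AE_I2, use le
        in \<open>auto intro: order_trans[OF _ abs_ge_self]\<close>)
  have "norm (\<integral>x. f x \<partial>\<mu>) \<le> (\<integral>x. norm (f x) \<partial>\<mu>)" by (rule integral_norm_bound)
  also have "\<dots> \<le> (\<integral>x. indicator K x * B \<partial>\<mu>)"
    using f_int int le by (intro integral_mono) auto
  also have "\<dots> = B * measure \<mu> K" using compact_in_sets[OF K] by simp
  finally show "norm (\<integral>x. f x \<partial>\<mu>) \<le> B * measure \<mu> K" .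
qed

lemma Cc_integrable:
  fixes f :: "'g \<Rightarrow> 'b::{banach, second_countable_topology}"
  assumes "f \<in> Cc"
  shows "integrable \<mu> f"
proof -
  obtain K where K: "continuous_on UNIV f" "compact K" "\<And>x. x \<notin> K \<Longrightarrow> f x = 0"
    using assms by (auto simp: Cc_def)
  obtain B where "\<And>x. x \<in> K \<Longrightarrow> norm (f x) \<le> B"
    using continuous_bounded_on_compact[OF K(1,2)] by blast
  then show ?thesis using integral_supported_le(1)[OF K(2) Cc_measurable[OF assms] K(3)] by blast
qed

lemma Cc_Lp: "\<lbrakk>f \<in> Cc; p > 0\<rbrakk> \<Longrightarrow> f \<in> Lp_functions p \<mu>"
  by (simp add: Lp_functions_def Cc_measurable Cc_integrable Cc_powr)

text \<open>Joint continuity is uniform in \<open>y\<close> over the compact set \<open>L\<close>,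
  and \<open>L\<close> has finite measure, so the integral depends continuously on
  \<open>x\<close>.\<close>

lemma Cc_parameter_integral:
  fixes F :: "'g \<Rightarrow> 'g \<Rightarrow> complex"
  assumes F: "continuous_on UNIV (\<lambda>(x, y). F x y)" and K: "compact K" and L: "compact L"
    and out: "\<And>x y. x \<notin> K \<or> y \<notin> L \<Longrightarrow> F x y = 0"
  shows "(\<lambda>x. \<integral>y. F x y \<partial>\<mu>) \<in> Cc" "\<And>x. (\<lambda>y. F x y) \<in> Cc"
proof -
  have section': "(\<lambda>y. F x y) \<in> Cc" for x
  proof (rule CcI[OF _ L])
    show "continuous_on UNIV (F x)"
      using continuous_on_compose2[OF F, of UNIV "\<lambda>y. (x, y)"]
      by (simp add: continuous_on_Pair continuous_on_const continuous_on_id)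
  qed (use out in auto)
  then show "\<And>x. (\<lambda>y. F x y) \<in> Cc" .
  show "(\<lambda>x. \<integral>y. F x y \<partial>\<mu>) \<in> Cc"
  proof (rule CcI[OF _ K])
    show "continuous_on UNIV (\<lambda>x. \<integral>y. F x y \<partial>\<mu>)"
      unfolding continuous_on_def
    proof (intro ballI tendstoI)
      fix x0 :: 'g and e :: real assume e: "e > 0"
      define d where "d = e / (2 * (measure \<mu> L + 1))"
      have d: "d > 0" using e by (simp add: d_def add_nonneg_pos)
      obtain X where X: "x0 \<in> X" "open X" "\<forall>x\<in>X \<inter> UNIV. \<forall>y\<in>L. dist (F x y) (F x0 y) \<le> d"
        using continuous_on_prod_compactE[of UNIV L "\<lambda>(x, y). F x y" x0 d]
          continuous_on_subset[OF F] L d by auto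
      have "dist (\<integral>y. F x y \<partial>\<mu>) (\<integral>y. F x0 y \<partial>\<mu>) < e" if "x \<in> X" for x
      proof -
        have "dist (\<integral>y. F x y \<partial>\<mu>) (\<integral>y. F x0 y \<partial>\<mu>) = norm (\<integral>y. F x y - F x0 y \<partial>\<mu>)"
          using Cc_integrable[OF section'] by (simp add: dist_norm)
        also have "\<dots> \<le> d * measure \<mu> L"
          using X that out Cc_measurable[OF section']
          by (intro integral_supported_le(2)[OF L]) (auto simp: dist_norm)
        also have "\<dots> \<le> d * (measure \<mu> L + 1)" using d by simp
        also have "\<dots> < e" using e by (simp add: d_def divide_simps add_nonneg_eq_0_iff)
        finally show ?thesis .
      qed
      then show "\<forall>\<^sub>F x in at x0 within UNIV. dist (\<integral>y. F x y \<partial>\<mu>) (\<integral>y. F x0 y \<partial>\<mu>) < e"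
        using X(1,2) unfolding eventually_at_topological by blast
    qed
  qed (use out in simp)
qed


text \<open>
  The Borel sets of a product may be more than the product of the Borel sets. A continuous function
  is nevertheless product measurable on a compact rectangle, being a uniform limit of functions
  \<open>(x, y) \<mapsto> F (c\<^sub>n x) y\<close> where \<open>c\<^sub>n\<close> takes finitely many values.
\<close>

lemma continuous_product_measurable:
  fixes F :: "'g \<Rightarrow> 'g \<Rightarrow> complex"
  assumes F: "continuous_on UNIV (\<lambda>(x, y). F x y)" and K: "compact K" and L: "compact L"
  shows "(\<lambda>(x, y). F x y) \<in> borel_measurable (restrict_space \<mu> K \<Otimes>\<^sub>M restrict_space \<mu> L)"
proof -
  let ?M = "restrict_space \<mu> K" and ?N = "restrict_space \<mu> L"
  have "\<exists>xs U. (\<forall>x\<in>K. \<exists>i<length xs. x \<in> U (xs ! i)) \<and> (\<forall>z. open (U z)) \<and>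
      (\<forall>z x y. x \<in> U z \<longrightarrow> y \<in> L \<longrightarrow> dist (F x y) (F z y) \<le> inverse (real (Suc n)))" for n
  proof -
    have "\<exists>X. z \<in> X \<and> open X \<and> (\<forall>x\<in>X. \<forall>y\<in>L. dist (F x y) (F z y) \<le> inverse (real (Suc n)))" for z
    proof -
      obtain X where "z \<in> X" "open X"
        "\<forall>x\<in>X \<inter> UNIV. \<forall>y\<in>L. dist ((\<lambda>(x, y). F x y) (x, y)) ((\<lambda>(x, y). F x y) (z, y))
            \<le> inverse (real (Suc n))"
        by (rule continuous_on_prod_compactE[of UNIV L "\<lambda>(x, y). F x y" z "inverse (real (Suc n))"])
          (use continuous_on_subset[OF F] L in auto)
      then show ?thesis by auto
    qed
    then obtain U where U: "\<And>z. z \<in> U z" "\<And>z. open (U z)"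
      "\<And>z x y. x \<in> U z \<Longrightarrow> y \<in> L \<Longrightarrow> dist (F x y) (F z y) \<le> inverse (real (Suc n))"
      by metis
    have "K \<subseteq> (\<Union>z\<in>K. U z)" using U(1) by blast
    then obtain D where D: "D \<subseteq> K" "finite D" "K \<subseteq> (\<Union>z\<in>D. U z)"
      using compactE_image[OF K, of K U] U(2) by metis
    obtain xs where xs: "set xs = D" using finite_list[OF D(2)] by blast
    have "\<exists>i<length xs. x \<in> U (xs ! i)" if "x \<in> K" for x
      using D(3) that xs by (metis UN_E in_set_conv_nth subsetD)
    then show ?thesis using U by blast
  qed
  then obtain xs U where cover: "\<And>n x. x \<in> K \<Longrightarrow> \<exists>i<length (xs n). x \<in> U n (xs n ! i)"
    and op: "\<And>n z. open (U n z)"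
    and close: "\<And>n z x y. \<lbrakk>x \<in> U n z; y \<in> L\<rbrakk> \<Longrightarrow> dist (F x y) (F z y) \<le> inverse (real (Suc n))"
    by metis
  \<comment> \<open>The least index of a covering set is measurable in \<open>x\<close>, and since
    it takes values in the natural numbers the sections can be glued countably. Its value matters on
    \<open>K\<close> only, where a covering set exists.\<close>
  define c where "c n x = (LEAST i. x \<in> U n (xs n ! i))" for n x
  have c: "x \<in> U n (xs n ! c n x)" if "x \<in> K" for n x
    using cover[OF that, of n] unfolding c_def by (auto intro: LeastI)
  have "(\<lambda>x. x \<in> U n (xs n ! i)) \<in> measurable \<mu> (count_space UNIV)" for n i
    using op by (auto simp: pred_def sets_eq_borel)
  then have c_meas: "c n \<in> measurable \<mu> (count_space UNIV)" for n
    unfolding c_def by (rule measurable_Least)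
  have c_meas': "(\<lambda>z. c n (fst z)) \<in> measurable (?M \<Otimes>\<^sub>M ?N) (count_space UNIV)" for n
    by (rule measurable_compose[OF measurable_fst measurable_restrict_space1[OF c_meas]])
  have F_meas: "F x \<in> borel_measurable \<mu>" for x
    unfolding borel_measurable_eq
    using continuous_on_compose2[OF F, of UNIV "\<lambda>y. (x, y)"]
    by (intro borel_measurable_continuous_onI) (simp add: continuous_on_Pair continuous_on_const
        continuous_on_id)
  have "(\<lambda>z. F (xs n ! i) (snd z)) \<in> borel_measurable (?M \<Otimes>\<^sub>M ?N)" for n i
    by (rule measurable_compose[OF measurable_snd measurable_restrict_space1[OF F_meas]])
  then have Fn: "(\<lambda>z. F (xs n ! c n (fst z)) (snd z)) \<in> borel_measurable (?M \<Otimes>\<^sub>M ?N)" for n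
    by (intro measurable_compose_countable[OF _ c_meas', of "\<lambda>i z. F (xs n ! i) (snd z)"]) auto
  have "(\<lambda>z. F (fst z) (snd z)) \<in> borel_measurable (?M \<Otimes>\<^sub>M ?N)"
  proof (rule borel_measurable_LIMSEQ_metric[OF Fn])
    fix z assume "z \<in> space (?M \<Otimes>\<^sub>M ?N)"
    then have z: "fst z \<in> K" "snd z \<in> L" by (auto simp: space_pair_measure space_restrict_space)
    show "(\<lambda>n. F (xs n ! c n (fst z)) (snd z)) \<longlonglongrightarrow> F (fst z) (snd z)"
    proof (rule metric_LIMSEQ_I)
      fix r :: real assume "r > 0"
      then obtain N where N: "inverse (real (Suc N)) < r" using reals_Archimedean by blast
      have "dist (F (xs n ! c n (fst z)) (snd z)) (F (fst z) (snd z)) < r" if "n \<ge> N" for n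
      proof -
        have "dist (F (fst z) (snd z)) (F (xs n ! c n (fst z)) (snd z)) \<le> inverse (real (Suc n))"
          by (rule close[OF c[OF z(1)] z(2)])
        also have "\<dots> \<le> inverse (real (Suc N))" using that by (simp add: field_simps)
        finally show ?thesis using N by (simp add: dist_commute)
      qed
      then show "\<exists>N. \<forall>n\<ge>N. dist (F (xs n ! c n (fst z)) (snd z)) (F (fst z) (snd z)) < r" by blast
    qed
  qed
  then show ?thesis by (simp add: split_beta')
qed

lemma integral_restrict_supported:
  fixes f :: "'g \<Rightarrow> complex"
  assumes "compact K" "\<And>x. x \<notin> K \<Longrightarrow> f x = 0"
  shows "(\<integral>x. f x \<partial>restrict_space \<mu> K) = (\<integral>x. f x \<partial>\<mu>)"
  using assms(2) compact_in_sets[OF assms(1)]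
  by (subst integral_restrict_space) (auto simp: indicator_def intro!:
      Bochner_Integration.integral_cong)

text \<open>Restricted to the compact sets \<open>K\<close> and \<open>L\<close> the measure is
  finite, so the classical theorem applies there; the support condition then extends the integrals
  back to the whole group.\<close>

lemma Cc_fubini:
  fixes F :: "'g \<Rightarrow> 'g \<Rightarrow> complex"
  assumes F: "continuous_on UNIV (\<lambda>(x, y). F x y)" and K: "compact K" and L: "compact L"
    and out: "\<And>x y. x \<notin> K \<or> y \<notin> L \<Longrightarrow> F x y = 0"
  shows "(\<integral>y. (\<integral>x. F x y \<partial>\<mu>) \<partial>\<mu>) = (\<integral>x. (\<integral>y. F x y \<partial>\<mu>) \<partial>\<mu>)"
proof -
  let ?M = "restrict_space \<mu> K" and ?N = "restrict_space \<mu> L"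
  have fin: "finite_measure (restrict_space \<mu> C)" if "compact C" for C
    using finite_on_compact[OF that] compact_in_sets[OF that]
    by (intro finite_measureI) (simp add: emeasure_restrict_space space_restrict_space)
  interpret M: finite_measure ?M by (rule fin[OF K])
  interpret N: finite_measure ?N by (rule fin[OF L])
  interpret P: finite_measure "?M \<Otimes>\<^sub>M ?N"
    by (rule finite_measure_pair_measure[OF N.finite_measure_axioms M.finite_measure_axioms])
  interpret pair_sigma_finite ?M ?N ..
  obtain B where B: "\<And>z. z \<in> K \<times> L \<Longrightarrow> norm ((\<lambda>(x, y). F x y) z) \<le> B"
    using continuous_bounded_on_compact[OF F compact_Times[OF K L]] by blast
  have "integrable (?M \<Otimes>\<^sub>M ?N) (case_prod F)"
  proof (rule P.integrable_const_bound)
    show "AE z in ?M \<Otimes>\<^sub>M ?N. norm (case_prod F z) \<le> B"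
      using B by (intro AE_I2) (auto simp: space_pair_measure space_restrict_space)
  qed (rule continuous_product_measurable[OF F K L])
  then have eq: "(\<integral>y. (\<integral>x. F x y \<partial>?M) \<partial>?N) = (\<integral>x. (\<integral>y. F x y \<partial>?N) \<partial>?M)"
    by (rule Fubini_integral)
  have 1: "(\<integral>x. F x y \<partial>?M) = (\<integral>x. F x y \<partial>\<mu>)" for y
    by (rule integral_restrict_supported[OF K]) (use out in auto)
  have 2: "(\<integral>y. F x y \<partial>?N) = (\<integral>y. F x y \<partial>\<mu>)" for x
    by (rule integral_restrict_supported[OF L]) (use out in auto)
  have "(\<integral>y. (\<integral>x. F x y \<partial>\<mu>) \<partial>?N) = (\<integral>y. (\<integral>x. F x y \<partial>\<mu>) \<partial>\<mu>)"
    by (rule integral_restrict_supported[OF L]) (use out in simp)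
  moreover have "(\<integral>x. (\<integral>y. F x y \<partial>\<mu>) \<partial>?M) = (\<integral>x. (\<integral>y. F x y \<partial>\<mu>) \<partial>\<mu>)"
    by (rule integral_restrict_supported[OF K]) (use out in simp)
  ultimately show ?thesis using eq by (simp add: 1 2)
qed

section \<open>Density of compactly supported continuous functions in L^p\<close>

lemma Cc_Lp_nrm_le:
  assumes p: "1 \<le> p" and K: "compact K" and f: "f \<in> borel_measurable \<mu>"
    and out: "\<And>x. x \<notin> K \<Longrightarrow> f x = 0" and bd: "\<And>x. cmod (f x) \<le> B"
  shows "Lp_nrm p \<mu> f \<le> B * measure \<mu> K powr (1 / p)"
proof (rule Lp_nrm_leI)
  have B: "B \<ge> 0" using bd[of undefined] norm_ge_zero order_trans by blast
  then show "0 \<le> B * measure \<mu> K powr (1 / p)" by simp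
  have "norm (\<integral>x. cmod (f x) powr p \<partial>\<mu>) \<le> B powr p * measure \<mu> K"
    using p f out bd by (intro integral_supported_le(2)[OF K]) (auto intro!: powr_mono2)
  also have "\<dots> = (B * measure \<mu> K powr (1 / p)) powr p"
    using p B by (simp add: powr_mult powr_powr)
  finally show "(\<integral>x. cmod (f x) powr p \<partial>\<mu>) \<le> (B * measure \<mu> K powr (1 / p)) powr p" by simp
qed (use p in simp)

text \<open>Outer regularity puts an open \<open>U\<close> around \<open>A\<close>, and inner
  regularity puts a compact \<open>K\<close> inside \<open>U\<close>. As inner regularity is given
  for open sets only, \<open>K\<close> approximates \<open>U\<close> and need not lie in
  \<open>A\<close>; a cutoff function between \<open>K\<close> and \<open>U\<close> is close to both
  indicators.\<close>

lemma Cc_dense_indicator: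
  assumes p: "1 \<le> p" and A: "A \<in> sets \<mu>" "emeasure \<mu> A < \<infinity>" and \<epsilon>: "\<epsilon> > 0"
  shows "\<exists>\<phi>\<in>Cc. Lp_nrm p \<mu> (\<lambda>x. indicator A x - \<phi> x) < \<epsilon>"
proof -
  \<comment> \<open>Two errors of size \<open>d\<close> add up to
    \<open>(\<epsilon> / 2) powr p\<close>; aiming at \<open>\<epsilon> / 2\<close> leaves room for
    the strict inequality.\<close>
  define d where "d = (\<epsilon> / 2) powr p / 2"
  have d: "d > 0" using \<epsilon> by (simp add: d_def)
  have A': "A \<in> sets borel" using A by (simp add: sets_eq_borel)
  have "(INF U\<in>{U. open U \<and> A \<subseteq> U}. emeasure \<mu> U) < emeasure \<mu> A + ennreal d"
    using outer_regular[OF A'] A(2) d by (simp add: ennreal_lessI flip: less_top)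
  then obtain U where U: "open U" "A \<subseteq> U" "emeasure \<mu> U < emeasure \<mu> A + ennreal d"
    by (auto simp: INF_less_iff)
  have U_fin: "emeasure \<mu> U < \<infinity>" using U(3) A(2)
      by (metis ennreal_add_eq_top ennreal_less_top infinity_ennreal_def less_top order_less_trans)
  have Us: "U \<in> sets \<mu>" using U(1) by (simp add: sets_eq_borel)
  obtain K where K: "compact K" "K \<subseteq> U" "emeasure \<mu> U < emeasure \<mu> K + ennreal d"
  proof (cases "emeasure \<mu> U = 0")
    case True
    then show ?thesis using that[of "{}"] d by simp
  next
    case False
    obtain u where u: "0 \<le> u" "emeasure \<mu> U = ennreal u"
      using U_fin by (cases "emeasure \<mu> U") auto
    then have "u > 0" using False by (cases "u = 0") auto
    then have "ennreal (u - d) < (SUP K\<in>{K. compact K \<and> K \<subseteq> U}. emeasure \<mu> K)"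
      unfolding inner_regular[OF U(1), symmetric] u(2) using d by (intro ennreal_lessI) auto
    then obtain K where K: "compact K" "K \<subseteq> U" "ennreal (u - d) < emeasure \<mu> K"
      by (auto simp: less_SUP_iff)
    obtain k where k: "0 \<le> k" "emeasure \<mu> K = ennreal k"
      using finite_on_compact[OF K(1)] by (cases "emeasure \<mu> K") auto
    \<comment> \<open>\<open>ennreal\<close> sends a negative \<open>u - d\<close> to 0, but then
      \<open>u < d\<close> and the claim is immediate.\<close>
    have "u < k + d" using K(3) k by (cases "u - d \<ge> 0") (auto simp: ennreal_less_iff)
    then have "emeasure \<mu> U < emeasure \<mu> K + ennreal d"
      using u(1) k d by (simp add: u(2) ennreal_less_iff flip: ennreal_plus)
    then show ?thesis using that K by blast
  qed
  obtain \<phi> where \<phi>: "\<phi> \<in> Cc" "\<And>x. 0 \<le> \<phi> x" "\<And>x. \<phi> x \<le> (1::real)"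
    "\<And>x. x \<in> K \<Longrightarrow> \<phi> x = 1" "\<And>x. x \<notin> U \<Longrightarrow> \<phi> x = 0"
    using Cc_urysohn[OF K(1) U(1) K(2)] by blast
  have Ks: "K \<in> sets \<mu>" by (rule compact_in_sets[OF K(1)])
  have K_fin: "emeasure \<mu> K < \<infinity>" by (rule finite_on_compact[OF K(1)])
  have mU: "measure \<mu> U < measure \<mu> A + d" "measure \<mu> U < measure \<mu> K + d"
    using U(3) K(3) U_fin K_fin A(2) d
    by (simp_all add: emeasure_eq_ennreal_measure less_top[symmetric] ennreal_less_iff
        flip: ennreal_plus)
  \<comment> \<open>The first difference covers \<open>U\<close> without \<open>A\<close>, the
    second \<open>U\<close> without \<open>K\<close>; elsewhere the indicator of \<open>A\<close>
    and \<open>\<phi>\<close> agree.\<close>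
  let ?g = "\<lambda>x. (indicator U x - indicator A x) + (indicator U x - indicator K x) :: real"
  have int: "integrable \<mu> ?g"
    using U_fin K_fin A Us Ks by (intro Bochner_Integration.integrable_add
        Bochner_Integration.integrable_diff) auto
  have le: "cmod (indicator A x - complex_of_real (\<phi> x)) powr p \<le> ?g x" for x
  proof -
    have "indicator A x - complex_of_real (\<phi> x) = complex_of_real (indicator A x - \<phi> x)"
      by (simp add: indicator_def)
    then have eq: "cmod (indicator A x - complex_of_real (\<phi> x)) = \<bar>indicator A x - \<phi> x\<bar>"
      by (simp only: norm_of_real)
    \<comment> \<open>The difference lies between 0 and 1 in modulus, so raising it to the power
      \<open>p\<close> does not enlarge it.\<close>
    have "\<bar>indicator A x - \<phi> x\<bar> powr p \<le> \<bar>indicator A x - \<phi> x\<bar> powr 1"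
      using \<phi>(2,3)[of x] p by (intro powr_mono') (auto simp: indicator_def)
    also have "\<dots> \<le> ?g x"
      using \<phi>(2-5)[of x] U(2) K(2) by (auto simp: indicator_def)
    finally show ?thesis unfolding eq .
  qed
  have meas: "(\<lambda>x. complex_of_real (\<phi> x)) \<in> borel_measurable \<mu>"
    by (rule Cc_measurable[OF Cc_of_real[OF \<phi>(1)]])
  have int': "integrable \<mu> (\<lambda>x. cmod (indicator A x - complex_of_real (\<phi> x)) powr p)"
    by (rule Bochner_Integration.integrable_bound[OF int])
      (use le A(1) meas in \<open>auto intro: order_trans[OF _ abs_ge_self]\<close>)
  have "(\<integral>x. cmod (indicator A x - complex_of_real (\<phi> x)) powr p \<partial>\<mu>) \<le> (\<integral>x. ?g x \<partial>\<mu>)"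
    by (rule integral_mono[OF int' int le])
  also have "\<dots> = (measure \<mu> U - measure \<mu> A) + (measure \<mu> U - measure \<mu> K)"
    using U_fin K_fin A Us Ks by simp
  also have "\<dots> \<le> (\<epsilon> / 2) powr p" using mU by (simp add: d_def)
  finally have "Lp_nrm p \<mu> (\<lambda>x. indicator A x - complex_of_real (\<phi> x)) \<le> \<epsilon> / 2"
    using \<epsilon> p by (intro Lp_nrm_leI) auto
  then show ?thesis using Cc_of_real[OF \<phi>(1)] \<epsilon>
      by (intro bexI[of _ "\<lambda>x. complex_of_real (\<phi> x)"]) auto
qed

lemma Cc_dense_simple:
  assumes p: "1 \<le> p" and f: "simple_function \<mu> f" "emeasure \<mu> {x \<in> space \<mu>. f x \<noteq> 0} \<noteq> \<infinity>"
  shows "f \<in> Lp_functions p \<mu> \<and> (\<forall>\<epsilon>>0. \<exists>\<phi>\<in>Cc. Lp_nrm p \<mu> (\<lambda>x. f x - \<phi> x) < \<epsilon>)"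
  using f
proof (induction f rule: integrable_simple_function_induct)
  case (cong f g)
  then have "f = g" by auto
  then show ?case using cong by simp
next
  case (indicator A c)
  have A: "(\<lambda>x. indicator A x :: complex) \<in> Lp_functions p \<mu>"
  proof -
    have "(\<lambda>x. cmod (indicator A x) powr p) = (indicator A :: _ \<Rightarrow> real)"
      using p by (auto simp: indicator_def)
    then show ?thesis using indicator by (simp add: Lp_functions_def)
  qed
  have eq: "indicator A x *\<^sub>R c = c * indicator A x" for x
    by (simp add: indicator_def)
  have "\<exists>\<phi>\<in>Cc. Lp_nrm p \<mu> (\<lambda>x. c * indicator A x - \<phi> x) < \<epsilon>" if "\<epsilon> > 0" for \<epsilon>
  proof -
    have "\<epsilon> / (cmod c + 1) > 0" using that by (simp add: add_nonneg_pos)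
    then obtain \<phi> where \<phi>: "\<phi> \<in> Cc" "Lp_nrm p \<mu> (\<lambda>x. indicator A x - \<phi> x) < \<epsilon> / (cmod c + 1)"
      using Cc_dense_indicator[OF p indicator] by blast
    have "Lp_nrm p \<mu> (\<lambda>x. c * (indicator A x - \<phi> x))
        = cmod c * Lp_nrm p \<mu> (\<lambda>x. indicator A x - \<phi> x)"
      using p by (intro Lp_nrm_cmult) simp
    also have "\<dots> \<le> (cmod c + 1) * Lp_nrm p \<mu> (\<lambda>x. indicator A x - \<phi> x)"
      by (intro mult_right_mono) auto
    also have "\<dots> < \<epsilon>"
      using \<phi>(2) add_nonneg_pos[OF norm_ge_zero zero_less_one, of c]
      by (simp add: pos_less_divide_eq mult.commute)
    finally show ?thesis using \<phi>(1)
        by (intro bexI[OF _ Cc_cmult[of \<phi> c]]) (simp_all add: right_diff_distrib)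
  qed
  then show ?case unfolding eq using Lp_functions_cmult[OF A, of c] by simp
next
  case (add f g)
  then have fg: "f \<in> Lp_functions p \<mu>" "g \<in> Lp_functions p \<mu>" by auto
  have "\<exists>\<phi>\<in>Cc. Lp_nrm p \<mu> (\<lambda>x. f x + g x - \<phi> x) < \<epsilon>" if "\<epsilon> > 0" for \<epsilon>
  proof -
    have "\<epsilon> / 2 > 0" using that by simp
    then obtain \<phi> \<psi> where \<phi>: "\<phi> \<in> Cc" "Lp_nrm p \<mu> (\<lambda>x. f x - \<phi> x) < \<epsilon> / 2"
      and \<psi>: "\<psi> \<in> Cc" "Lp_nrm p \<mu> (\<lambda>x. g x - \<psi> x) < \<epsilon> / 2"
      using add(6,7) by meson
    have Lp: "\<phi> \<in> Lp_functions p \<mu>" "\<psi> \<in> Lp_functions p \<mu>" using \<phi> \<psi> p by (auto intro: Cc_Lp)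
    have "Lp_nrm p \<mu> (\<lambda>x. (f x - \<phi> x) + (g x - \<psi> x)) < \<epsilon>"
      using Lp_nrm_triangle[OF p Lp_functions_diff[OF p fg(1) Lp(1)] Lp_functions_diff[OF p fg(2)
          Lp(2)]]
        \<phi>(2) \<psi>(2) by simp
    then show ?thesis
      using \<phi>(1) \<psi>(1) by (intro bexI[OF _ Cc_add[of \<phi> \<psi>]]) (simp_all add: algebra_simps)
  qed
  then show ?case using Lp_functions_add[OF p fg] by simp
qed

lemma Cc_dense:
  assumes p: "1 \<le> p" and f: "f \<in> Lp_functions p \<mu>" and \<epsilon>: "\<epsilon> > 0"
  obtains \<phi> where "\<phi> \<in> Cc" "Lp_nrm p \<mu> (\<lambda>x. f x - \<phi> x) < \<epsilon>"
proof -
  have p0: "p > 0" using p by simp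
  note [measurable] = Lp_functionsD(1)[OF f]
  obtain F where F: "\<And>i. simple_function \<mu> (F i)" "\<And>x. (\<lambda>i. F i x) \<longlonglongrightarrow> f x"
    "\<And>i x. cmod (F i x) \<le> 2 * cmod (f x)"
    using borel_measurable_implies_sequence_metric[OF Lp_functionsD(1)[OF f], of 0] by auto
  have F_meas [measurable]: "F i \<in> borel_measurable \<mu>" for i
    by (rule borel_measurable_simple_function[OF F(1)])
  have F_Lp: "F i \<in> Lp_functions p \<mu>" for i
    using F(3) by (intro Lp_nrm_mono(1)[OF p0 F_meas Lp_functions_cmult[OF f, of 2]]) (auto simp:
        norm_mult)
  have "emeasure \<mu> {x \<in> space \<mu>. F i x \<noteq> 0} \<noteq> \<infinity>" for i
  proof -
    \<comment> \<open>The nonzero values of a simple function are bounded away from 0, so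
      \<open>|F i|^p / m\<close> dominates the indicator of its support, which therefore has finite
      measure. Inserting 1 keeps the minimum defined when the function vanishes.\<close>
    define S where "S = (\<lambda>y. cmod y powr p) ` (F i ` space \<mu> - {0})"
    have S: "finite S" "\<And>y. y \<in> S \<Longrightarrow> y > 0" using simple_functionD(1)[OF F(1)] by (auto simp: S_def)
    define m where "m = Min (insert 1 S)"
    have m: "m > 0" "\<And>y. y \<in> S \<Longrightarrow> m \<le> y" using S by (auto simp: m_def)
    have "integrable \<mu> (\<lambda>x. indicator {x \<in> space \<mu>. F i x \<noteq> 0} x :: real)"
    proof (rule Bochner_Integration.integrable_bound)
      show "integrable \<mu> (\<lambda>x. cmod (F i x) powr p / m)"
        by (intro integrable_divide Lp_functionsD(2)[OF F_Lp])
      show "AE x in \<mu>. norm (indicator {x \<in> space \<mu>. F i x \<noteq> 0} x :: real)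
          \<le> norm (cmod (F i x) powr p / m)"
        using m by (intro AE_I2) (auto simp: indicator_def S_def)
    qed simp
    then show ?thesis by (auto simp: integrable_indicator_iff)
  qed
  then have dense: "\<And>\<epsilon>. \<epsilon> > 0 \<Longrightarrow> \<exists>\<phi>\<in>Cc. Lp_nrm p \<mu> (\<lambda>x. F i x - \<phi> x) < \<epsilon>" for i
    using Cc_dense_simple[OF p F(1)] by blast
  have "(\<lambda>i. \<integral>x. cmod (f x - F i x) powr p \<partial>\<mu>) \<longlonglongrightarrow> (\<integral>x. 0 \<partial>\<mu>)"
  proof (rule integral_dominated_convergence)
    \<comment> \<open>The factor 3 comes from \<open>|f - F i| \<le> |f| + 2 * |f|\<close>.\<close>
    show "integrable \<mu> (\<lambda>x. 3 powr p * cmod (f x) powr p)" using f by auto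
    show "AE x in \<mu>. (\<lambda>i. cmod (f x - F i x) powr p) \<longlonglongrightarrow> 0"
    proof (rule AE_I2)
      fix x
      have "(\<lambda>i. cmod (f x - F i x) powr p) \<longlonglongrightarrow> cmod (f x - f x) powr p"
        using p by (intro tendsto_powr' tendsto_norm tendsto_diff tendsto_const F(2)) auto
      then show "(\<lambda>i. cmod (f x - F i x) powr p) \<longlonglongrightarrow> 0" by simp
    qed
    show "AE x in \<mu>. norm (cmod (f x - F i x) powr p) \<le> 3 powr p * cmod (f x) powr p" for i
    proof (rule AE_I2)
      fix x
      have "cmod (f x - F i x) \<le> 3 * cmod (f x)"
          using F(3)[of i x] norm_triangle_ineq4[of "f x" "F i x"] by simp
      then have "cmod (f x - F i x) powr p \<le> (3 * cmod (f x)) powr p" using p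
          by (intro powr_mono2) auto
      then show "norm (cmod (f x - F i x) powr p) \<le> 3 powr p * cmod (f x) powr p"
          by (simp add: powr_mult)
    qed
  qed simp_all
  then have "\<forall>\<^sub>F i in sequentially. (\<integral>x. cmod (f x - F i x) powr p \<partial>\<mu>) < (\<epsilon> / 2) powr p"
    using \<epsilon> by (intro order_tendstoD(2)) auto
  then obtain i where i: "(\<integral>x. cmod (f x - F i x) powr p \<partial>\<mu>) < (\<epsilon> / 2) powr p"
    using eventually_happens by force
  then have fF: "Lp_nrm p \<mu> (\<lambda>x. f x - F i x) \<le> \<epsilon> / 2" using \<epsilon> p by (intro Lp_nrm_leI) auto
  obtain \<phi> where \<phi>: "\<phi> \<in> Cc" "Lp_nrm p \<mu> (\<lambda>x. F i x - \<phi> x) < \<epsilon> / 2"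
    using dense[of "\<epsilon> / 2"] \<epsilon> by auto
  show ?thesis
    using that[OF \<phi>(1)] Lp_nrm_diff_triangle[OF p f F_Lp Cc_Lp[OF \<phi>(1) p0], of i] fF \<phi>(2) by simp
qed

text \<open>The terms are differences of approximants with error below \<open>(1/2) ^ n\<close>, so
  their norms are summable. Both \<open>f\<close> and the sum of the series are L^p limits of the
  approximants and hence agree almost everywhere. This gives pointwise convergence together with an
  absolutely convergent majorant.\<close>

lemma Cc_series:
  assumes p: "1 \<le> p" and f: "f \<in> Lp_functions p \<mu>"
  obtains \<phi> :: "nat \<Rightarrow> 'g \<Rightarrow> complex" where "\<And>n. \<phi> n \<in> Cc" "summable (\<lambda>n. Lp_nrm p \<mu> (\<phi> n))"
    "AE x in \<mu>. summable (\<lambda>n. cmod (\<phi> n x))" "AE x in \<mu>. (\<lambda>n. \<phi> n x) sums f x"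
    "(\<lambda>N. Lp_nrm p \<mu> (\<lambda>x. f x - (\<Sum>n<N. \<phi> n x))) \<longlonglongrightarrow> 0"
proof -
  have p0: "p > 0" using p by simp
  have "\<exists>\<psi>. \<psi> \<in> Cc \<and> Lp_nrm p \<mu> (\<lambda>x. f x - \<psi> x) < (1/2) ^ n" for n :: nat
    using Cc_dense[OF p f, of "(1/2) ^ n"] by auto
  then obtain \<psi> where \<psi>: "\<And>n. \<psi> n \<in> Cc" "\<And>n. Lp_nrm p \<mu> (\<lambda>x. f x - \<psi> n x) < (1/2) ^ n" by metis
  define \<phi> where "\<phi> n x = (case n of 0 \<Rightarrow> \<psi> 0 x | Suc m \<Rightarrow> \<psi> (Suc m) x - \<psi> m x)" for n x
  have \<phi>: "\<phi> n \<in> Cc" for n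
  proof (cases n)
    case (Suc m)
    have "(\<lambda>x. \<psi> (Suc m) x + (-1) * \<psi> m x) \<in> Cc" by (intro Cc_add Cc_cmult \<psi>)
    then show ?thesis by (simp add: \<phi>_def[abs_def] Suc)
  qed (simp add: \<phi>_def[abs_def] \<psi>)
  have \<phi>_Lp: "\<phi> n \<in> Lp_functions p \<mu>" for n by (rule Cc_Lp[OF \<phi> p0])
  have \<psi>_Lp: "\<psi> n \<in> Lp_functions p \<mu>" for n by (rule Cc_Lp[OF \<psi>(1) p0])
  \<comment> \<open>The partial sum that includes the term of index \<open>N\<close> is
    \<open>\<psi> N\<close>, hence the shifts by one when limits of partial sums are taken.\<close>
  have tele: "(\<Sum>n<Suc N. \<phi> n x) = \<psi> N x" for N x
    by (induction N) (auto simp: \<phi>_def)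
  have "Lp_nrm p \<mu> (\<phi> (Suc n)) \<le> 2 * (1/2) ^ n" for n
  proof -
    have "Lp_nrm p \<mu> (\<lambda>x. \<psi> (Suc n) x - \<psi> n x)
        \<le> Lp_nrm p \<mu> (\<lambda>x. \<psi> (Suc n) x - f x) + Lp_nrm p \<mu> (\<lambda>x. f x - \<psi> n x)"
      by (rule Lp_nrm_diff_triangle[OF p \<psi>_Lp f \<psi>_Lp])
    also have "Lp_nrm p \<mu> (\<lambda>x. \<psi> (Suc n) x - f x) \<le> (1/2) ^ Suc n"
      using \<psi>(2)[of "Suc n"] Lp_nrm_diff_commute[of p \<mu> "\<psi> (Suc n)" f] by simp
    also have "(1/2) ^ Suc n \<le> (1/2 :: real) ^ n" by simp
    finally show ?thesis using \<psi>(2)[of n] by (simp add: \<phi>_def[abs_def])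
  qed
  then have "summable (\<lambda>n. Lp_nrm p \<mu> (\<phi> (Suc n)))"
    by (intro summable_comparison_test[OF _ summable_mult[OF summable_geometric[of "1/2::real"], of
        2]]) auto
  then have summ: "summable (\<lambda>n. Lp_nrm p \<mu> (\<phi> n))" by (subst (asm) summable_Suc_iff)
  then obtain s where s: "s \<in> Lp_functions p \<mu>"
    "AE x in \<mu>. summable (\<lambda>n. cmod (\<phi> n x))" "AE x in \<mu>. (\<lambda>n. \<phi> n x) sums s x"
    "(\<lambda>N. Lp_nrm p \<mu> (\<lambda>x. s x - (\<Sum>n<N. \<phi> n x))) \<longlonglongrightarrow> 0"
    by (rule Lp_series[OF p \<phi>_Lp])
  have lim1: "(\<lambda>N. Lp_nrm p \<mu> (\<lambda>x. s x - \<psi> N x)) \<longlonglongrightarrow> 0"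
    using LIMSEQ_Suc[OF s(4)] by (simp only: tele)
  have lim2: "(\<lambda>N. Lp_nrm p \<mu> (\<lambda>x. f x - \<psi> N x)) \<longlonglongrightarrow> 0"
    by (rule tendsto_sandwich[OF _ _ tendsto_const LIMSEQ_realpow_zero[of "1/2"]])
      (auto intro!: always_eventually less_imp_le \<psi>(2))
  have "Lp_nrm p \<mu> (\<lambda>x. s x - f x) \<le> Lp_nrm p \<mu> (\<lambda>x. s x - \<psi> N x) + Lp_nrm p \<mu> (\<lambda>x. f x - \<psi> N x)"
      for N
    using Lp_nrm_diff_triangle[OF p s(1) \<psi>_Lp f, of N] Lp_nrm_diff_commute[of p \<mu> f "\<psi> N"] by simp
  then have "Lp_nrm p \<mu> (\<lambda>x. s x - f x) \<le> 0 + 0"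
    by (intro LIMSEQ_le_const[OF tendsto_add[OF lim1 lim2]]) auto
  then have "Lp_nrm p \<mu> (\<lambda>x. s x - f x) = 0" using Lp_nrm_nonneg[of p \<mu> "\<lambda>x. s x - f x"] by simp
  then have ae: "AE x in \<mu>. s x - f x = 0"
    using Lp_nrm_eq_0_iff[OF p0 Lp_functions_diff[OF p s(1) f]] by simp
  show ?thesis
  proof (rule that[OF \<phi> summ s(2)])
    show "AE x in \<mu>. (\<lambda>n. \<phi> n x) sums f x" using s(3) ae by eventually_elim simp
    show "(\<lambda>N. Lp_nrm p \<mu> (\<lambda>x. f x - (\<Sum>n<N. \<phi> n x))) \<longlonglongrightarrow> 0"
      by (subst filterlim_sequentially_Suc[symmetric]) (simp only: tele lim2)
  qed
qed

end

section \<open>Convolution\<close>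

lemma continuous_on_compose_UNIV:
  "\<lbrakk>continuous_on UNIV g; continuous_on UNIV h\<rbrakk> \<Longrightarrow> continuous_on UNIV (\<lambda>z. g (h z))"
  by (rule continuous_on_compose2) auto

context locally_compact_haar
begin

section \<open>Convolution of compactly supported functions\<close>

lemma convolution_kernel:
  fixes f g :: "'g \<Rightarrow> complex"
  assumes "f \<in> Cc" "g \<in> Cc"
  obtains K L where "compact K" "compact L" "continuous_on UNIV (\<lambda>(x, y). f y * g (- y + x))"
    "\<And>x y. x \<notin> K \<or> y \<notin> L \<Longrightarrow> f y * g (- y + x) = 0" "\<And>y. y \<notin> L \<Longrightarrow> f y = 0"
proof -
  obtain L where L: "continuous_on UNIV f" "compact L" "\<And>x. x \<notin> L \<Longrightarrow> f x = 0"
    using assms(1) by (auto simp: Cc_def)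
  obtain K where K: "continuous_on UNIV g" "compact K" "\<And>x. x \<notin> K \<Longrightarrow> g x = 0"
    using assms(2) by (auto simp: Cc_def)
  show ?thesis
  proof (rule that[OF compact_add[OF L(2) K(2)] L(2)])
    show "continuous_on UNIV (\<lambda>(x, y). f y * g (- y + x))"
      unfolding split_beta
      by (intro continuous_on_mult continuous_on_compose_UNIV[OF L(1)] continuous_on_compose_UNIV[OF
          K(1)]
          continuous_intros)
    fix x y assume xy: "x \<notin> {x + y |x y. x \<in> L \<and> y \<in> K} \<or> y \<notin> L"
    \<comment> \<open>If \<open>y\<close> is in \<open>L\<close> and \<open>- y + x\<close> in
      \<open>K\<close>, then \<open>x\<close> is their sum in this order and lies in
      \<open>L + K\<close>.\<close>
    have "y + (- y + x) = x" by (simp flip: add.assoc)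
    then have "y \<in> L \<Longrightarrow> - y + x \<notin> K" using xy by (smt (verit) mem_Collect_eq)
    then show "f y * g (- y + x) = 0" using L(3) K(3) by (cases "y \<in> L") auto
  qed (rule L(3))
qed

lemma Cc_convolution:
  assumes "f \<in> Cc" "g \<in> Cc"
  shows "convolution \<mu> f g \<in> Cc" "\<And>x. (\<lambda>y. f y * g (- y + x)) \<in> Cc"
proof -
  obtain K L where *: "compact K" "compact L" "continuous_on UNIV (\<lambda>(x, y). f y * g (- y + x))"
    "\<And>x y. x \<notin> K \<or> y \<notin> L \<Longrightarrow> f y * g (- y + x) = 0"
    using convolution_kernel[OF assms] by metis
  show "\<And>x. (\<lambda>y. f y * g (- y + x)) \<in> Cc" using Cc_parameter_integral(2)[OF *(3,1,2,4)] .
  show "convolution \<mu> f g \<in> Cc"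
    using Cc_parameter_integral(1)[OF *(3,1,2,4)] by (simp add: convolution_def[abs_def])
qed

lemma Lp_nrm_1: "Lp_nrm 1 M f = (\<integral>x. cmod (f x) \<partial>M)"
  by (simp add: Lp_nrm_def)

text \<open>Jensen's inequality for a weight of arbitrary total mass \<open>s\<close>: integrate the
  tangent inequality at the mean value \<open>T / s\<close>. The exponent \<open>p - 1\<close> of
  \<open>s\<close> is what the missing normalization leaves behind; mass 0 forces
  \<open>T = 0\<close>.\<close>

lemma integral_powr_jensen:
  fixes w h :: "'a \<Rightarrow> real"
  assumes p: "1 \<le> p" and w: "\<And>y. 0 \<le> w y" and h: "\<And>y. 0 \<le> h y"
    and int: "integrable M w" "integrable M (\<lambda>y. w y * h y)" "integrable M (\<lambda>y. w y * h y powr p)"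
    and s: "s = (\<integral>y. w y \<partial>M)"
  shows "(\<integral>y. w y * h y \<partial>M) powr p \<le> s powr (p - 1) * (\<integral>y. w y * h y powr p \<partial>M)"
proof -
  define T where "T = (\<integral>y. w y * h y \<partial>M)"
  have T0: "T \<ge> 0" unfolding T_def using w h by (intro integral_nonneg_AE AE_I2) auto
  have s0: "s \<ge> 0" unfolding s using w by (intro integral_nonneg_AE AE_I2) auto
  have P0: "0 \<le> (\<integral>y. w y * h y powr p \<partial>M)" using w by (intro integral_nonneg_AE AE_I2) auto
  show ?thesis
  proof (cases "T = 0")
    case True
    then show ?thesis using P0 p by (simp add: T_def)
  next
    case False
    have s_pos: "s > 0"
    proof (rule ccontr)
      assume "\<not> s > 0"
      then have "(\<integral>y. w y \<partial>M) = 0" using s0 s by simp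
      then have "AE y in M. w y = 0" using integral_nonneg_eq_0_iff_AE[OF int(1)] w by simp
      then have "AE y in M. w y * h y = 0" by eventually_elim simp
      then have "T = 0" unfolding T_def by (intro integral_eq_zero_AE)
      then show False using False by simp
    qed
    define m where "m = T / s"
    have m: "m > 0" using T0 False s_pos by (simp add: m_def)
    have le: "w y * (m powr p + p * m powr (p - 1) * (h y - m)) \<le> w y * h y powr p" for y
      by (rule mult_left_mono[OF powr_above_tangent_le[OF p m h] w])
    have eq: "w y * (m powr p + p * m powr (p - 1) * (h y - m))
        = (m powr p - p * m powr (p - 1) * m) * w y + (p * m powr (p - 1)) * (w y * h y)" for y
      by (simp add: algebra_simps)
    have "(\<integral>y. w y * (m powr p + p * m powr (p - 1) * (h y - m)) \<partial>M) \<le> (\<integral>y. w y * h y powr p \<partial>M)"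
      unfolding eq using int le[unfolded eq] by (intro integral_mono) auto
    also have "(\<integral>y. w y * (m powr p + p * m powr (p - 1) * (h y - m)) \<partial>M)
        = (m powr p - p * m powr (p - 1) * m) * s + (p * m powr (p - 1)) * T"
      unfolding eq using int by (simp add: s T_def)
    also have "\<dots> = m powr p * s" using s_pos by (simp add: m_def algebra_simps)
    finally have "m powr p * s \<le> (\<integral>y. w y * h y powr p \<partial>M)" .
    moreover have "T powr p = s powr (p - 1) * (m powr p * s)"
    proof -
      have "T = m * s" using s_pos by (simp add: m_def)
      then show ?thesis using s_pos m by (simp add: powr_mult powr_diff)
    qed
    ultimately show ?thesis by (simp add: T_def[symmetric] mult_left_mono)
  qed
qed

text \<open>Jensen's inequality with weight \<open>|f|\<close> bounds the p-th power of the
  convolution pointwise; Fubini and left invariance then evaluate the integral of the bound as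
  \<open>|f|\<close> integrated times \<open>|g|^p\<close> integrated.\<close>

lemma Cc_convolution_nrm:
  assumes p: "1 \<le> p" and f: "f \<in> Cc" and g: "g \<in> Cc"
  shows "Lp_nrm p \<mu> (convolution \<mu> f g) \<le> Lp_nrm 1 \<mu> f * Lp_nrm p \<mu> g"
proof -
  have p0: "p > 0" using p by simp
  define s where "s = (\<integral>y. cmod (f y) \<partial>\<mu>)"
  have s0: "s \<ge> 0" by (simp add: s_def)
  \<comment> \<open>Fubini is at hand for complex kernels that are continuous with compact support,
    so the moduli are read as such functions and the double integral as their convolution.\<close>
  let ?F = "\<lambda>y. complex_of_real (cmod (f y))" and ?G = "\<lambda>y. complex_of_real (cmod (g y) powr p)"
  have FG: "?F \<in> Cc" "?G \<in> Cc" using f g p0 by (auto intro!: Cc_of_real Cc_norm Cc_powr)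
  obtain K L where *: "compact K" "compact L" "continuous_on UNIV (\<lambda>(x, y). ?F y * ?G (- y + x))"
    "\<And>x y. x \<notin> K \<or> y \<notin> L \<Longrightarrow> ?F y * ?G (- y + x) = 0"
    using convolution_kernel[OF FG] by metis
  define I where "I x = (\<integral>y. cmod (f y) * cmod (g (- y + x)) powr p \<partial>\<mu>)" for x
  have I: "convolution \<mu> ?F ?G = (\<lambda>x. complex_of_real (I x))"
    unfolding convolution_def[abs_def] I_def by (simp flip: of_real_mult)
  have "(\<lambda>x. complex_of_real (I x)) \<in> Cc" using Cc_convolution(1)[OF FG] unfolding I .
  then have "integrable \<mu> (\<lambda>x. complex_of_real (I x))" by (rule Cc_integrable)
  then have I_int: "integrable \<mu> I" by (rule complex_of_real_integrable_eq[THEN iffD1])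
  have "complex_of_real (\<integral>x. I x \<partial>\<mu>) = (\<integral>x. convolution \<mu> ?F ?G x \<partial>\<mu>)" by (simp add: I)
  also have "\<dots> = (\<integral>y. (\<integral>x. ?F y * ?G (- y + x) \<partial>\<mu>) \<partial>\<mu>)"
    unfolding convolution_def by (rule Cc_fubini[OF *(3,1,2,4), symmetric])
  also have "\<dots> = (\<integral>y. ?F y * (\<integral>x. ?G x \<partial>\<mu>) \<partial>\<mu>)"
    using integral_add_left[OF Cc_measurable[OF FG(2)]] by simp
  also have "\<dots> = complex_of_real (s * (\<integral>x. cmod (g x) powr p \<partial>\<mu>))" by (simp add: s_def)
  finally have int_I: "(\<integral>x. I x \<partial>\<mu>) = s * (\<integral>x. cmod (g x) powr p \<partial>\<mu>)"
    using of_real_eq_iff by blast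
  have pt: "cmod (convolution \<mu> f g x) powr p \<le> s powr (p - 1) * I x" for x
  proof -
    have 1: "(\<lambda>y. cmod (f y) * cmod (g (- y + x))) \<in> Cc"
      using Cc_norm[OF Cc_convolution(2)[OF f g, of x]] by (simp add: norm_mult)
    have 2: "(\<lambda>y. cmod (f y) * cmod (g (- y + x)) powr p) \<in> Cc"
      using Cc_norm[OF Cc_convolution(2)[OF FG, of x]] by (simp add: norm_mult)
    have "cmod (convolution \<mu> f g x) \<le> (\<integral>y. cmod (f y * g (- y + x)) \<partial>\<mu>)"
      unfolding convolution_def by (rule integral_norm_bound)
    then have "cmod (convolution \<mu> f g x) powr p \<le> (\<integral>y. cmod (f y) * cmod (g (- y + x)) \<partial>\<mu>) powr p"
      using p by (intro powr_mono2) (auto simp: norm_mult)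
    also have "\<dots> \<le> s powr (p - 1) * I x"
      unfolding I_def using Cc_integrable[OF 1] Cc_integrable[OF 2] Cc_integrable[OF Cc_norm[OF f]]
      by (intro integral_powr_jensen[OF p]) (auto simp: s_def)
    finally show ?thesis .
  qed
  show ?thesis
  proof (rule Lp_nrm_leI[OF p0])
    show "0 \<le> Lp_nrm 1 \<mu> f * Lp_nrm p \<mu> g" by simp
    have "(\<integral>x. cmod (convolution \<mu> f g x) powr p \<partial>\<mu>) \<le> (\<integral>x. s powr (p - 1) * I x \<partial>\<mu>)"
      using Cc_integrable[OF Cc_powr[OF Cc_convolution(1)[OF f g] p0]] I_int pt
      by (intro integral_mono) auto
    also have "\<dots> = s powr (p - 1) * s * (\<integral>x. cmod (g x) powr p \<partial>\<mu>)" by (simp add: int_I)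
    also have "s powr (p - 1) * s = s powr p"
      using s0 p by (cases "s = 0") (auto simp: powr_diff)
    also have "s powr p * (\<integral>x. cmod (g x) powr p \<partial>\<mu>) = (Lp_nrm 1 \<mu> f * Lp_nrm p \<mu> g) powr p"
      using s0 p0 by (simp add: powr_mult Lp_nrm_powr Lp_nrm_1 s_def)
    finally show "(\<integral>x. cmod (convolution \<mu> f g x) powr p \<partial>\<mu>)
        \<le> (Lp_nrm 1 \<mu> f * Lp_nrm p \<mu> g) powr p" .
  qed
qed

text \<open>Fubini exchanges the two integrals, and translating \<open>y\<close> by \<open>z\<close>
  on the left turns the inner one into a convolution evaluated at \<open>- z + x\<close>.\<close>

lemma Cc_convolution_assoc:
  assumes f: "f \<in> Cc" and h: "h \<in> Cc" and g: "g \<in> Cc"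
  shows "convolution \<mu> (convolution \<mu> f h) g = convolution \<mu> f (convolution \<mu> h g)"
proof
  fix x
  let ?F = "\<lambda>y z. f z * h (- z + y) * g (- y + x)"
  obtain K L where *: "compact K" "compact L" "continuous_on UNIV (\<lambda>(x, y). f y * h (- y + x))"
    "\<And>x y. x \<notin> K \<or> y \<notin> L \<Longrightarrow> f y * h (- y + x) = 0"
    using convolution_kernel[OF f h] by metis
  have cont: "continuous_on UNIV (\<lambda>(y, z). ?F y z)"
  proof -
    have "continuous_on UNIV (\<lambda>z :: 'g \<times> 'g. g (- fst z + x))"
      by (intro continuous_on_compose_UNIV[OF Cc_continuous[OF g]] continuous_intros)
    from continuous_on_mult[OF *(3) this] show ?thesis by (simp add: split_beta)
  qed
  have "convolution \<mu> (convolution \<mu> f h) g x = (\<integral>y. (\<integral>z. ?F y z \<partial>\<mu>) \<partial>\<mu>)"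
    by (simp add: convolution_def)
  also have "\<dots> = (\<integral>z. (\<integral>y. ?F y z \<partial>\<mu>) \<partial>\<mu>)"
    by (rule Cc_fubini[OF cont *(1,2), symmetric]) (use *(4) in \<open>metis mult_zero_left\<close>)
  also have "\<dots> = (\<integral>z. f z * convolution \<mu> h g (- z + x) \<partial>\<mu>)"
  proof (rule Bochner_Integration.integral_cong[OF refl])
    fix z
    have meas: "(\<lambda>y. h (- z + y) * g (- y + x)) \<in> borel_measurable \<mu>"
      unfolding borel_measurable_eq
      by (intro borel_measurable_continuous_onI continuous_on_mult continuous_intros
          continuous_on_compose_UNIV[OF Cc_continuous[OF g]] continuous_on_compose_UNIV[OF
              Cc_continuous[OF h]])
    have "(\<integral>y. ?F y z \<partial>\<mu>) = f z * (\<integral>y. h (- z + y) * g (- y + x) \<partial>\<mu>)"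
      by (simp add: mult.assoc)
    also have "(\<integral>y. h (- z + y) * g (- y + x) \<partial>\<mu>) = (\<integral>y. h (- z + (z + y)) * g (- (z + y) + x) \<partial>\<mu>)"
      by (rule integral_add_left[OF meas, symmetric])
    also have "\<dots> = convolution \<mu> h g (- z + x)"
      by (simp add: convolution_def minus_add add.assoc[symmetric])
    finally show "(\<integral>y. ?F y z \<partial>\<mu>) = f z * convolution \<mu> h g (- z + x)" .
  qed
  finally show "convolution \<mu> (convolution \<mu> f h) g x = convolution \<mu> f (convolution \<mu> h g) x"
    by (simp add: convolution_def)
qed

section \<open>Inversion and null sets\<close>

lemma Cc_bump:
  fixes K :: "'g set"
  assumes "compact K"
  shows "\<exists>\<phi>\<in>Cc. \<forall>x. 0 \<le> \<phi> x \<and> \<phi> x \<le> (1::real) \<and> (x \<in> K \<longrightarrow> \<phi> x = 1)"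
  by (rule Cc_urysohn[OF assms open_UNIV subset_UNIV]) blast

text \<open>
  Integrating \<open>\<phi> x * \<psi> y * h (- y + x)\<close> in both orders bounds the integral of \<open>h (- y)\<close> over a
  compact set by that of \<open>h\<close>, so that the modular function is not needed.
\<close>

lemma integral_uminus_le:
  fixes C :: "'g set"
  assumes C: "compact C"
  obtains c where "c > 0" "\<And>h. \<lbrakk>h \<in> Cc; \<And>x. 0 \<le> h x\<rbrakk> \<Longrightarrow>
    (\<integral>y. indicator C y * h (- y) \<partial>\<mu>) \<le> c * (\<integral>x. h x \<partial>\<mu> :: real)"
proof -
  have zero: "compact {0 :: 'g}" by simp
  obtain W0 W where W: "open W0" "compact W" "{0 :: 'g} \<subseteq> W0" "W0 \<subseteq> W"
    using compact_nbhd[OF zero] by blast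
  have "emeasure \<mu> W0 > 0" using W by (intro emeasure_open_pos) auto
  also have "emeasure \<mu> W0 \<le> emeasure \<mu> W" using W compact_in_sets[OF W(2)]
      by (intro emeasure_mono) auto
  finally have W_pos: "measure \<mu> W > 0"
    using finite_on_compact[OF W(2)] by (simp add: measure_def enn2real_positive_iff)
  obtain \<phi> where \<phi>: "\<phi> \<in> Cc" "\<And>x. 0 \<le> \<phi> x" "\<And>x. \<phi> x \<le> (1::real)" "\<And>x. x \<in> W \<Longrightarrow> \<phi> x = 1"
    using Cc_bump[OF W(2)] by blast
  \<comment> \<open>Being 1 on \<open>W + C\<close>, it satisfies \<open>\<psi> (x + y) = 1\<close>
    for all \<open>x\<close> in \<open>W\<close> and \<open>y\<close> in \<open>C\<close>.\<close>
  obtain \<psi> where \<psi>: "\<psi> \<in> Cc" "\<And>x. 0 \<le> \<psi> x" "\<And>x. x \<in> {x + y | x y. x \<in> W \<and> y \<in> C} \<Longrightarrow> \<psi> x = (1::real)"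
    using Cc_bump[OF compact_add[OF W(2) C]] by blast
  \<comment> \<open>The double integral is at least \<open>measure \<mu> W\<close> times the
    reflected integral and at most the integral of \<open>\<psi>\<close> times that of
    \<open>h\<close>; adding 1 makes the quotient positive.\<close>
  define c where "c = ((\<integral>y. \<psi> y \<partial>\<mu>) + 1) / measure \<mu> W"
  have \<psi>0: "0 \<le> (\<integral>y. \<psi> y \<partial>\<mu>)" using \<psi>(2) by simp
  show ?thesis
  proof (rule that[of c])
    show "c > 0" using W_pos \<psi>0 by (simp add: c_def)
    fix h :: "'g \<Rightarrow> real" assume h: "h \<in> Cc" "\<And>x. 0 \<le> h x"
    have meas [measurable]: "h \<in> borel_measurable \<mu>" "\<phi> \<in> borel_measurable \<mu>" "\<psi> \<in> borel_measurable
        \<mu>"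
      using h \<phi> \<psi> by (auto intro: Cc_measurable)
    have hm: "(\<lambda>y. h (- y)) \<in> borel_measurable \<mu>"
      unfolding borel_measurable_eq
      by (intro borel_measurable_continuous_onI continuous_on_compose_UNIV[OF Cc_continuous[OF
          h(1)]] continuous_intros)
    have Cs: "C \<in> sets \<mu>" by (rule compact_in_sets[OF C])
    have Ws: "W \<in> sets \<mu>" by (rule compact_in_sets[OF W(2)])
    obtain K where K: "compact K" "\<And>x. x \<notin> K \<Longrightarrow> \<phi> x = 0" using \<phi>(1) by (auto simp: Cc_def)
    obtain L where L: "compact L" "\<And>x. x \<notin> L \<Longrightarrow> \<psi> x = 0" using \<psi>(1) by (auto simp: Cc_def)
    define F where "F x y = complex_of_real (\<phi> x * \<psi> y * h (- y + x))" for x y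
    have cont: "continuous_on UNIV (\<lambda>(x, y). F x y)"
      unfolding F_def split_beta
      by (intro continuous_on_mult continuous_on_of_real continuous_on_compose_UNIV[OF
          Cc_continuous[OF h(1)]]
          continuous_on_compose_UNIV[OF Cc_continuous[OF \<phi>(1)]] continuous_on_compose_UNIV[OF
              Cc_continuous[OF \<psi>(1)]]
          continuous_on_add continuous_on_minus continuous_on_fst continuous_on_snd
              continuous_on_id)
    have out: "\<And>x y. x \<notin> K \<or> y \<notin> L \<Longrightarrow> F x y = 0" using K L by (auto simp: F_def)
    define I where "I = (\<integral>y. indicator C y * h (- y) \<partial>\<mu>)"
    define J where "J x = (\<integral>y. \<psi> y * h (- y + x) \<partial>\<mu>)" for x
    have J_int: "(\<lambda>y. \<psi> y * h (- y + x)) \<in> Cc" for x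
      by (intro Cc_mult \<psi> continuous_on_compose_UNIV[OF Cc_continuous[OF h(1)]] continuous_intros)
    have F_y: "(\<integral>y. F x y \<partial>\<mu>) = complex_of_real (\<phi> x * J x)" for x
      by (simp only: F_def J_def mult.assoc integral_complex_of_real integral_mult_right_zero)
    have F_x: "(\<integral>x. F x y \<partial>\<mu>) = complex_of_real (\<psi> y * (\<integral>x. \<phi> x * h (- y + x) \<partial>\<mu>))" for y
    proof -
      have "F x y = complex_of_real (\<psi> y * (\<phi> x * h (- y + x)))" for x by (simp add: F_def)
      then show ?thesis by (simp only: integral_complex_of_real integral_mult_right_zero)
    qed
    have phiJ: "(\<lambda>x. complex_of_real (\<phi> x * J x)) \<in> Cc"
      using Cc_parameter_integral(1)[OF cont K(1) L(1) out] by (simp only: F_y)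
    \<comment> \<open>Translating \<open>y\<close> by \<open>x\<close> turns
      \<open>h (- y + x)\<close> into \<open>h (- y)\<close>, while \<open>\<psi> (x + y)\<close> is
      1 for \<open>y\<close> in \<open>C\<close>.\<close>
    have J_ge: "I \<le> J x" if x: "x \<in> W" for x
    proof -
      have "J x = (\<integral>y. \<psi> (x + y) * h (- (x + y) + x) \<partial>\<mu>)"
        unfolding J_def by (rule integral_add_left[OF Cc_measurable[OF J_int], symmetric])
      also have "\<dots> = (\<integral>y. \<psi> (x + y) * h (- y) \<partial>\<mu>)" by (simp add: minus_add add.assoc)
      finally have Jx: "J x = (\<integral>y. \<psi> (x + y) * h (- y) \<partial>\<mu>)" .
      have "integrable (distr \<mu> \<mu> ((+) x)) (\<lambda>y. \<psi> y * h (- y + x))"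
        unfolding distr_add_left by (rule Cc_integrable[OF J_int])
      then have "integrable \<mu> (\<lambda>y. \<psi> (x + y) * h (- (x + y) + x))"
        by (rule integrable_distr[OF measurable_add_left])
      then have int: "integrable \<mu> (\<lambda>y. \<psi> (x + y) * h (- y))" by (simp add: minus_add add.assoc)
      have le: "indicator C y * h (- y) \<le> \<psi> (x + y) * h (- y)" for y
      proof (cases "y \<in> C")
        case True
        then have "\<psi> (x + y) = 1" using x by (intro \<psi>(3)) blast
        then show ?thesis using True by simp
      qed (use \<psi>(2) h(2) in simp)
      have int2: "integrable \<mu> (\<lambda>y. indicator C y * h (- y))"
        by (rule Bochner_Integration.integrable_bound[OF int])
          (use le h(2) \<psi>(2) Cs hm in \<open>auto simp: abs_mult\<close>)
      show ?thesis unfolding I_def Jx by (rule integral_mono[OF int2 int le])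
    qed
    have J0: "0 \<le> J x" for x unfolding J_def using \<psi>(2) h(2)
        by (intro integral_nonneg_AE AE_I2) auto
    have "integrable \<mu> (\<lambda>x. complex_of_real (\<phi> x * J x))" by (rule Cc_integrable[OF phiJ])
    then have phiJ_int: "integrable \<mu> (\<lambda>x. \<phi> x * J x)"
        by (rule complex_of_real_integrable_eq[THEN iffD1])
    have "measure \<mu> W * I = (\<integral>x. indicator W x * I \<partial>\<mu>)" using Ws by simp
    also have "\<dots> \<le> (\<integral>x. \<phi> x * J x \<partial>\<mu>)"
    proof (rule integral_mono[OF _ phiJ_int])
      show "integrable \<mu> (\<lambda>x. indicator W x * I)"
        using Ws finite_on_compact[OF W(2)] by (intro integrable_mult_left) auto
      show "indicator W x * I \<le> \<phi> x * J x" for x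
        using J_ge[of x] \<phi>(2,4)[of x] J0[of x] by (auto simp: indicator_def)
    qed
    also have "\<dots> \<le> (\<integral>y. \<psi> y \<partial>\<mu>) * (\<integral>x. h x \<partial>\<mu>)"
    proof -
      \<comment> \<open>Since \<open>\<phi> \<le> 1\<close>, left invariance bounds the inner
        integral by a constant independent of \<open>y\<close>.\<close>
      have inner: "(\<integral>x. \<phi> x * h (- y + x) \<partial>\<mu>) \<le> (\<integral>x. h x \<partial>\<mu>)" for y
      proof -
        have int1: "integrable \<mu> (\<lambda>x. h (- y + x))"
          by (rule integrable_distr[OF measurable_add_left]) (simp add: distr_add_left Cc_integrable
              h(1))
        have "(\<integral>x. \<phi> x * h (- y + x) \<partial>\<mu>) \<le> (\<integral>x. h (- y + x) \<partial>\<mu>)"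
        proof (rule integral_mono[OF _ int1])
          show "integrable \<mu> (\<lambda>x. \<phi> x * h (- y + x))"
            by (intro Cc_integrable Cc_mult \<phi> continuous_on_compose_UNIV[OF Cc_continuous[OF h(1)]]
                continuous_intros)
          show "\<phi> x * h (- y + x) \<le> h (- y + x)" for x
            using mult_right_mono[OF \<phi>(3) h(2)] by simp
        qed
        also have "\<dots> = (\<integral>x. h x \<partial>\<mu>)" by (rule integral_add_left[OF meas(1)])
        finally show ?thesis .
      qed
      have "complex_of_real (\<integral>x. \<phi> x * J x \<partial>\<mu>) = (\<integral>x. (\<integral>y. F x y \<partial>\<mu>) \<partial>\<mu>)"
        by (simp only: F_y integral_complex_of_real)
      also have "\<dots> = (\<integral>y. (\<integral>x. F x y \<partial>\<mu>) \<partial>\<mu>)" by (rule Cc_fubini[OF cont K(1) L(1) out, symmetric])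
      also have "\<dots> = complex_of_real (\<integral>y. \<psi> y * (\<integral>x. \<phi> x * h (- y + x) \<partial>\<mu>) \<partial>\<mu>)"
        by (simp only: F_x integral_complex_of_real)
      finally have "(\<integral>x. \<phi> x * J x \<partial>\<mu>) = (\<integral>y. \<psi> y * (\<integral>x. \<phi> x * h (- y + x) \<partial>\<mu>) \<partial>\<mu>)"
        using of_real_eq_iff by blast
      also have "\<dots> \<le> (\<integral>y. \<psi> y * (\<integral>x. h x \<partial>\<mu>) \<partial>\<mu>)"
      proof (rule integral_mono)
        have cont': "continuous_on UNIV (\<lambda>(y, x). F x y)"
          using continuous_on_compose_UNIV[OF cont, of "\<lambda>z. (snd z, fst z)"]
          by (simp add: split_beta continuous_on_Pair continuous_on_fst continuous_on_snd
              continuous_on_id)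
        have "(\<lambda>y. \<integral>x. F x y \<partial>\<mu>) \<in> Cc"
          by (rule Cc_parameter_integral(1)[OF cont' L(1) K(1)]) (use out in auto)
        then have "integrable \<mu> (\<lambda>y. complex_of_real (\<psi> y * (\<integral>x. \<phi> x * h (- y + x) \<partial>\<mu>)))"
          unfolding F_x by (rule Cc_integrable)
        then show "integrable \<mu> (\<lambda>y. \<psi> y * (\<integral>x. \<phi> x * h (- y + x) \<partial>\<mu>))"
          by (rule complex_of_real_integrable_eq[THEN iffD1])
        show "integrable \<mu> (\<lambda>y. \<psi> y * (\<integral>x. h x \<partial>\<mu>))"
          by (intro integrable_mult_left Cc_integrable \<psi>)
        show "\<psi> y * (\<integral>x. \<phi> x * h (- y + x) \<partial>\<mu>) \<le> \<psi> y * (\<integral>x. h x \<partial>\<mu>)" for y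
          using inner \<psi>(2) by (rule mult_left_mono)
      qed
      finally show ?thesis by simp
    qed
    finally have "measure \<mu> W * I \<le> (\<integral>y. \<psi> y \<partial>\<mu>) * (\<integral>x. h x \<partial>\<mu>)" .
    also have "\<dots> \<le> ((\<integral>y. \<psi> y \<partial>\<mu>) + 1) * (\<integral>x. h x \<partial>\<mu>)"
      using h(2) by (intro mult_right_mono) auto
    finally show "(\<integral>y. indicator C y * h (- y) \<partial>\<mu>) \<le> c * (\<integral>x. h x \<partial>\<mu>)"
      using W_pos by (simp add: c_def I_def pos_le_divide_eq mult.commute)
  qed
qed

text \<open>\<open>N\<close> is covered by open sets of small measure, and the preceding bound
  controls their reflections. Its constant depends on a compact set, hence the intersection with
  \<open>C\<close>; the open set \<open>O'\<close> between \<open>C\<close> and \<open>C'\<close> is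
  there because inner regularity needs an open set.\<close>

lemma null_set_uminus_locally:
  assumes N: "N \<in> null_sets \<mu>" and C: "compact C"
  shows "uminus ` N \<inter> C \<in> null_sets \<mu>"
proof -
  obtain O' C' where O: "open O'" "compact C'" "C \<subseteq> O'" "O' \<subseteq> C'" using compact_nbhd[OF C] by blast
  obtain c where c: "c > 0" "\<And>h. \<lbrakk>h \<in> Cc; \<And>x. 0 \<le> h x\<rbrakk> \<Longrightarrow>
    (\<integral>y. indicator C' y * h (- y) \<partial>\<mu>) \<le> c * (\<integral>x. h x \<partial>\<mu> :: real)"
    by (rule integral_uminus_le[OF O(2)]) blast
  have open_uminus: "open (uminus ` U)" if "open U" for U :: "'g set"
    unfolding uminus_image_eq using that by (intro open_vimage continuous_intros)
  \<comment> \<open>A compact \<open>K\<close> inside the reflected \<open>U\<close> and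
    \<open>O'\<close> is measured by a cutoff function \<open>h\<close> that is 1 on
    \<open>- K\<close> and vanishes off \<open>U\<close>; inner regularity passes from such
    \<open>K\<close> to the open set.\<close>
  have op: "emeasure \<mu> (uminus ` U \<inter> O') \<le> ennreal (c * u)"
    if U: "open U" and u: "emeasure \<mu> U = ennreal u" "u \<ge> 0" for U u
  proof -
    have oU: "open (uminus ` U \<inter> O')" using open_uminus[OF U] O(1) by blast
    have "emeasure \<mu> K \<le> ennreal (c * u)" if K: "compact K" "K \<subseteq> uminus ` U \<inter> O'" for K
    proof -
      have K': "compact (uminus ` K)"
        using K(1) by (intro compact_continuous_image continuous_intros)
      have KU: "uminus ` K \<subseteq> U" using K(2) by (auto simp: uminus_image_eq)
      obtain h where h: "h \<in> Cc" "\<And>x. 0 \<le> h x" "\<And>x. h x \<le> (1::real)"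
        "\<And>x. x \<in> uminus ` K \<Longrightarrow> h x = 1" "\<And>x. x \<notin> U \<Longrightarrow> h x = 0"
        using Cc_urysohn[OF K' U KU] by blast
      have hm: "(\<lambda>y. h (- y)) \<in> borel_measurable \<mu>"
        unfolding borel_measurable_eq
        by (intro borel_measurable_continuous_onI continuous_on_compose_UNIV[OF Cc_continuous[OF
            h(1)]] continuous_intros)
      have C's: "C' \<in> sets \<mu>" by (rule compact_in_sets[OF O(2)])
      have Us: "U \<in> sets \<mu>" using U by (simp add: sets_eq_borel)
      have Ks: "K \<in> sets \<mu>" by (rule compact_in_sets[OF K(1)])
      have K_fin: "emeasure \<mu> K < \<infinity>" by (rule finite_on_compact[OF K(1)])
      have "measure \<mu> K = (\<integral>y. indicator K y \<partial>\<mu>)" using Ks by simp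
      also have "\<dots> \<le> (\<integral>y. indicator C' y * h (- y) \<partial>\<mu>)"
      proof (rule integral_mono)
        show "integrable \<mu> (indicator K :: _ \<Rightarrow> real)" using Ks K_fin by simp
        show "integrable \<mu> (\<lambda>y. indicator C' y * h (- y))"
          using C's hm h(2,3)
          by (intro integral_supported_le(1)[OF O(2), where B = 1]) (auto simp: indicator_def)
        show "indicator K y \<le> indicator C' y * h (- y)" for y
          using K(2) O(4) h(2)[of "- y"] h(4)[of "- y"] by (auto simp: indicator_def)
      qed
      also have "\<dots> \<le> c * (\<integral>x. h x \<partial>\<mu>)" by (rule c(2)[OF h(1,2)])
      also have "(\<integral>x. h x \<partial>\<mu>) \<le> (\<integral>x. indicator U x \<partial>\<mu>)"
        proof (rule integral_mono[OF Cc_integrable[OF h(1)]])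
          show "integrable \<mu> (indicator U :: _ \<Rightarrow> real)" using Us u by simp
          show "h x \<le> indicator U x" for x using h(3,5) by (auto simp: indicator_def)
        qed
      also have "(\<integral>x. indicator U x \<partial>\<mu>) = u" using Us u by (simp add: measure_def)
      finally have "measure \<mu> K \<le> c * u" using c(1) by simp
      then show ?thesis using K_fin
          by (simp add: emeasure_eq_ennreal_measure less_top[symmetric] ennreal_leI)
    qed
    then show ?thesis unfolding inner_regular[OF oU] by (intro SUP_least) auto
  qed
  have Nb: "N \<in> sets borel" "emeasure \<mu> N = 0" using N by (auto simp: null_sets_def sets_eq_borel)
  have uN: "uminus ` N \<inter> C \<in> sets \<mu>"
  proof -
    have "uminus -` N \<inter> space borel \<in> sets borel"
      by (rule measurable_sets[OF _ Nb(1)]) (intro borel_measurable_continuous_onI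
          continuous_intros)
    then show ?thesis using compact_in_sets[OF C] by (simp add: uminus_image_eq sets_eq_borel)
  qed
  have small: "emeasure \<mu> (uminus ` N \<inter> C) \<le> ennreal e" if e: "e > 0" for e
  proof -
    have "(INF U\<in>{U. open U \<and> N \<subseteq> U}. emeasure \<mu> U) < ennreal (e / c)"
      using outer_regular[OF Nb(1)] Nb(2) e c(1) by simp
    then obtain U where U: "open U" "N \<subseteq> U" "emeasure \<mu> U < ennreal (e / c)"
        by (auto simp: INF_less_iff)
    obtain u where u: "0 \<le> u" "emeasure \<mu> U = ennreal u"
      using U(3) by (cases "emeasure \<mu> U") auto
    have "emeasure \<mu> (uminus ` N \<inter> C) \<le> emeasure \<mu> (uminus ` U \<inter> O')"
      using U(2) O(1,3) open_uminus[OF U(1)] by (intro emeasure_mono) (auto simp: sets_eq_borel)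
    also have "\<dots> \<le> ennreal (c * u)" by (rule op[OF U(1) u(2,1)])
    also have "\<dots> \<le> ennreal e"
      using U(3) u c(1) by (intro ennreal_leI) (simp add: ennreal_less_iff pos_less_divide_eq
          mult.commute)
    finally show ?thesis .
  qed
  have "emeasure \<mu> (uminus ` N \<inter> C) \<le> 0"
    by (rule ennreal_le_epsilon) (simp add: small)
  then show ?thesis using uN by (simp add: null_sets_def)
qed


text \<open>As \<open>- y + x = - (- x + y)\<close>, the map is a left translation followed by
  inversion, so left invariance and the local result on inverted null sets suffice. The compact set
  is moved along by \<open>- x\<close>.\<close>

lemma AE_translate_inverse_locally:
  assumes P: "AE z in \<mu>. P z" and C: "compact C"
  shows "AE y in \<mu>. y \<in> C \<longrightarrow> P (- y + x)"
proof -
  obtain N where N: "N \<in> null_sets \<mu>" "{z \<in> space \<mu>. \<not> P z} \<subseteq> N"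
    using P by (auto simp: eventually_ae_filter)
  define M where "M = uminus ` N \<inter> (+) (- x) ` C"
  have "compact ((+) (- x) ` C)" using C by (intro compact_continuous_image continuous_intros)
  then have M: "M \<in> null_sets \<mu>" unfolding M_def by (rule null_set_uminus_locally[OF N(1)])
  then have Mb: "M \<in> sets borel" by (simp add: null_sets_def sets_eq_borel)
  have "(+) (- x) -` M \<inter> space borel \<in> sets borel"
    by (rule measurable_sets[OF _ Mb]) (intro borel_measurable_continuous_onI continuous_intros)
  then have xM: "(+) x ` M \<in> null_sets \<mu>"
    using M Mb by (simp add: null_sets_def sets_eq_borel left_invariant) (simp add:
        image_add_left_eq)
  show ?thesis
  proof (rule AE_I'[OF xM], rule subsetI)
    fix y assume "y \<in> {y \<in> space \<mu>. \<not> (y \<in> C \<longrightarrow> P (- y + x))}"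
    then have y: "y \<in> C" "\<not> P (- y + x)" by auto
    then have "- y + x \<in> N" using N(2) by auto
    then have "- x + y \<in> M"
      using y(1) by (auto simp: M_def minus_add intro!: image_eqI[of _ uminus "- y + x"])
    then show "y \<in> (+) x ` M" by (intro image_eqI[of _ _ "- x + y"]) (simp_all flip: add.assoc)
  qed
qed

section \<open>Convolution of general functions\<close>

lemma measurable_translate_inverse:
  "(g :: 'g \<Rightarrow> 'b::topological_space) \<in> borel_measurable \<mu> \<Longrightarrow> (\<lambda>y. g (- y + x)) \<in> borel_measurable \<mu>"
proof (erule measurable_compose[rotated])
  show "(\<lambda>y. - y + x) \<in> measurable \<mu> \<mu>"
    unfolding measurable_cong_sets[OF sets_eq_borel sets_eq_borel]
    by (intro borel_measurable_continuous_onI continuous_intros)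
qed

text \<open>
  Functions in \<open>L\<^sup>1\<close> and \<open>L\<^sup>p\<close> are sums of absolutely convergent series of continuous functions with
  compact support, which reduces everything to the latter without measurability of
  \<open>(x, y) \<mapsto> f y * g (- y + x)\<close> on the product.
\<close>

lemma convolution_approx:
  assumes p: "1 \<le> p" and f: "f \<in> Lp_functions 1 \<mu>" and g: "g \<in> Lp_functions p \<mu>"
  obtains \<Phi> \<Gamma> :: "nat \<Rightarrow> 'g \<Rightarrow> complex" where "\<And>N. \<Phi> N \<in> Cc" "\<And>N. \<Gamma> N \<in> Cc"
    "(\<lambda>N. Lp_nrm 1 \<mu> (\<lambda>x. f x - \<Phi> N x)) \<longlonglongrightarrow> 0" "(\<lambda>N. Lp_nrm p \<mu> (\<lambda>x. g x - \<Gamma> N x)) \<longlonglongrightarrow> 0"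
    "AE x in \<mu>. integrable \<mu> (\<lambda>y. f y * g (- y + x)) \<and>
      (\<lambda>N. convolution \<mu> (\<Phi> N) (\<Gamma> N) x) \<longlonglongrightarrow> convolution \<mu> f g x"
proof -
  have p0: "p > 0" using p by simp
  obtain \<phi> :: "nat \<Rightarrow> 'g \<Rightarrow> complex" where \<phi>: "\<And>n. \<phi> n \<in> Cc" "summable (\<lambda>n. Lp_nrm 1 \<mu> (\<phi> n))"
    "AE x in \<mu>. summable (\<lambda>n. cmod (\<phi> n x))" "AE x in \<mu>. (\<lambda>n. \<phi> n x) sums f x"
    "(\<lambda>N. Lp_nrm 1 \<mu> (\<lambda>x. f x - (\<Sum>n<N. \<phi> n x))) \<longlonglongrightarrow> 0"
    by (rule Cc_series[OF order_refl f]) (rule that)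
  obtain \<gamma> :: "nat \<Rightarrow> 'g \<Rightarrow> complex" where \<gamma>: "\<And>n. \<gamma> n \<in> Cc" "summable (\<lambda>n. Lp_nrm p \<mu> (\<gamma> n))"
    "AE x in \<mu>. summable (\<lambda>n. cmod (\<gamma> n x))" "AE x in \<mu>. (\<lambda>n. \<gamma> n x) sums g x"
    "(\<lambda>N. Lp_nrm p \<mu> (\<lambda>x. g x - (\<Sum>n<N. \<gamma> n x))) \<longlonglongrightarrow> 0"
    by (rule Cc_series[OF p g]) (rule that)
  define \<Phi> where "\<Phi> N x = (\<Sum>n<N. \<phi> n x)" for N x
  define \<Gamma> where "\<Gamma> N x = (\<Sum>n<N. \<gamma> n x)" for N x
  have Cc: "\<Phi> N \<in> Cc" "\<Gamma> N \<in> Cc" for N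
    unfolding \<Phi>_def[abs_def] \<Gamma>_def[abs_def] using \<phi>(1) \<gamma>(1) by (auto intro: Cc_sum)
  define F where "F N x = (\<Sum>n<N. cmod (\<phi> n x))" for N x
  define G where "G N x = (\<Sum>n<N. cmod (\<gamma> n x))" for N x
  have FG_Cc: "F N \<in> Cc" "G N \<in> Cc" for N
    unfolding F_def[abs_def] G_def[abs_def] using \<phi>(1) \<gamma>(1) by (auto intro!: Cc_sum Cc_norm)
  have FG_nn: "0 \<le> F N x" "0 \<le> G N x" for N x by (auto simp: F_def G_def sum_nonneg)
  have FG_mono: "F m x \<le> F n x" "G m x \<le> G n x" if "m \<le> n" for m n x
    unfolding F_def G_def using that by (auto intro!: sum_mono2)
  let ?cF = "\<lambda>N x. complex_of_real (F N x)" and ?cG = "\<lambda>N x. complex_of_real (G N x)"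
  have cFG: "?cF N \<in> Cc" "?cG N \<in> Cc" for N using FG_Cc by (auto intro: Cc_of_real)
  \<comment> \<open>The convolution of two increasing majorants. Its L^p norm is at most the product
    of the two sums of norms, so \<open>T N x\<close> stays bounded in \<open>N\<close> for almost
    every \<open>x\<close>.\<close>
  define T where "T N x = (\<integral>y. F N y * G N (- y + x) \<partial>\<mu>)" for N x
  have int_T: "integrable \<mu> (\<lambda>y. F N y * G N (- y + x))" for N x
  proof (rule complex_of_real_integrable_eq[THEN iffD1])
    show "integrable \<mu> (\<lambda>y. complex_of_real (F N y * G N (- y + x)))"
      using Cc_integrable[OF Cc_convolution(2)[OF cFG]] by simp
  qed
  have T_conv: "convolution \<mu> (?cF N) (?cG N) = (\<lambda>x. complex_of_real (T N x))" for N
    unfolding convolution_def[abs_def] T_def by (simp flip: of_real_mult)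
  have "AE x in \<mu>. \<exists>C. \<forall>N. T N x \<le> C"
  proof (rule Lp_bounded_incseq[OF p0])
    show "(\<lambda>x. complex_of_real (T N x)) \<in> Lp_functions p \<mu>" for N
      unfolding T_conv[symmetric] by (intro Cc_Lp Cc_convolution cFG p0)
    show "0 \<le> T N x" for N x
      unfolding T_def using FG_nn by (intro integral_nonneg_AE AE_I2) auto
    show "incseq (\<lambda>N. T N x)" for x
      unfolding incseq_def T_def using FG_mono FG_nn
      by (intro allI impI integral_mono int_T mult_mono) auto
    show "Lp_nrm p \<mu> (\<lambda>x. complex_of_real (T N x))
        \<le> (\<Sum>n. Lp_nrm 1 \<mu> (\<phi> n)) * (\<Sum>n. Lp_nrm p \<mu> (\<gamma> n))" for N
    proof -
      have sum_le: "Lp_nrm q \<mu> (\<lambda>x. complex_of_real (\<Sum>n<N. cmod (\<xi> n x))) \<le> (\<Sum>n. Lp_nrm q \<mu> (\<xi> n))"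
        if q: "1 \<le> q" and \<xi>: "\<And>n. \<xi> n \<in> Cc" and "summable (\<lambda>n. Lp_nrm q \<mu> (\<xi> n))" for q \<xi>
      proof -
        have "Lp_nrm q \<mu> (\<lambda>x. \<Sum>n<N. complex_of_real (cmod (\<xi> n x)))
            \<le> (\<Sum>n<N. Lp_nrm q \<mu> (\<lambda>x. complex_of_real (cmod (\<xi> n x))))"
          using q by (intro Lp_nrm_sum Cc_Lp Cc_of_real Cc_norm \<xi>) auto
        also have "\<dots> = (\<Sum>n<N. Lp_nrm q \<mu> (\<xi> n))" by (simp only: Lp_nrm_norm)
        also have "\<dots> \<le> (\<Sum>n. Lp_nrm q \<mu> (\<xi> n))" using that by (intro sum_le_suminf) auto
        finally show ?thesis by simp
      qed
      have "Lp_nrm p \<mu> (convolution \<mu> (?cF N) (?cG N)) \<le> Lp_nrm 1 \<mu> (?cF N) * Lp_nrm p \<mu> (?cG N)"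
        by (rule Cc_convolution_nrm[OF p cFG])
      also have "\<dots> \<le> (\<Sum>n. Lp_nrm 1 \<mu> (\<phi> n)) * (\<Sum>n. Lp_nrm p \<mu> (\<gamma> n))"
        using sum_le[OF order_refl \<phi>(1,2)] sum_le[OF p \<gamma>(1,2)] \<phi>(2)
        by (intro mult_mono suminf_nonneg) (auto simp: F_def G_def)
      finally show ?thesis unfolding T_conv .
    qed
  qed
  then have "AE x in \<mu>. integrable \<mu> (\<lambda>y. f y * g (- y + x)) \<and>
      (\<lambda>N. convolution \<mu> (\<Phi> N) (\<Gamma> N) x) \<longlonglongrightarrow> convolution \<mu> f g x"
  proof eventually_elim
    case (elim x)
    \<comment> \<open>Almost everywhere statements pass through \<open>y \<mapsto> - y + x\<close>
      on compact sets. Countably many of these contain the supports of all \<open>\<phi> n\<close>;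
      at any other \<open>y\<close> every product vanishes, whether or not the series of the
      \<open>\<gamma> n\<close> converges.\<close>
    have "\<exists>K. \<forall>n. compact (K n) \<and> (\<forall>y. y \<notin> K n \<longrightarrow> \<phi> n y = 0)"
      using \<phi>(1) by (intro choice) (auto simp: Cc_def)
    then obtain K where K: "\<And>n. compact (K n)" "\<And>n y. y \<notin> K n \<Longrightarrow> \<phi> n y = 0" by metis
    have "AE z in \<mu>. summable (\<lambda>n. cmod (\<gamma> n z)) \<and> (\<lambda>n. \<gamma> n z) sums g z"
      using \<gamma>(3,4) by eventually_elim simp
    then have "AE y in \<mu>. \<forall>n. y \<in> K n \<longrightarrow> summable (\<lambda>n. cmod (\<gamma> n (- y + x))) \<and> (\<lambda>n. \<gamma> n (- y
        + x)) sums g (- y + x)"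
      unfolding AE_all_countable by (intro allI AE_translate_inverse_locally K)
    with \<phi>(3,4) have ae: "AE y in \<mu>. summable (\<lambda>n. cmod (\<phi> n y)) \<and> (\<lambda>n. \<phi> n y) sums f y \<and>
      ((\<forall>n. \<phi> n y = 0) \<or> summable (\<lambda>n. cmod (\<gamma> n (- y + x))) \<and> (\<lambda>n. \<gamma> n (- y + x)) sums g (- y
          + x))"
      by eventually_elim (use K(2) in blast)
    \<comment> \<open>The limit of the increasing majorants dominates every product
      \<open>\<Phi> N y * \<Gamma> N (- y + x)\<close>, and the bound on \<open>T N x\<close> makes
      it integrable.\<close>
    define w where "w y = lim (\<lambda>N. F N y * G N (- y + x))" for y
    have w_lim: "AE y in \<mu>. (\<lambda>N. F N y * G N (- y + x)) \<longlonglongrightarrow> w y"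
      using ae
    proof eventually_elim
      case (elim y)
      have "convergent (\<lambda>N. F N y * G N (- y + x))"
      proof (cases "\<forall>n. \<phi> n y = 0")
        case True
        then show ?thesis by (simp add: F_def convergent_const)
      next
        case False
        then show ?thesis using elim unfolding F_def G_def
          by (intro convergent_mult) (auto simp: summable_iff_convergent)
      qed
      then show ?case unfolding w_def by (simp add: convergent_LIMSEQ_iff)
    qed
    have meas_FG: "(\<lambda>y. F N y * G N (- y + x)) \<in> borel_measurable \<mu>" for N
      using int_T[of N x] by auto
    have w_meas: "w \<in> borel_measurable \<mu>"
      unfolding w_def by (rule borel_measurable_lim_metric[OF meas_FG])
    have FG_incseq: "mono (\<lambda>N. F N y * G N (- y + x))" for y
      unfolding mono_def using FG_mono FG_nn by (auto intro!: mult_mono)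
    have w_int: "integrable \<mu> w"
    proof -
      obtain C where C: "\<And>N. T N x \<le> C" using elim by blast
      have "incseq (\<lambda>N. T N x)"
        unfolding incseq_def T_def using FG_incseq
        by (intro allI impI integral_mono int_T) (auto simp: mono_def)
      then obtain l where "(\<lambda>N. T N x) \<longlonglongrightarrow> l" using incseq_convergent[of "\<lambda>N. T N x" C] C by metis
      then show ?thesis
        using int_T FG_incseq w_lim w_meas unfolding T_def
        by (intro integrable_monotone_convergence[of \<mu> "\<lambda>N y. F N y * G N (- y + x)" w l]) auto
    qed
    have fg_meas: "(\<lambda>y. f y * g (- y + x)) \<in> borel_measurable \<mu>"
      using Lp_functionsD(1)[OF f] measurable_translate_inverse[OF Lp_functionsD(1)[OF g], of x]
          by simp
    have PG_meas: "(\<lambda>y. \<Phi> N y * \<Gamma> N (- y + x)) \<in> borel_measurable \<mu>" for N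
      by (rule Cc_measurable[OF Cc_convolution(2)[OF Cc]])
    have lim: "AE y in \<mu>. (\<lambda>N. \<Phi> N y * \<Gamma> N (- y + x)) \<longlonglongrightarrow> f y * g (- y + x)"
      using ae
    proof eventually_elim
      case (elim y)
      show ?case
      proof (cases "\<forall>n. \<phi> n y = 0")
        case True
        then have "(\<lambda>n. 0) sums f y" using elim by simp
        then have "f y = 0" using sums_unique2 sums_zero by blast
        then show ?thesis using True by (simp add: \<Phi>_def)
      next
        case False
        then show ?thesis using elim unfolding \<Phi>_def \<Gamma>_def
          by (intro tendsto_mult) (auto simp: sums_def)
      qed
    qed
    have bound: "AE y in \<mu>. norm (\<Phi> N y * \<Gamma> N (- y + x)) \<le> w y" for N
      using w_lim
    proof eventually_elim
      case (elim y)
      have "norm (\<Phi> N y * \<Gamma> N (- y + x)) \<le> F N y * G N (- y + x)"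
        unfolding norm_mult \<Phi>_def \<Gamma>_def F_def G_def by (intro mult_mono norm_sum sum_nonneg) auto
      also have "\<dots> \<le> w y" using FG_incseq elim by (intro incseq_le) auto
      finally show ?case .
    qed
    show ?case
      using integrable_dominated_convergence[OF fg_meas PG_meas w_int lim bound]
        integral_dominated_convergence[OF fg_meas PG_meas w_int lim bound]
      by (simp add: convolution_def)
  qed
  then show ?thesis
    using that[of \<Phi> \<Gamma>, OF Cc] \<phi>(5) \<gamma>(5) by (simp add: \<Phi>_def \<Gamma>_def)
qed

text \<open>Young's inequality passes from compactly supported functions to the limit by Fatou's
  lemma. The convolution is known only as an almost everywhere limit, so \<open>h\<close> serves as
  a measurable version of it.\<close>

lemma
  assumes p: "1 \<le> p" and f: "f \<in> Lp_functions 1 \<mu>" and g: "g \<in> Lp_functions p \<mu>"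
  shows convolution_integrable: "AE x in \<mu>. integrable \<mu> (\<lambda>y. f y * g (- y + x))"
    and convolution_Lp: "\<exists>h\<in>Lp_functions p \<mu>. (AE x in \<mu>. convolution \<mu> f g x = h x) \<and>
      Lp_nrm p \<mu> h \<le> Lp_nrm 1 \<mu> f * Lp_nrm p \<mu> g"
proof -
  have p0: "p > 0" using p by simp
  obtain \<Phi> \<Gamma> :: "nat \<Rightarrow> 'g \<Rightarrow> complex" where Cc: "\<And>N. \<Phi> N \<in> Cc" "\<And>N. \<Gamma> N \<in> Cc"
    and lim: "(\<lambda>N. Lp_nrm 1 \<mu> (\<lambda>x. f x - \<Phi> N x)) \<longlonglongrightarrow> 0" "(\<lambda>N. Lp_nrm p \<mu> (\<lambda>x. g x - \<Gamma> N x)) \<longlonglongrightarrow> 0"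
    and ae: "AE x in \<mu>. integrable \<mu> (\<lambda>y. f y * g (- y + x)) \<and>
      (\<lambda>N. convolution \<mu> (\<Phi> N) (\<Gamma> N) x) \<longlonglongrightarrow> convolution \<mu> f g x"
    by (rule convolution_approx[OF assms]) (rule that)
  show "AE x in \<mu>. integrable \<mu> (\<lambda>y. f y * g (- y + x))" using ae by eventually_elim simp
  define h where "h x = lim (\<lambda>N. convolution \<mu> (\<Phi> N) (\<Gamma> N) x)" for x
  have conv_Lp: "convolution \<mu> (\<Phi> N) (\<Gamma> N) \<in> Lp_functions p \<mu>" for N
    by (intro Cc_Lp Cc_convolution Cc p0)
  have h_meas: "h \<in> borel_measurable \<mu>"
    unfolding h_def by (rule borel_measurable_lim_metric) (use conv_Lp in auto)
  have h_lim: "AE x in \<mu>. (\<lambda>N. convolution \<mu> (\<Phi> N) (\<Gamma> N) x) \<longlonglongrightarrow> h x"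
    using ae by eventually_elim (auto simp: h_def convergent_LIMSEQ_iff[symmetric] convergent_def)
  have eq: "AE x in \<mu>. convolution \<mu> f g x = h x"
    using ae h_lim by eventually_elim (use LIMSEQ_unique in blast)
  have bd: "Lp_nrm p \<mu> (convolution \<mu> (\<Phi> N) (\<Gamma> N))
      \<le> (Lp_nrm 1 \<mu> f + Lp_nrm 1 \<mu> (\<lambda>x. f x - \<Phi> N x)) * (Lp_nrm p \<mu> g
          + Lp_nrm p \<mu> (\<lambda>x. g x - \<Gamma> N x))" for N
  proof -
    have "Lp_nrm 1 \<mu> (\<Phi> N) \<le> Lp_nrm 1 \<mu> f + Lp_nrm 1 \<mu> (\<lambda>x. f x - \<Phi> N x)"
      using Lp_nrm_diff_le[OF _ f Lp_functions_diff[OF _ f Cc_Lp[OF Cc(1)]], of N] by simp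
    moreover have "Lp_nrm p \<mu> (\<Gamma> N) \<le> Lp_nrm p \<mu> g + Lp_nrm p \<mu> (\<lambda>x. g x - \<Gamma> N x)"
      using Lp_nrm_diff_le[OF p g Lp_functions_diff[OF p g Cc_Lp[OF Cc(2) p0]], of N] by simp
    ultimately show ?thesis
      using Cc_convolution_nrm[OF p Cc, of N N]
          by (meson Lp_nrm_nonneg add_nonneg_nonneg mult_mono order_trans)
  qed
  have lim_bd: "(\<lambda>N. (Lp_nrm 1 \<mu> f + Lp_nrm 1 \<mu> (\<lambda>x. f x - \<Phi> N x)) * (Lp_nrm p \<mu> g
      + Lp_nrm p \<mu> (\<lambda>x. g x - \<Gamma> N x)))
      \<longlonglongrightarrow> (Lp_nrm 1 \<mu> f + 0) * (Lp_nrm p \<mu> g + 0)"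
    by (intro tendsto_intros lim)
  have fatou: "h \<in> Lp_functions p \<mu> \<and> Lp_nrm p \<mu> h \<le> Lp_nrm 1 \<mu> f * Lp_nrm p \<mu> g + e" if "e > 0"
      for e
  proof -
    have "\<forall>\<^sub>F N in sequentially.
        (Lp_nrm 1 \<mu> f + Lp_nrm 1 \<mu> (\<lambda>x. f x - \<Phi> N x)) * (Lp_nrm p \<mu> g
            + Lp_nrm p \<mu> (\<lambda>x. g x - \<Gamma> N x))
        < Lp_nrm 1 \<mu> f * Lp_nrm p \<mu> g + e"
      using that by (intro order_tendstoD(2)[OF lim_bd]) simp
    then have "\<forall>\<^sub>F N in sequentially. Lp_nrm p \<mu> (convolution \<mu> (\<Phi> N) (\<Gamma> N))
        \<le> Lp_nrm 1 \<mu> f * Lp_nrm p \<mu> g + e"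
      by eventually_elim (rule order_trans[OF bd less_imp_le])
    then obtain N0 where
      N0: "\<And>N. N \<ge> N0 \<Longrightarrow> Lp_nrm p \<mu> (convolution \<mu> (\<Phi> N) (\<Gamma> N)) \<le> Lp_nrm 1 \<mu> f * Lp_nrm p \<mu> g + e"
      unfolding eventually_sequentially by blast
    \<comment> \<open>The bound with \<open>e\<close> holds from \<open>N0\<close> on, so the
      sequence is shifted before Fatou's lemma is applied.\<close>
    have "AE x in \<mu>. (\<lambda>N. convolution \<mu> (\<Phi> (N + N0)) (\<Gamma> (N + N0)) x) \<longlonglongrightarrow> h x"
      using h_lim by eventually_elim (rule LIMSEQ_ignore_initial_segment)
    from Lp_nrm_fatou[OF p0 conv_Lp h_meas this N0] show ?thesis by simp
  qed
  have "Lp_nrm p \<mu> h \<le> Lp_nrm 1 \<mu> f * Lp_nrm p \<mu> g"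
    by (rule field_le_epsilon) (use fatou in blast)
  then show "\<exists>h\<in>Lp_functions p \<mu>. (AE x in \<mu>. convolution \<mu> f g x = h x) \<and>
      Lp_nrm p \<mu> h \<le> Lp_nrm 1 \<mu> f * Lp_nrm p \<mu> g"
    using fatou[of 1] eq by (intro bexI[of _ h]) auto
qed


section \<open>Bilinearity, passage to classes and associativity\<close>

lemma convolution_add_left:
  assumes p: "1 \<le> p" and f: "f \<in> Lp_functions 1 \<mu>" and f': "f' \<in> Lp_functions 1 \<mu>"
      and g: "g \<in> Lp_functions p \<mu>"
  shows "AE x in \<mu>. convolution \<mu> (\<lambda>x. f x + f' x) g x = convolution \<mu> f g x + convolution \<mu> f' g x"
  using convolution_integrable[OF p f g] convolution_integrable[OF p f' g]
  by eventually_elim (simp add: convolution_def distrib_right)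

lemma convolution_add_right:
  assumes p: "1 \<le> p" and f: "f \<in> Lp_functions 1 \<mu>" and g: "g \<in> Lp_functions p \<mu>"
      and g': "g' \<in> Lp_functions p \<mu>"
  shows "AE x in \<mu>. convolution \<mu> f (\<lambda>x. g x + g' x) x = convolution \<mu> f g x + convolution \<mu> f g' x"
  using convolution_integrable[OF p f g] convolution_integrable[OF p f g']
  by eventually_elim (simp add: convolution_def distrib_left)

lemma convolution_cmult_left: "convolution \<mu> (\<lambda>x. c * f x) g = (\<lambda>x. c * convolution \<mu> f g x)"
  by (simp add: convolution_def mult.assoc fun_eq_iff)

lemma convolution_cmult_right: "convolution \<mu> f (\<lambda>x. c * g x) = (\<lambda>x. c * convolution \<mu> f g x)"
  by (simp add: convolution_def mult.left_commute fun_eq_iff)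

text \<open>Changing \<open>f\<close> on a null set leaves each integral alone. For \<open>g\<close>
  the null set is reflected and moved with \<open>x\<close>, so the difference \<open>g - g'\<close>
  is used instead: it has norm 0, and by Young's inequality so has its convolution.\<close>

lemma convolution_cong_AE:
  assumes p: "1 \<le> p" and f: "f \<in> Lp_functions 1 \<mu>" and f': "f' \<in> Lp_functions 1 \<mu>"
    and g: "g \<in> Lp_functions p \<mu>" and g': "g' \<in> Lp_functions p \<mu>"
    and ae: "AE x in \<mu>. f x = f' x" "AE x in \<mu>. g x = g' x"
  shows "AE x in \<mu>. convolution \<mu> f g x = convolution \<mu> f' g' x"
proof -
  have p0: "p > 0" using p by simp
  have 1: "convolution \<mu> f g x = convolution \<mu> f' g x" for x
    unfolding convolution_def
    using f f' g by (intro integral_cong_AE borel_measurable_times measurable_translate_inverse)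
      (auto intro: AE_mp[OF ae(1)])
  have d: "(\<lambda>x. g x - g' x) \<in> Lp_functions p \<mu>" by (rule Lp_functions_diff[OF p g g'])
  obtain h where h: "h \<in> Lp_functions p \<mu>" "AE x in \<mu>. convolution \<mu> f' (\<lambda>x. g x - g' x) x = h x"
    "Lp_nrm p \<mu> h \<le> Lp_nrm 1 \<mu> f' * Lp_nrm p \<mu> (\<lambda>x. g x - g' x)"
    using convolution_Lp[OF p f' d] by blast
  have "AE x in \<mu>. g x - g' x = 0" using ae(2) by eventually_elim simp
  then have "Lp_nrm p \<mu> (\<lambda>x. g x - g' x) = 0" using Lp_nrm_eq_0_iff[OF p0 d] by simp
  then have "Lp_nrm p \<mu> h = 0" using h(3) Lp_nrm_nonneg[of p \<mu> h] by simp
  then have "AE x in \<mu>. h x = 0" using Lp_nrm_eq_0_iff[OF p0 h(1)] by simp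
  with h(2) convolution_add_right[OF p f' g' d]
  show ?thesis by eventually_elim (simp add: 1)
qed

lemma ae_convolution_class:
  assumes p: "1 \<le> p" and f: "f \<in> Lp_functions 1 \<mu>" and g: "g \<in> Lp_functions p \<mu>"
  shows "ae_convolution \<mu> (ae_class \<mu> f) (ae_class \<mu> g) = ae_class \<mu> (convolution \<mu> f g)"
  unfolding ae_convolution_def
  by (rule ae_class_cong, rule convolution_cong_AE[OF p]) (use Lp_rep f g in auto)

text \<open>The class of a convolution is described by a function of L^p that equals it almost
  everywhere; \<open>ae_class\<close> depends on no more than this.\<close>

lemma ae_convolution_obtain:
  assumes p: "1 \<le> p" and f: "f \<in> Lp_functions 1 \<mu>" and g: "g \<in> Lp_functions p \<mu>"
  obtains h where "h \<in> Lp_functions p \<mu>" "AE x in \<mu>. convolution \<mu> f g x = h x"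
    "ae_convolution \<mu> (ae_class \<mu> f) (ae_class \<mu> g) = ae_class \<mu> h"
    "Lp_nrm p \<mu> h \<le> Lp_nrm 1 \<mu> f * Lp_nrm p \<mu> g"
proof -
  obtain h where h: "h \<in> Lp_functions p \<mu>" "AE x in \<mu>. convolution \<mu> f g x = h x"
    "Lp_nrm p \<mu> h \<le> Lp_nrm 1 \<mu> f * Lp_nrm p \<mu> g"
    using convolution_Lp[OF assms] by blast
  then show ?thesis using that ae_class_cong[OF h(2)] by (simp add: ae_convolution_class[OF assms])
qed

lemma
  assumes p: "1 \<le> p" and X: "X \<in> carrier (Lp_space 1 \<mu>)" and Y: "Y \<in> carrier (Lp_space p \<mu>)"
  shows ae_convolution_closed: "ae_convolution \<mu> X Y \<in> carrier (Lp_space p \<mu>)"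
    and ae_convolution_nrm: "nrm (Lp_space p \<mu>) (ae_convolution \<mu> X Y)
      \<le> nrm (Lp_space 1 \<mu>) X * nrm (Lp_space p \<mu>) Y"
    and ae_convolution_smult_left:
      "ae_convolution \<mu> (c \<odot>\<^bsub>Lp_space 1 \<mu>\<^esub> X) Y = c \<odot>\<^bsub>Lp_space p \<mu>\<^esub> ae_convolution \<mu> X Y"
    and ae_convolution_smult_right:
      "ae_convolution \<mu> X (c \<odot>\<^bsub>Lp_space p \<mu>\<^esub> Y) = c \<odot>\<^bsub>Lp_space p \<mu>\<^esub> ae_convolution \<mu> X Y"
proof -
  obtain f where f: "f \<in> Lp_functions 1 \<mu>" "X = ae_class \<mu> f" using X by (rule Lp_space_cases)
  obtain g where g: "g \<in> Lp_functions p \<mu>" "Y = ae_class \<mu> g" using Y by (rule Lp_space_cases)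
  obtain h where h: "h \<in> Lp_functions p \<mu>" "AE x in \<mu>. convolution \<mu> f g x = h x"
    "ae_convolution \<mu> X Y = ae_class \<mu> h" "Lp_nrm p \<mu> h \<le> Lp_nrm 1 \<mu> f * Lp_nrm p \<mu> g"
    using ae_convolution_obtain[OF p f(1) g(1)] f(2) g(2) by metis
  show "ae_convolution \<mu> X Y \<in> carrier (Lp_space p \<mu>)" using h by simp
  show "nrm (Lp_space p \<mu>) (ae_convolution \<mu> X Y) \<le> nrm (Lp_space 1 \<mu>) X * nrm (Lp_space p \<mu>) Y"
    using h f g by (simp add: Lp_space_nrm)
  have ch: "AE x in \<mu>. c * convolution \<mu> f g x = c * h x" using h(2) by eventually_elim simp
  show "ae_convolution \<mu> (c \<odot>\<^bsub>Lp_space 1 \<mu>\<^esub> X) Y = c \<odot>\<^bsub>Lp_space p \<mu>\<^esub> ae_convolution \<mu> X Y"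
    using f g ae_convolution_class[OF p Lp_functions_cmult[OF f(1), of c] g(1)] h(1,3)
        ae_class_cong[OF ch]
    by (simp add: Lp_space_smult convolution_cmult_left)
  show "ae_convolution \<mu> X (c \<odot>\<^bsub>Lp_space p \<mu>\<^esub> Y) = c \<odot>\<^bsub>Lp_space p \<mu>\<^esub> ae_convolution \<mu> X Y"
    using f g ae_convolution_class[OF p f(1) Lp_functions_cmult[OF g(1), of c]] h(1,3)
        ae_class_cong[OF ch]
    by (simp add: Lp_space_smult convolution_cmult_right)
qed

lemma ae_convolution_add_left:
  assumes p: "1 \<le> p" and X: "X \<in> carrier (Lp_space 1 \<mu>)" and X': "X' \<in> carrier (Lp_space 1 \<mu>)"
    and Y: "Y \<in> carrier (Lp_space p \<mu>)"
  shows "ae_convolution \<mu> (X \<oplus>\<^bsub>Lp_space 1 \<mu>\<^esub> X') Y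
    = ae_convolution \<mu> X Y \<oplus>\<^bsub>Lp_space p \<mu>\<^esub> ae_convolution \<mu> X' Y"
proof -
  obtain f where f: "f \<in> Lp_functions 1 \<mu>" "X = ae_class \<mu> f" using X by (rule Lp_space_cases)
  obtain f' where f': "f' \<in> Lp_functions 1 \<mu>" "X' = ae_class \<mu> f'" using X' by (rule Lp_space_cases)
  obtain g where g: "g \<in> Lp_functions p \<mu>" "Y = ae_class \<mu> g" using Y by (rule Lp_space_cases)
  obtain h where h: "h \<in> Lp_functions p \<mu>" "AE x in \<mu>. convolution \<mu> f g x = h x"
    "ae_convolution \<mu> X Y = ae_class \<mu> h"
    using ae_convolution_obtain[OF p f(1) g(1)] f(2) g(2) by metis
  obtain h' where h': "h' \<in> Lp_functions p \<mu>" "AE x in \<mu>. convolution \<mu> f' g x = h' x"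
    "ae_convolution \<mu> X' Y = ae_class \<mu> h'"
    using ae_convolution_obtain[OF p f'(1) g(1)] f'(2) g(2) by metis
  have "AE x in \<mu>. convolution \<mu> (\<lambda>x. f x + f' x) g x = h x + h' x"
    using convolution_add_left[OF p f(1) f'(1) g(1)] h(2) h'(2) by eventually_elim simp
  from ae_class_cong[OF this] show ?thesis
    using f f' g h(1,3) h'(1,3) ae_convolution_class[OF p Lp_functions_add[OF order_refl f(1) f'(1)]
        g(1)]
    by (simp add: Lp_space_add)
qed

lemma ae_convolution_add_right:
  assumes p: "1 \<le> p" and X: "X \<in> carrier (Lp_space 1 \<mu>)"
    and Y: "Y \<in> carrier (Lp_space p \<mu>)" and Y': "Y' \<in> carrier (Lp_space p \<mu>)"
  shows "ae_convolution \<mu> X (Y \<oplus>\<^bsub>Lp_space p \<mu>\<^esub> Y')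
    = ae_convolution \<mu> X Y \<oplus>\<^bsub>Lp_space p \<mu>\<^esub> ae_convolution \<mu> X Y'"
proof -
  obtain f where f: "f \<in> Lp_functions 1 \<mu>" "X = ae_class \<mu> f" using X by (rule Lp_space_cases)
  obtain g where g: "g \<in> Lp_functions p \<mu>" "Y = ae_class \<mu> g" using Y by (rule Lp_space_cases)
  obtain g' where g': "g' \<in> Lp_functions p \<mu>" "Y' = ae_class \<mu> g'" using Y' by (rule Lp_space_cases)
  obtain h where h: "h \<in> Lp_functions p \<mu>" "AE x in \<mu>. convolution \<mu> f g x = h x"
    "ae_convolution \<mu> X Y = ae_class \<mu> h"
    using ae_convolution_obtain[OF p f(1) g(1)] f(2) g(2) by metis
  obtain h' where h': "h' \<in> Lp_functions p \<mu>" "AE x in \<mu>. convolution \<mu> f g' x = h' x"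
    "ae_convolution \<mu> X Y' = ae_class \<mu> h'"
    using ae_convolution_obtain[OF p f(1) g'(1)] f(2) g'(2) by metis
  have "AE x in \<mu>. convolution \<mu> f (\<lambda>x. g x + g' x) x = h x + h' x"
    using convolution_add_right[OF p f(1) g(1) g'(1)] h(2) h'(2) by eventually_elim simp
  from ae_class_cong[OF this] show ?thesis
    using f g g' h(1,3) h'(1,3) ae_convolution_class[OF p f(1) Lp_functions_add[OF p g(1) g'(1)]]
    by (simp add: Lp_space_add)
qed

lemma ae_convolution_diff_left:
  assumes p: "1 \<le> p" and X: "X \<in> carrier (Lp_space 1 \<mu>)" and X': "X' \<in> carrier (Lp_space 1 \<mu>)"
    and Y: "Y \<in> carrier (Lp_space p \<mu>)"
  shows "ae_convolution \<mu> (X \<ominus>\<^bsub>Lp_space 1 \<mu>\<^esub> X') Y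
    = ae_convolution \<mu> X Y \<ominus>\<^bsub>Lp_space p \<mu>\<^esub> ae_convolution \<mu> X' Y"
proof -
  interpret L1: complex_normed_space "Lp_space 1 \<mu>" by (rule complex_normed_space_Lp) simp
  interpret Lp: complex_normed_space "Lp_space p \<mu>" by (rule complex_normed_space_Lp[OF p])
  show ?thesis using assms
    by (simp add: L1.diff_eq Lp.diff_eq ae_convolution_add_left ae_convolution_smult_left
        ae_convolution_closed)
qed

lemma ae_convolution_diff_right:
  assumes p: "1 \<le> p" and X: "X \<in> carrier (Lp_space 1 \<mu>)"
    and Y: "Y \<in> carrier (Lp_space p \<mu>)" and Y': "Y' \<in> carrier (Lp_space p \<mu>)"
  shows "ae_convolution \<mu> X (Y \<ominus>\<^bsub>Lp_space p \<mu>\<^esub> Y')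
    = ae_convolution \<mu> X Y \<ominus>\<^bsub>Lp_space p \<mu>\<^esub> ae_convolution \<mu> X Y'"
proof -
  interpret Lp: complex_normed_space "Lp_space p \<mu>" by (rule complex_normed_space_Lp[OF p])
  show ?thesis using assms
    by (simp add: Lp.diff_eq ae_convolution_add_right ae_convolution_smult_right
        ae_convolution_closed)
qed

lemma Lp_space_dense:
  assumes p: "1 \<le> p" and X: "X \<in> carrier (Lp_space p \<mu>)" and \<epsilon>: "\<epsilon> > 0"
  obtains \<phi> where "\<phi> \<in> Cc" "nrm (Lp_space p \<mu>) (X \<ominus>\<^bsub>Lp_space p \<mu>\<^esub> ae_class \<mu> \<phi>) < \<epsilon>"
proof -
  obtain f where f: "f \<in> Lp_functions p \<mu>" "X = ae_class \<mu> f" using X by (rule Lp_space_cases)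
  obtain \<phi> where \<phi>: "\<phi> \<in> Cc" "Lp_nrm p \<mu> (\<lambda>x. f x - \<phi> x) < \<epsilon>" using Cc_dense[OF p f(1) \<epsilon>] by blast
  then show ?thesis using that[OF \<phi>(1)] f p by (simp add: Lp_space_nrm_diff Cc_Lp)
qed

lemma Cc_class: "\<lbrakk>\<phi> \<in> Cc; 1 \<le> p\<rbrakk> \<Longrightarrow> ae_class \<mu> \<phi> \<in> carrier (Lp_space p \<mu>)"
  by (intro Lp_space_closed Cc_Lp) auto

text \<open>Two Lipschitz maps that agree on a dense set are equal. The common constant
  \<open>C\<close> bounds both, so an approximant within \<open>e / (2 * (C + 1))\<close> moves each
  value by at most \<open>e / 2\<close>.\<close>

lemma Lp_space_eq_on_dense:
  assumes p: "1 \<le> p" and q: "1 \<le> q"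
    and T: "\<And>X. X \<in> carrier (Lp_space p \<mu>) \<Longrightarrow> T X \<in> carrier (Lp_space q \<mu>)"
    and U: "\<And>X. X \<in> carrier (Lp_space p \<mu>) \<Longrightarrow> U X \<in> carrier (Lp_space q \<mu>)"
    and lip: "\<And>X Y. \<lbrakk>X \<in> carrier (Lp_space p \<mu>); Y \<in> carrier (Lp_space p \<mu>)\<rbrakk> \<Longrightarrow>
      nrm (Lp_space q \<mu>) (T X \<ominus>\<^bsub>Lp_space q \<mu>\<^esub> T Y) \<le> C * nrm (Lp_space p \<mu>) (X \<ominus>\<^bsub>Lp_space p \<mu>\<^esub> Y)"
      "\<And>X Y. \<lbrakk>X \<in> carrier (Lp_space p \<mu>); Y \<in> carrier (Lp_space p \<mu>)\<rbrakk> \<Longrightarrow>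
      nrm (Lp_space q \<mu>) (U X \<ominus>\<^bsub>Lp_space q \<mu>\<^esub> U Y) \<le> C * nrm (Lp_space p \<mu>) (X \<ominus>\<^bsub>Lp_space p \<mu>\<^esub> Y)"
    and eq: "\<And>\<phi>. \<phi> \<in> Cc \<Longrightarrow> T (ae_class \<mu> \<phi>) = U (ae_class \<mu> \<phi>)"
    and C: "0 \<le> C" and X: "X \<in> carrier (Lp_space p \<mu>)"
  shows "T X = U X"
proof -
  interpret Lp: complex_normed_space "Lp_space p \<mu>" by (rule complex_normed_space_Lp[OF p])
  interpret Lq: complex_normed_space "Lp_space q \<mu>" by (rule complex_normed_space_Lp[OF q])
  show ?thesis
  proof (rule Lq.eq_if_nrm_diff_small[OF T[OF X] U[OF X]])
    fix e :: real assume "e > 0"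
    then have d: "e / (2 * (C + 1)) > 0" using C by simp
    obtain \<phi> where \<phi>: "\<phi> \<in> Cc" "nrm (Lp_space p \<mu>) (X \<ominus>\<^bsub>Lp_space p \<mu>\<^esub> ae_class \<mu> \<phi>) < e / (2 * (C
        + 1))"
      using Lp_space_dense[OF p X d] by blast
    have \<phi>c: "ae_class \<mu> \<phi> \<in> carrier (Lp_space p \<mu>)" by (rule Cc_class[OF \<phi>(1) p])
    have "nrm (Lp_space q \<mu>) (T X \<ominus>\<^bsub>Lp_space q \<mu>\<^esub> U X)
        \<le> nrm (Lp_space q \<mu>) (T X \<ominus>\<^bsub>Lp_space q \<mu>\<^esub> T (ae_class \<mu> \<phi>))
          + nrm (Lp_space q \<mu>) (U X \<ominus>\<^bsub>Lp_space q \<mu>\<^esub> U (ae_class \<mu> \<phi>))"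
      using Lq.nrm_diff_triangle[OF T[OF X] T[OF \<phi>c] U[OF X]] Lq.nrm_diff_commute[OF U[OF X] U[OF
          \<phi>c]]
      by (simp add: eq[OF \<phi>(1)])
    also have "\<dots> \<le> 2 * (C * nrm (Lp_space p \<mu>) (X \<ominus>\<^bsub>Lp_space p \<mu>\<^esub> ae_class \<mu> \<phi>))"
      using lip[OF X \<phi>c] by simp
    also have "\<dots> \<le> 2 * ((C + 1) * nrm (Lp_space p \<mu>) (X \<ominus>\<^bsub>Lp_space p \<mu>\<^esub> ae_class \<mu> \<phi>))"
      using Lp.nrm_nonneg[OF Lp.diff_closed[OF X \<phi>c]] by (intro mult_left_mono mult_right_mono) auto
    also have "\<dots> \<le> e" using \<phi>(2) C by (simp add: pos_less_divide_eq algebra_simps)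
    finally show "nrm (Lp_space q \<mu>) (T X \<ominus>\<^bsub>Lp_space q \<mu>\<^esub> U X) \<le> e" .
  qed
qed

text \<open>The identity holds for compactly supported functions, and both sides are Lipschitz in
  each factor. Density extends it one factor at a time, to \<open>Z\<close> in \<open>step1\<close>,
  to \<open>Y\<close> in \<open>step2\<close> and last to \<open>X\<close>.\<close>

lemma ae_convolution_assoc:
  assumes p: "1 \<le> p" and X: "X \<in> carrier (Lp_space 1 \<mu>)" and Y: "Y \<in> carrier (Lp_space 1 \<mu>)"
    and Z: "Z \<in> carrier (Lp_space p \<mu>)"
  shows "ae_convolution \<mu> (ae_convolution \<mu> X Y) Z = ae_convolution \<mu> X (ae_convolution \<mu> Y Z)"
proof -
  let ?L1 = "Lp_space 1 \<mu>" and ?L = "Lp_space p \<mu>"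
  interpret L1: complex_normed_space ?L1 by (rule complex_normed_space_Lp) simp
  interpret Lp: complex_normed_space ?L by (rule complex_normed_space_Lp[OF p])
  note closed = ae_convolution_closed[OF p] ae_convolution_closed[OF order_refl]
  note nrm = ae_convolution_nrm[OF p] ae_convolution_nrm[OF order_refl]
  have right: "nrm ?L (ae_convolution \<mu> A B \<ominus>\<^bsub>?L\<^esub> ae_convolution \<mu> A B')
      \<le> nrm ?L1 A * nrm ?L (B \<ominus>\<^bsub>?L\<^esub> B')"
    if "A \<in> carrier ?L1" "B \<in> carrier ?L" "B' \<in> carrier ?L" for A B B'
    using that nrm(1)[of A "B \<ominus>\<^bsub>?L\<^esub> B'"] by (simp add: ae_convolution_diff_right[OF p])
  have right1: "nrm ?L1 (ae_convolution \<mu> A B \<ominus>\<^bsub>?L1\<^esub> ae_convolution \<mu> A B')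
      \<le> nrm ?L1 A * nrm ?L1 (B \<ominus>\<^bsub>?L1\<^esub> B')"
    if "A \<in> carrier ?L1" "B \<in> carrier ?L1" "B' \<in> carrier ?L1" for A B B'
    using that nrm(2)[of A "B \<ominus>\<^bsub>?L1\<^esub> B'"] by (simp add: ae_convolution_diff_right)
  have left: "nrm ?L (ae_convolution \<mu> A B \<ominus>\<^bsub>?L\<^esub> ae_convolution \<mu> A' B)
      \<le> nrm ?L1 (A \<ominus>\<^bsub>?L1\<^esub> A') * nrm ?L B"
    if "A \<in> carrier ?L1" "A' \<in> carrier ?L1" "B \<in> carrier ?L" for A A' B
    using that nrm(1)[of "A \<ominus>\<^bsub>?L1\<^esub> A'" B] by (simp add: ae_convolution_diff_left[OF p])
  have left1: "nrm ?L1 (ae_convolution \<mu> A B \<ominus>\<^bsub>?L1\<^esub> ae_convolution \<mu> A' B)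
      \<le> nrm ?L1 (A \<ominus>\<^bsub>?L1\<^esub> A') * nrm ?L1 B"
    if "A \<in> carrier ?L1" "A' \<in> carrier ?L1" "B \<in> carrier ?L1" for A A' B
    using that nrm(2)[of "A \<ominus>\<^bsub>?L1\<^esub> A'" B] by (simp add: ae_convolution_diff_left[OF order_refl])
  have Cc1: "ae_class \<mu> \<phi> \<in> carrier ?L1" if "\<phi> \<in> Cc" for \<phi> by (rule Cc_class[OF that order_refl])
  have Ccp: "ae_class \<mu> \<phi> \<in> carrier ?L" if "\<phi> \<in> Cc" for \<phi> by (rule Cc_class[OF that p])
  have conv_Cc: "ae_convolution \<mu> (ae_class \<mu> f) (ae_class \<mu> g) = ae_class \<mu> (convolution \<mu> f g)"
    if "f \<in> Cc" "g \<in> Cc" for f g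
    using that by (intro ae_convolution_class[OF order_refl] Cc_Lp) auto
  have step1: "ae_convolution \<mu> (ae_convolution \<mu> (ae_class \<mu> f) (ae_class \<mu> h)) Z
      = ae_convolution \<mu> (ae_class \<mu> f) (ae_convolution \<mu> (ae_class \<mu> h) Z)"
    if f: "f \<in> Cc" and h: "h \<in> Cc" and Z: "Z \<in> carrier ?L" for f h Z
  proof (rule Lp_space_eq_on_dense[OF p p, where X = Z and
        T = "\<lambda>Z. ae_convolution \<mu> (ae_convolution \<mu> (ae_class \<mu> f) (ae_class \<mu> h)) Z" and
        U = "\<lambda>Z. ae_convolution \<mu> (ae_class \<mu> f) (ae_convolution \<mu> (ae_class \<mu> h) Z)"])
    let ?C = "nrm ?L1 (ae_class \<mu> f) * nrm ?L1 (ae_class \<mu> h)"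
    show "0 \<le> ?C" by (intro mult_nonneg_nonneg L1.nrm_nonneg Cc1 f h)
    fix A B assume AB: "A \<in> carrier ?L" "B \<in> carrier ?L"
    have fh: "ae_convolution \<mu> (ae_class \<mu> f) (ae_class \<mu> h) \<in> carrier ?L1"
        by (intro closed Cc1 f h)
    show "nrm ?L (ae_convolution \<mu> (ae_convolution \<mu> (ae_class \<mu> f) (ae_class \<mu> h)) A \<ominus>\<^bsub>?L\<^esub>
        ae_convolution \<mu> (ae_convolution \<mu> (ae_class \<mu> f) (ae_class \<mu> h)) B)
            \<le> ?C * nrm ?L (A \<ominus>\<^bsub>?L\<^esub> B)"
      by (rule order_trans[OF right[OF fh AB] mult_right_mono[OF nrm(2)[OF Cc1[OF f] Cc1[OF h]]]])
        (intro Lp.nrm_nonneg Lp.diff_closed AB)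
    have "nrm ?L (ae_convolution \<mu> (ae_class \<mu> f) (ae_convolution \<mu> (ae_class \<mu> h) A) \<ominus>\<^bsub>?L\<^esub>
        ae_convolution \<mu> (ae_class \<mu> f) (ae_convolution \<mu> (ae_class \<mu> h) B))
        \<le> nrm ?L1 (ae_class \<mu> f) * (nrm ?L1 (ae_class \<mu> h) * nrm ?L (A \<ominus>\<^bsub>?L\<^esub> B))"
      by (rule order_trans[OF right mult_left_mono[OF right]])
        (intro closed Cc1 f h AB L1.nrm_nonneg)+
    then show "nrm ?L (ae_convolution \<mu> (ae_class \<mu> f) (ae_convolution \<mu> (ae_class \<mu> h) A) \<ominus>\<^bsub>?L\<^esub>
        ae_convolution \<mu> (ae_class \<mu> f) (ae_convolution \<mu> (ae_class \<mu> h) B))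
            \<le> ?C * nrm ?L (A \<ominus>\<^bsub>?L\<^esub> B)"
      by (simp add: mult.assoc)
  next
    fix g :: "'g \<Rightarrow> complex" assume g: "g \<in> Cc"
    show "ae_convolution \<mu> (ae_convolution \<mu> (ae_class \<mu> f) (ae_class \<mu> h)) (ae_class \<mu> g)
      = ae_convolution \<mu> (ae_class \<mu> f) (ae_convolution \<mu> (ae_class \<mu> h) (ae_class \<mu> g))"
      by (simp only: conv_Cc Cc_convolution(1) Cc_convolution_assoc f h g)
  qed (intro closed Cc1 f h Z | assumption)+
  have step2: "ae_convolution \<mu> (ae_convolution \<mu> (ae_class \<mu> f) Y) Z
      = ae_convolution \<mu> (ae_class \<mu> f) (ae_convolution \<mu> Y Z)"
    if f: "f \<in> Cc" and Y: "Y \<in> carrier ?L1" and Z: "Z \<in> carrier ?L" for f Y Z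
  proof (rule Lp_space_eq_on_dense[OF order_refl p, where X = Y and
        T = "\<lambda>Y. ae_convolution \<mu> (ae_convolution \<mu> (ae_class \<mu> f) Y) Z" and
        U = "\<lambda>Y. ae_convolution \<mu> (ae_class \<mu> f) (ae_convolution \<mu> Y Z)"])
    let ?C = "nrm ?L1 (ae_class \<mu> f) * nrm ?L Z"
    show "0 \<le> ?C" by (intro mult_nonneg_nonneg L1.nrm_nonneg Lp.nrm_nonneg Cc1 f Z)
    fix A B assume AB: "A \<in> carrier ?L1" "B \<in> carrier ?L1"
    have "nrm ?L (ae_convolution \<mu> (ae_convolution \<mu> (ae_class \<mu> f) A) Z \<ominus>\<^bsub>?L\<^esub>
        ae_convolution \<mu> (ae_convolution \<mu> (ae_class \<mu> f) B) Z)
        \<le> (nrm ?L1 (ae_class \<mu> f) * nrm ?L1 (A \<ominus>\<^bsub>?L1\<^esub> B)) * nrm ?L Z"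
      by (rule order_trans[OF left mult_right_mono[OF right1]])
        (intro closed Cc1 f Z AB Lp.nrm_nonneg)+
    then show "nrm ?L (ae_convolution \<mu> (ae_convolution \<mu> (ae_class \<mu> f) A) Z \<ominus>\<^bsub>?L\<^esub>
        ae_convolution \<mu> (ae_convolution \<mu> (ae_class \<mu> f) B) Z) \<le> ?C * nrm ?L1 (A \<ominus>\<^bsub>?L1\<^esub> B)"
      by (simp add: mult_ac)
    have "nrm ?L (ae_convolution \<mu> (ae_class \<mu> f) (ae_convolution \<mu> A Z) \<ominus>\<^bsub>?L\<^esub>
        ae_convolution \<mu> (ae_class \<mu> f) (ae_convolution \<mu> B Z))
        \<le> nrm ?L1 (ae_class \<mu> f) * (nrm ?L1 (A \<ominus>\<^bsub>?L1\<^esub> B) * nrm ?L Z)"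
      by (rule order_trans[OF right mult_left_mono[OF left]])
        (intro closed Cc1 f Z AB L1.nrm_nonneg)+
    then show "nrm ?L (ae_convolution \<mu> (ae_class \<mu> f) (ae_convolution \<mu> A Z) \<ominus>\<^bsub>?L\<^esub>
        ae_convolution \<mu> (ae_class \<mu> f) (ae_convolution \<mu> B Z)) \<le> ?C * nrm ?L1 (A \<ominus>\<^bsub>?L1\<^esub> B)"
      by (simp add: mult_ac)
  qed (intro step1 closed Cc1 f Y Z | assumption)+
  show ?thesis
  proof (rule Lp_space_eq_on_dense[OF order_refl p, where X = X and
        T = "\<lambda>X. ae_convolution \<mu> (ae_convolution \<mu> X Y) Z" and
        U = "\<lambda>X. ae_convolution \<mu> X (ae_convolution \<mu> Y Z)"])
    let ?C = "nrm ?L1 Y * nrm ?L Z"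
    show "0 \<le> ?C" by (intro mult_nonneg_nonneg L1.nrm_nonneg Lp.nrm_nonneg Y Z)
    fix A B assume AB: "A \<in> carrier ?L1" "B \<in> carrier ?L1"
    have "nrm ?L (ae_convolution \<mu> (ae_convolution \<mu> A Y) Z \<ominus>\<^bsub>?L\<^esub> ae_convolution \<mu> (ae_convolution \<mu>
        B Y) Z)
        \<le> (nrm ?L1 (A \<ominus>\<^bsub>?L1\<^esub> B) * nrm ?L1 Y) * nrm ?L Z"
      by (rule order_trans[OF left mult_right_mono[OF left1]])
        (intro closed Y Z AB Lp.nrm_nonneg)+
    then show "nrm ?L (ae_convolution \<mu> (ae_convolution \<mu> A Y) Z \<ominus>\<^bsub>?L\<^esub> ae_convolution \<mu>
        (ae_convolution \<mu> B Y) Z)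
        \<le> ?C * nrm ?L1 (A \<ominus>\<^bsub>?L1\<^esub> B)"
      by (simp add: mult_ac)
    have "nrm ?L (ae_convolution \<mu> A (ae_convolution \<mu> Y Z) \<ominus>\<^bsub>?L\<^esub> ae_convolution \<mu> B (ae_convolution
        \<mu> Y Z))
        \<le> nrm ?L1 (A \<ominus>\<^bsub>?L1\<^esub> B) * (nrm ?L1 Y * nrm ?L Z)"
      by (rule order_trans[OF left mult_left_mono[OF nrm(1)]])
        (intro closed Y Z AB L1.nrm_nonneg L1.diff_closed)+
    then show "nrm ?L (ae_convolution \<mu> A (ae_convolution \<mu> Y Z) \<ominus>\<^bsub>?L\<^esub> ae_convolution \<mu> B
        (ae_convolution \<mu> Y Z))
        \<le> ?C * nrm ?L1 (A \<ominus>\<^bsub>?L1\<^esub> B)"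
      by (simp add: mult_ac)
  qed (intro step2 closed X Y Z | assumption)+
qed

end

section \<open>The group algebra and its modules\<close>

lemma group_algebra_simps [simp]:
  "carrier (group_algebra \<mu>) = carrier (Lp_space 1 \<mu>)" "add (group_algebra \<mu>) = add (Lp_space 1 \<mu>)"
  "zero (group_algebra \<mu>) = zero (Lp_space 1 \<mu>)" "smult (group_algebra \<mu>) = smult (Lp_space 1 \<mu>)"
  "nrm (group_algebra \<mu>) = nrm (Lp_space 1 \<mu>)" "mult (group_algebra \<mu>) = ae_convolution \<mu>"
  by (simp_all add: group_algebra_def)

lemma Lp_module_simps [simp]:
  "carrier (Lp_module p \<mu>) = carrier (Lp_space p \<mu>)" "add (Lp_module p \<mu>) = add (Lp_space p \<mu>)"
  "zero (Lp_module p \<mu>) = zero (Lp_space p \<mu>)" "smult (Lp_module p \<mu>) = smult (Lp_space p \<mu>)"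
  "nrm (Lp_module p \<mu>) = nrm (Lp_space p \<mu>)" "act (Lp_module p \<mu>) = ae_convolution \<mu>"
  by (simp_all add: Lp_module_def normed_cspace.extend_def banach_act.fields_def)

context locally_compact_haar
begin

lemma banach_algebra_group_algebra: "banach_algebra (group_algebra \<mu>)"
proof -
  have "complex_banach_space (group_algebra \<mu>)"
    by (rule complex_banach_space_cong[OF complex_banach_space_Lp[OF order_refl]]) simp_all
  then show ?thesis
    by (intro banach_algebra.intro banach_algebra_axioms.intro)
      (simp_all add: ae_convolution_closed ae_convolution_assoc[OF order_refl]
          ae_convolution_add_left[OF order_refl]
        ae_convolution_add_right ae_convolution_smult_left[OF order_refl] ae_convolution_smult_right
        ae_convolution_nrm)
qed

lemma banach_left_module_Lp:
  assumes p: "1 \<le> p"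
  shows "banach_left_module (group_algebra \<mu>) (Lp_module p \<mu>)"
proof -
  interpret L: complex_normed_space "Lp_space p \<mu>" by (rule complex_normed_space_Lp[OF p])
  have "complex_banach_space (Lp_module p \<mu>)"
    by (rule complex_banach_space_cong[OF complex_banach_space_Lp[OF p]]) simp_all
  moreover have "\<exists>C. \<forall>X\<in>carrier (group_algebra \<mu>). \<forall>Y\<in>carrier (Lp_module p \<mu>).
      nrm (Lp_module p \<mu>) (act (Lp_module p \<mu>) X Y)
          \<le> C * nrm (group_algebra \<mu>) X * nrm (Lp_module p \<mu>) Y"
    using ae_convolution_nrm[OF p] by (intro exI[of _ 1]) simp
  ultimately show ?thesis
    using banach_algebra_group_algebra
    by (intro banach_left_module.intro banach_left_module_axioms.intro)
      (simp_all add: ae_convolution_closed[OF p] ae_convolution_assoc[OF p]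
          ae_convolution_add_left[OF p]
        ae_convolution_add_right[OF p] ae_convolution_smult_left[OF p] ae_convolution_smult_right[OF
            p])
qed

text \<open>
  Symmetric units make the right approximate unit property independent of the modular function:
  \<open>(a * e) x = \<integral> a (x + y) * e (- y) dy\<close>.
\<close>

definition unit_functions :: "'g set \<Rightarrow> ('g \<Rightarrow> real) set" where
  "unit_functions V = {e \<in> Cc. (\<forall>y. 0 \<le> e y) \<and> (\<forall>y. e (- y) = e y) \<and> (\<integral>y. e y \<partial>\<mu>) = 1 \<and> (\<forall>y. y \<notin> V
      \<longrightarrow> e y = 0)}"

definition unit_classes :: "'g set \<Rightarrow> ('g \<Rightarrow> complex) set set" where
  "unit_classes V = (\<lambda>e. ae_class \<mu> (\<lambda>y. complex_of_real (e y))) ` unit_functions V"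

text \<open>A cutoff function at 0 supported in \<open>V\<close> and its reflection is symmetrized
  and divided by its integral, which is positive because nonempty open sets have positive
  measure.\<close>

lemma unit_functions_nonempty:
  assumes V: "open V" "0 \<in> V"
  shows "unit_functions V \<noteq> {}"
proof -
  let ?U = "V \<inter> uminus -` V"
  have U: "open ?U" "{0} \<subseteq> ?U"
    using V by (auto intro!: open_Int open_vimage continuous_intros)
  have zero: "compact {0 :: 'g}" by simp
  obtain \<psi> where \<psi>: "\<psi> \<in> Cc" "\<And>x. 0 \<le> \<psi> x" "\<And>x. \<psi> x \<le> (1::real)"
    "\<And>x. x \<in> {0} \<Longrightarrow> \<psi> x = 1" "\<And>x. x \<notin> ?U \<Longrightarrow> \<psi> x = 0"
    using Cc_urysohn[OF zero U] by blast
  define s where "s y = \<psi> y + \<psi> (- y)" for y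
  obtain K where K: "compact K" "\<And>x. x \<notin> K \<Longrightarrow> \<psi> x = 0" using \<psi>(1) by (auto simp: Cc_def)
  have "(\<lambda>y. \<psi> (- y)) \<in> Cc"
  proof (rule CcI)
    show "continuous_on UNIV (\<lambda>y. \<psi> (- y))"
      by (intro continuous_on_compose_UNIV[OF Cc_continuous[OF \<psi>(1)]] continuous_intros)
    show "compact (uminus ` K)" using K(1) by (intro compact_continuous_image continuous_intros)
    show "\<psi> (- x) = 0" if "x \<notin> uminus ` K" for x
      using that by (intro K(2)) (auto simp: uminus_image_eq)
  qed
  then have s: "s \<in> Cc" unfolding s_def[abs_def] by (intro Cc_add \<psi>(1))
  have s_nn: "0 \<le> s y" for y by (simp add: s_def \<psi>(2))
  have "(\<integral>y. s y \<partial>\<mu>) \<noteq> 0"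
  proof
    assume "(\<integral>y. s y \<partial>\<mu>) = 0"
    then have "AE y in \<mu>. s y = 0"
      using integral_nonneg_eq_0_iff_AE[OF Cc_integrable[OF s]] s_nn by simp
    moreover have op: "open {y. s y \<noteq> 0}"
      by (intro open_Collect_neq Cc_continuous[OF s] continuous_on_const)
    ultimately have "emeasure \<mu> {y. s y \<noteq> 0} = 0"
      by (subst (asm) AE_iff_measurable[OF _ refl]) (auto simp: sets_eq_borel)
    moreover have "0 \<in> {y. s y \<noteq> 0}" by (simp add: s_def \<psi>(4))
    ultimately show False using emeasure_open_pos[OF op] by auto
  qed
  moreover have "0 \<le> (\<integral>y. s y \<partial>\<mu>)" using s_nn by simp
  ultimately have pos: "(\<integral>y. s y \<partial>\<mu>) > 0" by simp
  have "(\<lambda>y. inverse (\<integral>y. s y \<partial>\<mu>) * s y) \<in> unit_functions V"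
    unfolding unit_functions_def
  proof (intro CollectI conjI allI impI)
    show "(\<lambda>y. inverse (\<integral>y. s y \<partial>\<mu>) * s y) \<in> Cc" by (rule Cc_cmult[OF s])
    show "inverse (\<integral>y. s y \<partial>\<mu>) * s y = 0" if "y \<notin> V" for y
      using that by (simp add: s_def \<psi>(5))
  qed (use pos s_nn in \<open>auto simp: s_def add.commute\<close>)
  then show ?thesis by blast
qed

text \<open>Serves both sides, with \<open>h (y, x)\<close> equal to \<open>- y + x\<close> for left
  units and \<open>x + y\<close> for right units. As \<open>e\<close> is nonnegative with integral
  1, the error is an average of \<open>\<gamma> (h (y, x)) - \<gamma> x\<close> over
  \<open>y\<close> near 0; it is uniformly small on \<open>K\<close> and vanishes off
  \<open>K\<close>.\<close>

lemma approximate_unit_aux: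
  assumes p: "1 \<le> p" and \<gamma>: "\<gamma> \<in> Cc"
    and h: "continuous_on UNIV h" "\<And>x. h (0, x) = x"
    and W: "open W" "0 \<in> W" and K: "compact K" "\<And>x y. \<lbrakk>y \<in> W; x \<notin> K\<rbrakk> \<Longrightarrow> \<gamma> (h (y, x)) = 0"
    and \<delta>: "\<delta> > 0"
  obtains V where "open V" "0 \<in> V" "\<And>e. e \<in> unit_functions V \<Longrightarrow>
    Lp_nrm p \<mu> (\<lambda>x. (\<integral>y. complex_of_real (e y) * \<gamma> (h (y, x)) \<partial>\<mu>) - \<gamma> x) < \<delta>"
proof -
  \<comment> \<open>A uniform error \<open>\<eta>\<close> on \<open>K\<close> has norm at most
    \<open>\<eta> * measure \<mu> K powr (1 / p)\<close>; adding 1 avoids division by 0.\<close>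
  define \<eta> where "\<eta> = \<delta> / (2 * (measure \<mu> K powr (1 / p) + 1))"
  have \<eta>: "\<eta> > 0" using \<delta> by (simp add: \<eta>_def add_nonneg_pos)
  have cont: "continuous_on UNIV (\<lambda>z. \<gamma> (h z))"
    by (rule continuous_on_compose_UNIV[OF Cc_continuous[OF \<gamma>] h(1)])
  have "\<exists>X. 0 \<in> X \<and> open X \<and> (\<forall>y\<in>X. \<forall>x\<in>K. dist (\<gamma> (h (y, x))) (\<gamma> (h (0, x))) \<le> \<eta>)"
    by (rule continuous_on_prod_compactE[of UNIV K "\<lambda>z. \<gamma> (h z)" 0 \<eta>])
      (use continuous_on_subset[OF cont] K \<eta> in auto)
  then obtain X where X: "0 \<in> X" "open X"
    "\<And>y x. y \<in> X \<Longrightarrow> x \<in> K \<Longrightarrow> cmod (\<gamma> (h (y, x)) - \<gamma> x) \<le> \<eta>"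
    by (auto simp: h(2) dist_norm)
  show ?thesis
  proof (rule that[of "X \<inter> W"])
    show "open (X \<inter> W)" "0 \<in> X \<inter> W" using X W by auto
    fix e assume "e \<in> unit_functions (X \<inter> W)"
    then have e: "e \<in> Cc" "\<And>y. 0 \<le> e y" "(\<integral>y. e y \<partial>\<mu>) = 1" "\<And>y. y \<notin> X \<inter> W \<Longrightarrow> e y = 0"
      by (auto simp: unit_functions_def)
    obtain L where L: "compact L" "\<And>y. y \<notin> L \<Longrightarrow> e y = 0" using e(1) by (auto simp: Cc_def)
    define F where "F x y = complex_of_real (e y) * \<gamma> (h (y, x))" for x y
    have contF: "continuous_on UNIV (\<lambda>(x, y). F x y)"
      unfolding F_def split_beta
      by (intro continuous_on_mult continuous_on_of_real continuous_on_compose_UNIV[OF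
          Cc_continuous[OF e(1)]]
          continuous_on_compose_UNIV[OF cont] continuous_on_Pair continuous_on_fst continuous_on_snd
              continuous_on_id)
    have out: "\<And>x y. x \<notin> K \<or> y \<notin> L \<Longrightarrow> F x y = 0"
      using K(2) L(2) e(4) by (auto simp: F_def)
    have FCc: "(\<lambda>x. \<integral>y. F x y \<partial>\<mu>) \<in> Cc" "\<And>x. (\<lambda>y. F x y) \<in> Cc"
      using Cc_parameter_integral[OF contF K(1) L(1) out] by auto
    have \<gamma>0: "\<gamma> x = 0" if "x \<notin> K" for x using K(2)[OF W(2) that] by (simp add: h(2))
    have ce: "(\<lambda>y. complex_of_real (e y)) \<in> Cc" by (rule Cc_of_real[OF e(1)])
    have bd: "cmod ((\<integral>y. F x y \<partial>\<mu>) - \<gamma> x) \<le> \<eta>" for x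
    proof (cases "x \<in> K")
      case True
      have int: "integrable \<mu> (\<lambda>y. F x y - complex_of_real (e y) * \<gamma> x)"
        using Cc_integrable[OF FCc(2)] Cc_integrable[OF ce] by auto
      have "(\<integral>y. complex_of_real (e y) * \<gamma> x \<partial>\<mu>) = \<gamma> x"
        by (simp add: e(3))
      then have "(\<integral>y. F x y \<partial>\<mu>) - \<gamma> x = (\<integral>y. F x y - complex_of_real (e y) * \<gamma> x \<partial>\<mu>)"
        using Cc_integrable[OF FCc(2)] Cc_integrable[OF ce] by simp
      also have "cmod \<dots> \<le> (\<integral>y. cmod (F x y - complex_of_real (e y) * \<gamma> x) \<partial>\<mu>)"
        by (rule integral_norm_bound)
      also have "\<dots> \<le> (\<integral>y. e y * \<eta> \<partial>\<mu>)"
      proof (rule integral_mono)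
        show "integrable \<mu> (\<lambda>y. cmod (F x y - complex_of_real (e y) * \<gamma> x))" using int by simp
        show "integrable \<mu> (\<lambda>y. e y * \<eta>)" using Cc_integrable[OF e(1)] by simp
        fix y
        have "F x y - complex_of_real (e y) * \<gamma> x = complex_of_real (e y) * (\<gamma> (h (y, x)) - \<gamma> x)"
          by (simp add: F_def algebra_simps)
        then have "cmod (F x y - complex_of_real (e y) * \<gamma> x) = e y * cmod (\<gamma> (h (y, x)) - \<gamma> x)"
          using e(2) by (simp add: norm_mult)
        also have "\<dots> \<le> e y * \<eta>"
          using e(2,4)[of y] X(3)[OF _ True, of y]
              by (cases "y \<in> X \<inter> W") (auto intro: mult_left_mono)
        finally show "cmod (F x y - complex_of_real (e y) * \<gamma> x) \<le> e y * \<eta>" .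
      qed
      also have "\<dots> = \<eta>" by (simp add: e(3))
      finally show ?thesis .
    next
      case False
      then show ?thesis using \<eta> out \<gamma>0 by simp
    qed
    have "Lp_nrm p \<mu> (\<lambda>x. (\<integral>y. F x y \<partial>\<mu>) - \<gamma> x) \<le> \<eta> * measure \<mu> K powr (1 / p)"
    proof (rule Cc_Lp_nrm_le[OF p K(1) _ _ bd])
      show "(\<lambda>x. (\<integral>y. F x y \<partial>\<mu>) - \<gamma> x) \<in> borel_measurable \<mu>"
        using Cc_measurable[OF FCc(1)] Cc_measurable[OF \<gamma>] by simp
    qed (use out \<gamma>0 in simp)
    also have "\<dots> \<le> \<eta> * (measure \<mu> K powr (1 / p) + 1)" using \<eta> by simp
    also have "\<dots> = \<delta> / 2"
      using add_nonneg_pos[OF powr_ge_zero zero_less_one, of "measure \<mu> K" "1 / p"]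
      by (simp add: \<eta>_def divide_simps)
    also have "\<dots> < \<delta>" using \<delta> by simp
    finally show "Lp_nrm p \<mu> (\<lambda>x. (\<integral>y. complex_of_real (e y) * \<gamma> (h (y, x)) \<partial>\<mu>) - \<gamma> x) < \<delta>"
      by (simp add: F_def)
  qed
qed

lemma unit_functions_nrm:
  assumes "e \<in> unit_functions V"
  shows "(\<lambda>y. complex_of_real (e y)) \<in> Cc" "Lp_nrm 1 \<mu> (\<lambda>y. complex_of_real (e y)) = 1"
  using assms by (auto simp: unit_functions_def Cc_of_real Lp_nrm_1)

lemma unit_classes_carrier:
  "E \<in> unit_classes V \<Longrightarrow> E \<in> carrier (Lp_space 1 \<mu>)"
  by (auto simp: unit_classes_def intro!: Cc_class unit_functions_nrm)

lemma unit_classes_nrm: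
  assumes "E \<in> unit_classes V"
  shows "nrm (Lp_space 1 \<mu>) E = 1"
proof -
  obtain e where e: "e \<in> unit_functions V" "E = ae_class \<mu> (\<lambda>y. complex_of_real (e y))"
    using assms by (auto simp: unit_classes_def)
  then show ?thesis using unit_functions_nrm[OF e(1)] by (simp add: Lp_space_nrm Cc_Lp)
qed

lemma Cc_left_unit:
  assumes p: "1 \<le> p" and \<gamma>: "\<gamma> \<in> Cc" and \<delta>: "\<delta> > 0"
  obtains V where "open V" "0 \<in> V" "\<And>E. E \<in> unit_classes V \<Longrightarrow>
    nrm (Lp_space p \<mu>) (ae_convolution \<mu> E (ae_class \<mu> \<gamma>) \<ominus>\<^bsub>Lp_space p \<mu>\<^esub> ae_class \<mu> \<gamma>) < \<delta>"
proof -
  have zero: "compact {0 :: 'g}" by simp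
  obtain W C where W: "open W" "compact C" "{0 :: 'g} \<subseteq> W" "W \<subseteq> C"
    using compact_nbhd[OF zero] by blast
  obtain K where K: "compact K" "\<And>x. x \<notin> K \<Longrightarrow> \<gamma> x = 0" using \<gamma> by (auto simp: Cc_def)
  have cont: "continuous_on UNIV (\<lambda>z :: 'g \<times> 'g. - fst z + snd z)" by (intro continuous_intros)
  \<comment> \<open>For \<open>y\<close> in the relatively compact \<open>W\<close>, all translates
    of \<open>\<gamma>\<close> are supported in the one compact set \<open>C + K\<close>.\<close>
  have supp: "\<gamma> (- fst (y, x) + snd (y, x)) = 0" if "y \<in> W" "x \<notin> {x + y |x y. x \<in> C \<and> y \<in> K}"
      for x y
  proof (rule K(2))
    show "- fst (y, x) + snd (y, x) \<notin> K"
    proof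
      assume "- fst (y, x) + snd (y, x) \<in> K"
      moreover have "x = y + (- y + x)" by (simp flip: add.assoc)
      ultimately show False using that W(4) by auto
    qed
  qed
  obtain V where V: "open V" "0 \<in> V" "\<And>e. e \<in> unit_functions V \<Longrightarrow>
    Lp_nrm p \<mu> (\<lambda>x. (\<integral>y. complex_of_real (e y) * \<gamma> (- fst (y, x) + snd (y, x)) \<partial>\<mu>) - \<gamma> x) < \<delta>"
    by (rule approximate_unit_aux[OF p \<gamma> cont _ W(1) _ compact_add[OF W(2) K(1)] supp \<delta>])
      (use W(3) in \<open>auto intro: that\<close>)
  show ?thesis
  proof (rule that[OF V(1,2)])
    fix E assume "E \<in> unit_classes V"
    then obtain e where e: "e \<in> unit_functions V" "E = ae_class \<mu> (\<lambda>y. complex_of_real (e y))"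
      by (auto simp: unit_classes_def)
    have Lp: "(\<lambda>y. complex_of_real (e y)) \<in> Lp_functions 1 \<mu>" "\<gamma> \<in> Lp_functions p \<mu>"
      "convolution \<mu> (\<lambda>y. complex_of_real (e y)) \<gamma> \<in> Lp_functions p \<mu>"
      using p unit_functions_nrm(1)[OF e(1)] \<gamma> by (auto intro!: Cc_Lp Cc_convolution)
    show "nrm (Lp_space p \<mu>) (ae_convolution \<mu> E (ae_class \<mu> \<gamma>) \<ominus>\<^bsub>Lp_space p \<mu>\<^esub> ae_class \<mu> \<gamma>) < \<delta>"
      using V(3)[OF e(1)] Lp by (simp add: e(2) ae_convolution_class[OF p] Lp_space_nrm_diff[OF p]
          convolution_def)
  qed
qed

lemma Cc_right_unit:
  assumes \<gamma>: "\<gamma> \<in> Cc" and \<delta>: "\<delta> > 0"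
  obtains V where "open V" "0 \<in> V" "\<And>E. E \<in> unit_classes V \<Longrightarrow>
    nrm (Lp_space 1 \<mu>) (ae_convolution \<mu> (ae_class \<mu> \<gamma>) E \<ominus>\<^bsub>Lp_space 1 \<mu>\<^esub> ae_class \<mu> \<gamma>) < \<delta>"
proof -
  have zero: "compact {0 :: 'g}" by simp
  obtain W C where W: "open W" "compact C" "{0 :: 'g} \<subseteq> W" "W \<subseteq> C"
    using compact_nbhd[OF zero] by blast
  have C': "compact (uminus ` C)" using W(2) by (intro compact_continuous_image continuous_intros)
  obtain K where K: "compact K" "\<And>x. x \<notin> K \<Longrightarrow> \<gamma> x = 0" using \<gamma> by (auto simp: Cc_def)
  have cont: "continuous_on UNIV (\<lambda>z :: 'g \<times> 'g. snd z + fst z)" by (intro continuous_intros)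
  \<comment> \<open>The translates \<open>x \<mapsto> \<gamma> (x + y)\<close> are supported in
    \<open>K - y\<close>, hence for \<open>y\<close> in \<open>W\<close> in the compact set of all
    sums from \<open>K\<close> and \<open>- C\<close>.\<close>
  have supp: "\<gamma> (snd (y, x) + fst (y, x)) = 0" if "y \<in> W" "x \<notin> {x + y |x y. x \<in> K \<and> y \<in> uminus ` C}"
      for x y
  proof (rule K(2))
    show "snd (y, x) + fst (y, x) \<notin> K"
    proof
      assume "snd (y, x) + fst (y, x) \<in> K"
      moreover have "x = (x + y) + (- y)" by (simp add: add.assoc)
      moreover have "- y \<in> uminus ` C" using that(1) W(4) by blast
      ultimately show False using that(2) by auto
    qed
  qed
  obtain V where V: "open V" "0 \<in> V" "\<And>e. e \<in> unit_functions V \<Longrightarrow>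
    Lp_nrm 1 \<mu> (\<lambda>x. (\<integral>y. complex_of_real (e y) * \<gamma> (snd (y, x) + fst (y, x)) \<partial>\<mu>) - \<gamma> x) < \<delta>"
    by (rule approximate_unit_aux[OF order_refl \<gamma> cont _ W(1) _ compact_add[OF K(1) C'] supp \<delta>])
      (use W(3) in \<open>auto intro: that\<close>)
  show ?thesis
  proof (rule that[OF V(1,2)])
    fix E assume "E \<in> unit_classes V"
    then obtain e where e: "e \<in> unit_functions V" "E = ae_class \<mu> (\<lambda>y. complex_of_real (e y))"
      by (auto simp: unit_classes_def)
    have Cc: "(\<lambda>y. complex_of_real (e y)) \<in> Cc" by (rule unit_functions_nrm(1)[OF e(1)])
    have sym: "e (- y) = e y" for y using e(1) by (simp add: unit_functions_def)
    have Lp: "(\<lambda>y. complex_of_real (e y)) \<in> Lp_functions 1 \<mu>" "\<gamma> \<in> Lp_functions 1 \<mu>"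
      "convolution \<mu> \<gamma> (\<lambda>y. complex_of_real (e y)) \<in> Lp_functions 1 \<mu>"
      using Cc \<gamma> by (auto intro!: Cc_Lp Cc_convolution)
    have "convolution \<mu> \<gamma> (\<lambda>y. complex_of_real (e y)) x = (\<integral>y. complex_of_real (e y) * \<gamma> (x
        + y) \<partial>\<mu>)" for x
    proof -
      have "convolution \<mu> \<gamma> (\<lambda>y. complex_of_real (e y)) x
          = (\<integral>y. \<gamma> (x + y) * complex_of_real (e (- (x + y) + x)) \<partial>\<mu>)"
        unfolding convolution_def
        by (rule integral_add_left[OF Cc_measurable[OF Cc_convolution(2)[OF \<gamma> Cc]], symmetric])
      also have "\<dots> = (\<integral>y. complex_of_real (e y) * \<gamma> (x + y) \<partial>\<mu>)"
        by (simp add: minus_add add.assoc sym mult.commute)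
      finally show ?thesis .
    qed
    then show "nrm (Lp_space 1 \<mu>) (ae_convolution \<mu> (ae_class \<mu> \<gamma>) E \<ominus>\<^bsub>Lp_space 1 \<mu>\<^esub> ae_class \<mu> \<gamma>)
        < \<delta>"
      using V(3)[OF e(1)] Lp by (simp add: e(2) ae_convolution_class[OF order_refl]
          Lp_space_nrm_diff)
  qed
qed

text \<open>Density reduces the claim to a compactly supported \<open>\<gamma>\<close>. Every unit
  has norm 1, so replacing \<open>Y\<close> by \<open>\<gamma>\<close> costs at most
  \<open>\<epsilon> / 3\<close> before and after convolving, uniformly in the unit.\<close>

lemma left_unit_Lp:
  assumes p: "1 \<le> p" and Y: "Y \<in> carrier (Lp_space p \<mu>)" and \<epsilon>: "\<epsilon> > 0"
  obtains V where "open V" "0 \<in> V" "\<And>E. E \<in> unit_classes V \<Longrightarrow>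
    nrm (Lp_space p \<mu>) (ae_convolution \<mu> E Y \<ominus>\<^bsub>Lp_space p \<mu>\<^esub> Y) < \<epsilon>"
proof -
  let ?L = "Lp_space p \<mu>"
  interpret L: complex_normed_space ?L by (rule complex_normed_space_Lp[OF p])
  have \<epsilon>3: "\<epsilon> / 3 > 0" using \<epsilon> by simp
  obtain \<gamma> where \<gamma>: "\<gamma> \<in> Cc" "nrm ?L (Y \<ominus>\<^bsub>?L\<^esub> ae_class \<mu> \<gamma>) < \<epsilon> / 3"
    using Lp_space_dense[OF p Y \<epsilon>3] by blast
  have G: "ae_class \<mu> \<gamma> \<in> carrier ?L" by (rule Cc_class[OF \<gamma>(1) p])
  obtain V where V: "open V" "0 \<in> V" "\<And>E. E \<in> unit_classes V \<Longrightarrow>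
    nrm ?L (ae_convolution \<mu> E (ae_class \<mu> \<gamma>) \<ominus>\<^bsub>?L\<^esub> ae_class \<mu> \<gamma>) < \<epsilon> / 3"
    using Cc_left_unit[OF p \<gamma>(1) \<epsilon>3] by blast
  show ?thesis
  proof (rule that[OF V(1,2)])
    fix E assume E: "E \<in> unit_classes V"
    note Ec = unit_classes_carrier[OF E]
    note EY = ae_convolution_closed[OF p Ec Y] and EG = ae_convolution_closed[OF p Ec G]
    have "nrm ?L (ae_convolution \<mu> E Y \<ominus>\<^bsub>?L\<^esub> ae_convolution \<mu> E (ae_class \<mu> \<gamma>))
        \<le> nrm ?L (Y \<ominus>\<^bsub>?L\<^esub> ae_class \<mu> \<gamma>)"
      using ae_convolution_nrm[OF p Ec L.diff_closed[OF Y G]] unit_classes_nrm[OF E]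
      by (simp add: ae_convolution_diff_right[OF p Ec Y G])
    then show "nrm ?L (ae_convolution \<mu> E Y \<ominus>\<^bsub>?L\<^esub> Y) < \<epsilon>"
      using L.nrm_diff_triangle[OF EY EG Y] L.nrm_diff_triangle[OF EG G Y] L.nrm_diff_commute[OF G
          Y]
        \<gamma>(2) V(3)[OF E] by linarith
  qed
qed

lemma right_unit_L1:
  assumes X: "X \<in> carrier (Lp_space 1 \<mu>)" and \<epsilon>: "\<epsilon> > 0"
  obtains V where "open V" "0 \<in> V" "\<And>E. E \<in> unit_classes V \<Longrightarrow>
    nrm (Lp_space 1 \<mu>) (ae_convolution \<mu> X E \<ominus>\<^bsub>Lp_space 1 \<mu>\<^esub> X) < \<epsilon>"
proof -
  let ?L = "Lp_space 1 \<mu>"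
  interpret L: complex_normed_space ?L by (rule complex_normed_space_Lp[OF order_refl])
  have \<epsilon>3: "\<epsilon> / 3 > 0" using \<epsilon> by simp
  obtain \<gamma> where \<gamma>: "\<gamma> \<in> Cc" "nrm ?L (X \<ominus>\<^bsub>?L\<^esub> ae_class \<mu> \<gamma>) < \<epsilon> / 3"
    using Lp_space_dense[OF order_refl X \<epsilon>3] by blast
  have G: "ae_class \<mu> \<gamma> \<in> carrier ?L" by (rule Cc_class[OF \<gamma>(1) order_refl])
  obtain V where V: "open V" "0 \<in> V" "\<And>E. E \<in> unit_classes V \<Longrightarrow>
    nrm ?L (ae_convolution \<mu> (ae_class \<mu> \<gamma>) E \<ominus>\<^bsub>?L\<^esub> ae_class \<mu> \<gamma>) < \<epsilon> / 3"
    using Cc_right_unit[OF \<gamma>(1) \<epsilon>3] by blast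
  show ?thesis
  proof (rule that[OF V(1,2)])
    fix E assume E: "E \<in> unit_classes V"
    note Ec = unit_classes_carrier[OF E]
    note XE = ae_convolution_closed[OF order_refl X Ec]
        and GE = ae_convolution_closed[OF order_refl G Ec]
    have "nrm ?L (ae_convolution \<mu> X E \<ominus>\<^bsub>?L\<^esub> ae_convolution \<mu> (ae_class \<mu> \<gamma>) E)
        \<le> nrm ?L (X \<ominus>\<^bsub>?L\<^esub> ae_class \<mu> \<gamma>)"
      using ae_convolution_nrm[OF order_refl L.diff_closed[OF X G] Ec] unit_classes_nrm[OF E]
      by (simp add: ae_convolution_diff_left[OF order_refl X G Ec])
    then show "nrm ?L (ae_convolution \<mu> X E \<ominus>\<^bsub>?L\<^esub> X) < \<epsilon>"
      using L.nrm_diff_triangle[OF XE GE X] L.nrm_diff_triangle[OF GE G X] L.nrm_diff_commute[OF G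
          X]
        \<gamma>(2) V(3)[OF E] by linarith
  qed
qed

lemma unit_functions_midpoint:
  assumes "e \<in> unit_functions V" "e' \<in> unit_functions V"
  shows "(\<lambda>y. (1/2) * (e y + e' y)) \<in> unit_functions V"
proof -
  have "(\<lambda>y. (1/2) * (e y + e' y)) \<in> Cc"
    using assms by (intro Cc_cmult Cc_add) (auto simp: unit_functions_def)
  moreover have "integrable \<mu> e" "integrable \<mu> e'"
    using assms by (auto simp: unit_functions_def intro: Cc_integrable)
  ultimately show ?thesis using assms by (auto simp: unit_functions_def)
qed

lemma approximate_identity_group_algebra:
  "approximate_identity (group_algebra \<mu>) {unit_classes V | V. open V \<and> 0 \<in> V}"
proof -
  interpret A: banach_algebra "group_algebra \<mu>" by (rule banach_algebra_group_algebra)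
  interpret L: complex_normed_space "Lp_space 1 \<mu>" by (rule complex_normed_space_Lp[OF order_refl])
  have diff: "X \<ominus>\<^bsub>group_algebra \<mu>\<^esub> Y = X \<ominus>\<^bsub>Lp_space 1 \<mu>\<^esub> Y"
    if "X \<in> carrier (Lp_space 1 \<mu>)" "Y \<in> carrier (Lp_space 1 \<mu>)" for X Y
    using that A.diff_eq[of X Y] L.diff_eq[of X Y] by simp
  show ?thesis
  proof
    show "{unit_classes V | V. open V \<and> 0 \<in> V} \<noteq> {}" using open_UNIV by blast
  next
    fix X assume "X \<in> {unit_classes V | V. open V \<and> 0 \<in> V}"
    then show "X \<noteq> {}" "X \<subseteq> carrier (group_algebra \<mu>)"
      using unit_functions_nonempty unit_classes_carrier by (auto simp: unit_classes_def)
  next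
    fix X E E' assume "X \<in> {unit_classes V | V. open V \<and> 0 \<in> V}" "E \<in> X" "E' \<in> X"
    then obtain V e e' where X: "X = unit_classes V"
        and e: "e \<in> unit_functions V" "e' \<in> unit_functions V"
      and E: "E = ae_class \<mu> (\<lambda>y. complex_of_real (e y))" "E'
          = ae_class \<mu> (\<lambda>y. complex_of_real (e' y))"
      by (auto simp: unit_classes_def)
    have Lp: "(\<lambda>y. complex_of_real (e y)) \<in> Lp_functions 1 \<mu>" "(\<lambda>y. complex_of_real (e' y)) \<in>
        Lp_functions 1 \<mu>"
      using unit_functions_nrm(1)[OF e(1)] unit_functions_nrm(1)[OF e(2)] by (auto intro: Cc_Lp)
    have "(1/2) \<odot>\<^bsub>group_algebra \<mu>\<^esub> (E \<oplus>\<^bsub>group_algebra \<mu>\<^esub> E')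
        = ae_class \<mu> (\<lambda>y. complex_of_real ((1/2) * (e y + e' y)))"
      using Lp by (simp add: E Lp_space_add Lp_space_smult Lp_functions_add)
    then show "(1/2) \<odot>\<^bsub>group_algebra \<mu>\<^esub> (E \<oplus>\<^bsub>group_algebra \<mu>\<^esub> E') \<in> X"
      unfolding X unit_classes_def by (rule image_eqI[OF _ unit_functions_midpoint[OF e]])
  next
    fix X Y assume "X \<in> {unit_classes V | V. open V \<and> 0 \<in> V}" "Y \<in> {unit_classes V | V. open V
        \<and> 0 \<in> V}"
    then obtain V W where VW: "X = unit_classes V" "Y
        = unit_classes W" "open V" "0 \<in> V" "open W" "0 \<in> W"
      by blast
    have "unit_classes (V \<inter> W) \<subseteq> X \<inter> Y"
      unfolding VW unit_classes_def unit_functions_def by blast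
    then show "\<exists>Z\<in>{unit_classes V | V. open V \<and> 0 \<in> V}. Z \<subseteq> X \<inter> Y"
      using VW by blast
  next
    fix X E assume "X \<in> {unit_classes V | V. open V \<and> 0 \<in> V}" "E \<in> X"
    then show "nrm (group_algebra \<mu>) E \<le> 1" using unit_classes_nrm by auto
  next
    fix a and \<epsilon> :: real assume a: "a \<in> carrier (group_algebra \<mu>)" and \<epsilon>: "\<epsilon> > 0"
    then have a': "a \<in> carrier (Lp_space 1 \<mu>)" by simp
    obtain V where V: "open V" "0 \<in> V" "\<And>E. E \<in> unit_classes V \<Longrightarrow>
      nrm (Lp_space 1 \<mu>) (ae_convolution \<mu> E a \<ominus>\<^bsub>Lp_space 1 \<mu>\<^esub> a) < \<epsilon>"
      using left_unit_Lp[OF order_refl a' \<epsilon>] by blast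
    show "\<exists>X\<in>{unit_classes V | V. open V \<and> 0 \<in> V}. \<forall>e\<in>X.
        nrm (group_algebra \<mu>) (e \<otimes>\<^bsub>group_algebra \<mu>\<^esub> a \<ominus>\<^bsub>group_algebra \<mu>\<^esub> a) < \<epsilon>"
      using V a' unit_classes_carrier[of _ V]
      by (intro bexI[of _ "unit_classes V"]) (auto simp: diff ae_convolution_closed)
    obtain V where V: "open V" "0 \<in> V" "\<And>E. E \<in> unit_classes V \<Longrightarrow>
      nrm (Lp_space 1 \<mu>) (ae_convolution \<mu> a E \<ominus>\<^bsub>Lp_space 1 \<mu>\<^esub> a) < \<epsilon>"
      using right_unit_L1[OF a' \<epsilon>] by blast
    show "\<exists>X\<in>{unit_classes V | V. open V \<and> 0 \<in> V}. \<forall>e\<in>X.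
        nrm (group_algebra \<mu>) (a \<otimes>\<^bsub>group_algebra \<mu>\<^esub> e \<ominus>\<^bsub>group_algebra \<mu>\<^esub> a) < \<epsilon>"
      using V a' unit_classes_carrier[of _ V]
      by (intro bexI[of _ "unit_classes V"]) (auto simp: diff ae_convolution_closed)
  qed
qed

end

theorem corollary3p10:
  fixes \<mu> :: "'g::{topological_group_add, t2_space} measure"
    and p :: real
  assumes "locally_compact_space (euclidean :: 'g topology)"
    and "left_haar_measure \<mu>"
    and "1 < p"
  shows "zero_injective TYPE('f) TYPE('k) (group_algebra \<mu>) (Lp_module p \<mu>) \<and>
         zero_injective TYPE('f) TYPE('k) (group_algebra \<mu>) (L1_bidual \<mu>)"
proof
  interpret left_haar_measure \<mu> by fact
  interpret locally_compact_haar \<mu> by unfold_locales fact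
  interpret approximate_identity "group_algebra \<mu>" "{unit_classes V | V. open V \<and> 0 \<in> V}"
    by (rule approximate_identity_group_algebra)
  have p: "1 \<le> p" using assms(3) by simp
  interpret L: complex_normed_space "Lp_space p \<mu>" by (rule complex_normed_space_Lp[OF p])
  show "zero_injective TYPE('f) TYPE('k) (group_algebra \<mu>) (Lp_module p \<mu>)"
  proof (rule zero_injective_uniformly_convex[OF banach_left_module_Lp[OF p]])
    show "uniformly_convex (Lp_module p \<mu>)"
      by (rule uniformly_convex_cong[OF L.complex_normed_space_axioms uniformly_convex_Lp[OF
          assms(3)]])
        simp_all
    fix Y assume "Y \<in> carrier (Lp_module p \<mu>)"
      and zero: "\<And>X. X \<in> carrier (group_algebra \<mu>) \<Longrightarrow> act (Lp_module p \<mu>) X Y = \<zero>\<^bsub>Lp_module p \<mu>\<^esub>"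
    then have Y: "Y \<in> carrier (Lp_space p \<mu>)" by simp
    \<comment> \<open>All convolutions \<open>E * Y\<close> vanish, yet by the left units they come
      arbitrarily close to \<open>Y\<close>.\<close>
    have "\<zero>\<^bsub>Lp_space p \<mu>\<^esub> = Y"
    proof (rule L.eq_if_nrm_diff_small[OF _ Y])
      fix e :: real assume e: "e > 0"
      obtain V where V: "open V" "0 \<in> V" "\<And>E. E \<in> unit_classes V \<Longrightarrow>
        nrm (Lp_space p \<mu>) (ae_convolution \<mu> E Y \<ominus>\<^bsub>Lp_space p \<mu>\<^esub> Y) < e"
        using left_unit_Lp[OF p Y e] by blast
      obtain E where E: "E \<in> unit_classes V"
        using unit_functions_nonempty[OF V(1,2)] by (auto simp: unit_classes_def)
      then show "nrm (Lp_space p \<mu>) (\<zero>\<^bsub>Lp_space p \<mu>\<^esub> \<ominus>\<^bsub>Lp_space p \<mu>\<^esub> Y) \<le> e"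
        using V(3)[OF E] zero[of E] unit_classes_carrier[OF E] by simp
    qed simp
    then show "Y = \<zero>\<^bsub>Lp_module p \<mu>\<^esub>" by simp
  qed
  \<comment> \<open>The bidual is the dual of the right module
    \<open>dual_module (Lp_module 1 \<mu>)\<close>, which counts as a left module over the opposite
    algebra. To obtain that by the same duality lemma, \<open>Lp_module 1 \<mu>\<close> is viewed
    over the twice opposite algebra.\<close>
  have "banach_left_module (opposite_algebra (opposite_algebra (group_algebra \<mu>))) (Lp_module 1 \<mu>)"
    by (simp only: opposite_opposite banach_left_module_Lp[OF order_refl])
  then have "banach_left_module (opposite_algebra (group_algebra \<mu>)) (dual_module (Lp_module 1 \<mu>))"
    by (rule banach_left_module_dual)
  then show "zero_injective TYPE('f) TYPE('k) (group_algebra \<mu>) (L1_bidual \<mu>)"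
    unfolding L1_bidual_def by (rule zero_injective_dual_module)
qed

end
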